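(* Let $k$ be an algebraically closed field of characteristic zero and $G$ a finite group. Let $R$ be the set of reflections $r_{H,C,\delta}\in\mathrm{Aut}_{Hopf}(DG)$ and $\mathrm P_c(kG,k^G)$ the set of central bialgebra pairings, regarded as lazy 2-cocycles on $DG^*$ (see context). (i) Consider the subset $R\times\mathrm P_c(kG,k^G)$ of $\mathrm{Aut}_{Hopf}(DG)\ltimes\mathrm Z^2_L(DG^* )$. An element $(r,\lambda)$, $r=r_{H,C,\delta}$, corresponds to the monoidal functor $\Psi(r,\lambda)=(F_r,J^\lambda)$ given on simple objects by $$F_r(\mathcal O_{hc}^{\rho_H\rho_C})=\mathcal O_{\delta^{-1}(\rho_C)h}^{\rho_H\delta(c)},$$ where group elements and representations are decomposed according to the choice $G=H\times C$ into $h\in H$, $c\in C$, and irreducible representations $\rho_H$ of $\mathrm{Cent}_H(h)$, $\rho_C$ of $\mathrm{Cent}_C(c)=C$. The monoidal structure $J^\lambda$ is, with $\rho=\rho_H\rho_C$, $$\mathcal O_{\delta^{-1}(\rho_C)h}^{\rho_H\delta(c)}\otimes\mathcal O_{\delta^{-1}(\chi_C)h'}^{\chi_H\delta(c')}\to F_r(\mathcal O_{hc}^{\rho_H\rho_C}\otimes\mathcal O_{h'c'}^{\chi_H\chi_C}),$$ $$(s_m\otimes v)\otimes(r_n\otimes w)\mapsto\sum_{i;\ z\in\mathrm{Cent}(hc)}\lambda\big((h'c')_n,e_{s_izs_m^{-1}}\big)\,[s_i\otimes\rho(z)(v)]\otimes(r_n\otimes w),$$ where $\{s_m\},\{r_n\}\subset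 G$ are choices of representatives of $G/\mathrm{Cent}(hc)$ and $G/\mathrm{Cent}(h'c')$, and $(h'c')_n=r_nh'c'r_n^{-1}$. (ii) Define the following set, uniquely parametrized by decompositions $G=H\times C$: $$\underline{\mathcal R}_L:=\{(r_{H,C,\delta},\lambda)\in R\times\mathrm P_c(kG,k^G)\mid\lambda(hc,e_{h'c'})=\delta_{c,c'}\,\epsilon(h)\,\epsilon(e_{h'})\}$$ (the condition being for all $h,h'\in H$, $c,c'\in C$, with $\delta_{c,c'}$ the Kronecker delta). Then $\Psi(r_{H,C,\delta},\lambda)$ is a braided autoequivalence if and only if $(r_{H,C,\delta},\lambda)\in\underline{\mathcal R}_L$. (iii) For $(r_{H,C,\delta},\lambda)\in\underline{\mathcal R}_L$ the monoidal structure of $\Psi(r_{H,C,\delta},\lambda)$ simplifies to $$\mathcal O_{\delta^{-1}(\rho_C)h}^{\rho_H\delta(c)}\otimes\mathcal O_{\delta^{-1}(\chi_C)h'}^{\chi_H\delta(c')}\to F_r(\mathcal O_{hc}^{\rho_H\rho_C}\otimes\mathcal O_{h'c'}^{\chi_H\chi_C}),\quad m\otimes n\mapsto\rho_C(c')\cdot(m\otimes n).$$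
   Context: **Basics.** $\widehat A=\mathrm{Hom}(A,k^\times)$; $g^h=h^{-1}gh$, ${}^hg=hgh^{-1}$. $k^G=(kG)^*$ has basis $e_x$ ($e_x(y)=\delta_{x,y}$), $\epsilon(e_x)=\delta_{x,1}$. $DG$ has basis $e_x\times y$, $(e_x\times y)(e_{x'}\times y')=e_x({}^yx')(e_x\times yy')$, $\Delta(e_x\times y)=\sum_{x_1x_2=x}(e_{x_1}\times y)\otimes(e_{x_2}\times y)$, $\epsilon(e_x\times y)=\delta_{x,1}$. $DG^*$ has dual basis $g\times e_x$ (dual to $e_g\times x$), $(x\times e_y)(x'\times e_{y'})=xx'\times e_ye_{y'}$, $\Delta(x\times e_y)=\sum_{y_1y_2=y}(x\times e_{y_1})\otimes(x^{y_1}\times e_{y_2})$. $DG\text{-mod}$ is braided by $c_{M,N}(m\otimes n)=R_2.n\otimes R_1.m$, with $R$-matrix $\sum_g(e_g\times1)\otimes(1\times g)=R_1\otimes R_2$. **Simple objects.** $\mathcal O_g^\rho=kG\otimes_{k\mathrm{Cent}(g)}W$ for $g\in G$ and $\rho:\mathrm{Cent}(g)\to\mathrm{GL}(W)$ irreducible, with $(e_h\times t).(y\otimes w)=e_h((ty)g(ty)^{-1})\,(ty\otimes w)$. **Reflections.** The set $R$ consists of the Hopf automorphisms $r_{H,C,\delta}$ of $DG$ for triples $(H,C,\delta)$, where $H,C$ are subgroups of $G$ with $C$ abelian and $G=H\times C$, and $\delta:kC\to k^C$ is a Hopf algebra isomorphism (equivalently, a group isomorphism $C\to\widehat C$): $$r_{H,C,\delta}:(f_H,f_C)\times(h,c)\mapsto(f_H,\delta(c))\times(h,\delta^{-1}(f_C)),\quad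 f_H\in k^H,f_C\in k^C,h\in H,c\in C.$$ **Lazy cocycles.** A 2-cocycle on a Hopf algebra $K$ is a convolution invertible $\sigma:K\otimes K\to k$ with $\sigma(1,b)=\epsilon(b)=\sigma(b,1)$ and $\sigma(a_1,b_1)\sigma(a_2b_2,c)=\sigma(b_1,c_1)\sigma(a,b_2c_2)$; it is lazy if $\sigma(a_1,b_1)a_2b_2=a_1b_1\sigma(a_2,b_2)$. $\mathrm Z^2_L(K)$ is the group (under convolution) of lazy 2-cocycles. A cocycle $\sigma$ on $DG^*$ is identified with $\sigma_1\otimes\sigma_2=\sum\sigma(g\times e_x,h\times e_y)(e_g\times x)\otimes(e_h\times y)\in DG\otimes DG$. $\mathrm P_c(kG,k^G)\cong\mathrm{Hom}(G,Z(G))$: central bialgebra pairings $\lambda:kG\times k^G\to k$, i.e. $\lambda(g,f)=f(p(g))$ for some homomorphism $p:G\to Z(G)$; $\lambda$ is regarded as the lazy cocycle $\sigma_\lambda(g\times e_x,h\times e_y)=\lambda(g,e_y)\epsilon(e_x)$ on $DG^*$. **Functors.** Every $\phi\in\mathrm{Aut}_{Hopf}(DG)$ is uniquely of the form $\phi(f\times g)=u(f_{(1)})b(g)\times a(f_{(2)})v(g)$ with $u\in\mathrm{End}_{Hopf}(k^G)$, Hopf maps $b:kG\to k^G$, $a:k^G\to kG$ and $v\in\mathrm{End}(G)$; put $\phi^\dagger(f\times g)=v^*(f_{(1)})b^*(g)\times a^*(f_{(2)})u^*(g)$ ($*$ = dual map). $\Psi(\phi,\sigma)=(F_\phi,J^\sigma)$,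 where $F_\phi(M)={}_\phi M$ is $M$ with $h\in DG$ acting by $\phi^\dagger(h)$, and $J^\sigma_{M,N}:{}_\phi M\otimes{}_\phi N\to{}_\phi(M\otimes N)$, $m\otimes n\mapsto\sigma_1.m\otimes\sigma_2.n$ (original actions). The group law on $\mathrm{Aut}_{Hopf}(DG)\ltimes\mathrm Z^2_L(DG^* )$ corresponds to composition of functors: $(\phi,\sigma)(\phi',\sigma')=(\phi\phi',\sigma'\cdot(\phi'^\dagger\otimes\phi'^\dagger)(\sigma))$, product in $DG\otimes DG$.
   Formalization: In (ii), Ψ is braided iff (r,λ) lies in R_L and also δ(c)(c')=δ(c')(c) for all c,c' in C (it fails for non-symmetric δ); λ is regarded as the cocycle σ_λ(g×e_x,h×e_y)=λ(h,e_x)ε(e_y), the side required by the formulas in (i) and (iii), not the context's λ(g,e_y)ε(e_x). *)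

theory Defs
  imports "HOL-Algebra.Algebra" "HOL-Library.Function_Algebras" "HOL-Library.Nat_Bijection"
    "HOL-Computational_Algebra.Polynomial"
begin

section \<open>Coordinate vector spaces\<close>

text \<open>A finite-dimensional space with basis \<open>B\<close> is the set of coordinate functions supported
  on \<open>B\<close>; addition is pointwise.\<close>

definition vecs :: "'i set \<Rightarrow> ('i \<Rightarrow> 'k::field) set" where
  "vecs B = {v. \<forall>i. i \<notin> B \<longrightarrow> v i = 0}"

definition ket :: "'i \<Rightarrow> 'i \<Rightarrow> 'k::field" where
  "ket i = (\<lambda>j. if j = i then 1 else 0)"

definition scl :: "'k::field \<Rightarrow> ('i \<Rightarrow> 'k) \<Rightarrow> 'i \<Rightarrow> 'k" (infixr "\<cdot>\<^sub>v" 75) where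
  "c \<cdot>\<^sub>v v = (\<lambda>i. c * v i)"

definition linear_between :: "'i set \<Rightarrow> 'j set \<Rightarrow> (('i \<Rightarrow> 'k::field) \<Rightarrow> 'j \<Rightarrow> 'k) \<Rightarrow> bool" where
  "linear_between A B f \<longleftrightarrow> f \<in> vecs A \<rightarrow> vecs B \<and>
     (\<forall>v\<in>vecs A. \<forall>w\<in>vecs A. f (v + w) = f v + f w) \<and>
     (\<forall>c. \<forall>v\<in>vecs A. f (c \<cdot>\<^sub>v v) = c \<cdot>\<^sub>v f v)"

definition lin_ext :: "'i set \<Rightarrow> ('i \<Rightarrow> 'j \<Rightarrow> 'k::field) \<Rightarrow> ('i \<Rightarrow> 'k) \<Rightarrow> 'j \<Rightarrow> 'k" where
  "lin_ext B f v = (\<Sum>i\<in>B. v i \<cdot>\<^sub>v f i)"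

definition pure :: "('i \<Rightarrow> 'k::field) \<Rightarrow> ('j \<Rightarrow> 'k) \<Rightarrow> 'i \<times> 'j \<Rightarrow> 'k" where
  "pure v w = (\<lambda>(i, j). v i * w j)"

definition map_pure :: "'i set \<Rightarrow> 'j set \<Rightarrow> (('i \<Rightarrow> 'k::field) \<Rightarrow> 'm \<Rightarrow> 'k) \<Rightarrow>
    (('j \<Rightarrow> 'k) \<Rightarrow> 'n \<Rightarrow> 'k) \<Rightarrow> ('i \<times> 'j \<Rightarrow> 'k) \<Rightarrow> 'm \<times> 'n \<Rightarrow> 'k" where
  "map_pure A B f g = lin_ext (A \<times> B) (\<lambda>(i, j). pure (f (ket i)) (g (ket j)))"

text \<open>The dual of \<open>f : vecs A \<rightarrow> vecs B\<close>, in dual bases.\<close>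

definition dual_map :: "'i set \<Rightarrow> 'j set \<Rightarrow> (('i \<Rightarrow> 'k::field) \<Rightarrow> 'j \<Rightarrow> 'k) \<Rightarrow> ('j \<Rightarrow> 'k) \<Rightarrow> 'i \<Rightarrow> 'k" where
  "dual_map A B f \<xi> = (\<lambda>i. if i \<in> A then \<Sum>j\<in>B. \<xi> j * f (ket i) j else 0)"

section \<open>Bialgebras given by structure constants\<close>

record ('i, 'k) bialg =
  bas :: "'i set"
  mulc :: "'i \<Rightarrow> 'i \<Rightarrow> 'i \<Rightarrow> 'k"
  unitc :: "'i \<Rightarrow> 'k"
  comulc :: "'i \<Rightarrow> 'i \<times> 'i \<Rightarrow> 'k"
  counitc :: "'i \<Rightarrow> 'k"

definition bmul :: "('i, 'k::field) bialg \<Rightarrow> ('i \<Rightarrow> 'k) \<Rightarrow> ('i \<Rightarrow> 'k) \<Rightarrow> 'i \<Rightarrow> 'k" where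
  "bmul A v w = (\<Sum>i\<in>bas A. \<Sum>j\<in>bas A. (v i * w j) \<cdot>\<^sub>v mulc A i j)"

definition bcomul :: "('i, 'k::field) bialg \<Rightarrow> ('i \<Rightarrow> 'k) \<Rightarrow> 'i \<times> 'i \<Rightarrow> 'k" where
  "bcomul A = lin_ext (bas A) (comulc A)"

definition bcounit :: "('i, 'k::field) bialg \<Rightarrow> ('i \<Rightarrow> 'k) \<Rightarrow> 'k" where
  "bcounit A v = (\<Sum>i\<in>bas A. v i * counitc A i)"

text \<open>Homomorphisms of bialgebras; between Hopf algebras these automatically commute with the
  antipodes, so they are the Hopf algebra homomorphisms.\<close>

definition hopf_hom :: "('i, 'k::field) bialg \<Rightarrow> ('j, 'k) bialg \<Rightarrow> (('i \<Rightarrow> 'k) \<Rightarrow> 'j \<Rightarrow> 'k) set" where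
  "hopf_hom A B = {f. linear_between (bas A) (bas B) f \<and>
     (\<forall>v\<in>vecs (bas A). \<forall>w\<in>vecs (bas A). f (bmul A v w) = bmul B (f v) (f w)) \<and>
     f (unitc A) = unitc B \<and>
     (\<forall>v\<in>vecs (bas A). bcomul B (f v) = map_pure (bas A) (bas A) f f (bcomul A v)) \<and>
     (\<forall>v\<in>vecs (bas A). bcounit B (f v) = bcounit A v)}"

definition hopf_iso :: "('i, 'k::field) bialg \<Rightarrow> ('j, 'k) bialg \<Rightarrow> (('i \<Rightarrow> 'k) \<Rightarrow> 'j \<Rightarrow> 'k) set" where
  "hopf_iso A B = {f \<in> hopf_hom A B. bij_betw f (vecs (bas A)) (vecs (bas B))}"

abbreviation hopf_aut :: "('i, 'k::field) bialg \<Rightarrow> (('i \<Rightarrow> 'k) \<Rightarrow> 'i \<Rightarrow> 'k) set" where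
  "hopf_aut A \<equiv> hopf_iso A A"

text \<open>The group algebra \<open>kG\<close> (\<open>ket g\<close> is the group element \<open>g\<close>) and the function algebra
  \<open>k\<^sup>G\<close> (\<open>ket x\<close> is the delta function \<open>e\<^sub>x\<close>, and the coordinates of a function
  are its values).\<close>

definition group_alg :: "('g, 'm) monoid_scheme \<Rightarrow> ('g, 'k::field) bialg" where
  "group_alg G = \<lparr>bas = carrier G,
     mulc = (\<lambda>g h. ket (g \<otimes>\<^bsub>G\<^esub> h)),
     unitc = ket \<one>\<^bsub>G\<^esub>,
     comulc = (\<lambda>g. ket (g, g)),
     counitc = (\<lambda>g. 1)\<rparr>"

definition fun_alg :: "('g, 'm) monoid_scheme \<Rightarrow> ('g, 'k::field) bialg" where
  "fun_alg G = \<lparr>bas = carrier G,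
     mulc = (\<lambda>x y. if x = y then ket x else 0),
     unitc = (\<lambda>x. if x \<in> carrier G then 1 else 0),
     comulc = (\<lambda>x (y, z). if y \<in> carrier G \<and> z \<in> carrier G \<and> y \<otimes>\<^bsub>G\<^esub> z = x then 1 else 0),
     counitc = (\<lambda>x. if x = \<one>\<^bsub>G\<^esub> then 1 else 0)\<rparr>"

text \<open>In \<open>DG\<close> the pair \<open>(x, y)\<close> stands for \<open>e\<^sub>x \<times> y\<close>; in \<open>DG\<^sup>*\<close> it stands for the dual
  basis element \<open>x \<times> e\<^sub>y\<close>.\<close>

definition drinfeld :: "('g, 'm) monoid_scheme \<Rightarrow> ('g \<times> 'g, 'k::field) bialg" where
  "drinfeld G = \<lparr>bas = carrier G \<times> carrier G,
     mulc = (\<lambda>(x, y) (x', y').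
       if x = y \<otimes>\<^bsub>G\<^esub> x' \<otimes>\<^bsub>G\<^esub> inv\<^bsub>G\<^esub> y then ket (x, y \<otimes>\<^bsub>G\<^esub> y') else 0),
     unitc = (\<lambda>(x, y). if x \<in> carrier G \<and> y = \<one>\<^bsub>G\<^esub> then 1 else 0),
     comulc = (\<lambda>(x, y) ((x1, y1), (x2, y2)).
       if x1 \<in> carrier G \<and> x2 \<in> carrier G \<and> x1 \<otimes>\<^bsub>G\<^esub> x2 = x \<and> y1 = y \<and> y2 = y then 1 else 0),
     counitc = (\<lambda>(x, y). if x = \<one>\<^bsub>G\<^esub> then 1 else 0)\<rparr>"

definition drinfeld_dual :: "('g, 'm) monoid_scheme \<Rightarrow> ('g \<times> 'g, 'k::field) bialg" where
  "drinfeld_dual G = \<lparr>bas = carrier G \<times> carrier G,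
     mulc = (\<lambda>(x, y) (x', y'). if y = y' then ket (x \<otimes>\<^bsub>G\<^esub> x', y) else 0),
     unitc = (\<lambda>(x, y). if x = \<one>\<^bsub>G\<^esub> \<and> y \<in> carrier G then 1 else 0),
     comulc = (\<lambda>(x, y) ((x1, y1), (x2, y2)).
       if y1 \<in> carrier G \<and> y2 \<in> carrier G \<and> y1 \<otimes>\<^bsub>G\<^esub> y2 = y \<and>
          x1 = x \<and> x2 = inv\<^bsub>G\<^esub> y1 \<otimes>\<^bsub>G\<^esub> x \<otimes>\<^bsub>G\<^esub> y1 then 1 else 0),
     counitc = (\<lambda>(x, y). if y = \<one>\<^bsub>G\<^esub> then 1 else 0)\<rparr>"

section \<open>Lazy 2-cocycles\<close>

text \<open>A bilinear form on a bialgebra is given by its values on pairs of basis elements.\<close>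

definition bil :: "('i, 'k::field) bialg \<Rightarrow> ('i \<times> 'i \<Rightarrow> 'k) \<Rightarrow> ('i \<Rightarrow> 'k) \<Rightarrow> ('i \<Rightarrow> 'k) \<Rightarrow> 'k" where
  "bil A \<sigma> v w = (\<Sum>i\<in>bas A. \<Sum>j\<in>bas A. v i * w j * \<sigma> (i, j))"

definition conv :: "('i, 'k::field) bialg \<Rightarrow> ('i \<times> 'i \<Rightarrow> 'k) \<Rightarrow> ('i \<times> 'i \<Rightarrow> 'k) \<Rightarrow> 'i \<times> 'i \<Rightarrow> 'k" where
  "conv A \<sigma> \<tau> = (\<lambda>(a, b). \<Sum>(a1, a2)\<in>bas A \<times> bas A. \<Sum>(b1, b2)\<in>bas A \<times> bas A.
     comulc A a (a1, a2) * comulc A b (b1, b2) * \<sigma> (a1, b1) * \<tau> (a2, b2))"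

definition conv_invertible :: "('i, 'k::field) bialg \<Rightarrow> ('i \<times> 'i \<Rightarrow> 'k) \<Rightarrow> bool" where
  "conv_invertible A \<sigma> \<longleftrightarrow> (\<exists>\<tau>. \<forall>a\<in>bas A. \<forall>b\<in>bas A.
     conv A \<sigma> \<tau> (a, b) = counitc A a * counitc A b \<and>
     conv A \<tau> \<sigma> (a, b) = counitc A a * counitc A b)"

definition cocycles :: "('i, 'k::field) bialg \<Rightarrow> ('i \<times> 'i \<Rightarrow> 'k) set" where
  "cocycles A = {\<sigma> \<in> vecs (bas A \<times> bas A). conv_invertible A \<sigma> \<and>
     (\<forall>b\<in>bas A. bil A \<sigma> (unitc A) (ket b) = counitc A b \<and> bil A \<sigma> (ket b) (unitc A) = counitc A b) \<and>
     (\<forall>a\<in>bas A. \<forall>b\<in>bas A. \<forall>c\<in>bas A.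
       (\<Sum>(a1, a2)\<in>bas A \<times> bas A. \<Sum>(b1, b2)\<in>bas A \<times> bas A.
          comulc A a (a1, a2) * comulc A b (b1, b2) * \<sigma> (a1, b1) * bil A \<sigma> (mulc A a2 b2) (ket c))
     = (\<Sum>(b1, b2)\<in>bas A \<times> bas A. \<Sum>(c1, c2)\<in>bas A \<times> bas A.
          comulc A b (b1, b2) * comulc A c (c1, c2) * \<sigma> (b1, c1) * bil A \<sigma> (ket a) (mulc A b2 c2)))}"

definition lazy_cocycles :: "('i, 'k::field) bialg \<Rightarrow> ('i \<times> 'i \<Rightarrow> 'k) set" where
  "lazy_cocycles A = {\<sigma> \<in> cocycles A. \<forall>a\<in>bas A. \<forall>b\<in>bas A.
       (\<Sum>(a1, a2)\<in>bas A \<times> bas A. \<Sum>(b1, b2)\<in>bas A \<times> bas A.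
          (comulc A a (a1, a2) * comulc A b (b1, b2) * \<sigma> (a1, b1)) \<cdot>\<^sub>v mulc A a2 b2)
     = (\<Sum>(a1, a2)\<in>bas A \<times> bas A. \<Sum>(b1, b2)\<in>bas A \<times> bas A.
          (comulc A a (a1, a2) * comulc A b (b1, b2) * \<sigma> (a2, b2)) \<cdot>\<^sub>v mulc A a1 b1)}"

definition group_center :: "('g, 'm) monoid_scheme \<Rightarrow> 'g set" where
  "group_center G = {z \<in> carrier G. \<forall>x\<in>carrier G. z \<otimes>\<^bsub>G\<^esub> x = x \<otimes>\<^bsub>G\<^esub> z}"

definition central_pairings :: "('g, 'm) monoid_scheme \<Rightarrow> (('g \<Rightarrow> 'k::field) \<Rightarrow> ('g \<Rightarrow> 'k) \<Rightarrow> 'k) set" where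
  "central_pairings G = {\<lambda>a f. \<Sum>g\<in>carrier G. a g * f (p g) | p. p \<in> hom G (G\<lparr>carrier := group_center G\<rparr>)}"

text \<open>The value of the cocycle on \<open>(g \<times> e\<^sub>x, h \<times> e\<^sub>y)\<close> is \<open>l(h, e\<^sub>x) \<epsilon>(e\<^sub>y)\<close>. Of the two possible
  sides for the pairing this is the one for which the function part acts on the left tensor factor
  and the degree is read off the right factor, i.e. \<open>m \<otimes> n \<mapsto> p(deg n).m \<otimes> n\<close>.\<close>

definition pairing_cocycle :: "('g, 'm) monoid_scheme \<Rightarrow> (('g \<Rightarrow> 'k::field) \<Rightarrow> ('g \<Rightarrow> 'k) \<Rightarrow> 'k) \<Rightarrow>
    ('g \<times> 'g) \<times> ('g \<times> 'g) \<Rightarrow> 'k" where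
  "pairing_cocycle G l = (\<lambda>((g, x), (h, y)).
     if g \<in> carrier G \<and> x \<in> carrier G \<and> h \<in> carrier G \<and> y \<in> carrier G
     then l (ket h) (ket x) * bcounit (fun_alg G) (ket y) else 0)"

section \<open>The category of finite-dimensional \<open>DG\<close>-modules\<close>

text \<open>The basis of a module is a finite set of natural numbers, so that all
  modules live in one type; the basis of a tensor product is coded by \<^const>\<open>prod_encode\<close>.\<close>

record ('g, 'k) dg_mod =
  idx :: "nat set"
  act :: "('g \<times> 'g \<Rightarrow> 'k) \<Rightarrow> (nat \<Rightarrow> 'k) \<Rightarrow> nat \<Rightarrow> 'k"

definition dg_modules :: "('g, 'm) monoid_scheme \<Rightarrow> ('g, 'k::field) dg_mod set" where
  "dg_modules G = {M. finite (idx M) \<and>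
     (\<forall>a\<in>vecs (carrier G \<times> carrier G). linear_between (idx M) (idx M) (act M a)) \<and>
     (\<forall>a\<in>vecs (carrier G \<times> carrier G). \<forall>b\<in>vecs (carrier G \<times> carrier G). \<forall>v\<in>vecs (idx M).
        act M (a + b) v = act M a v + act M b v \<and>
        act M (bmul (drinfeld G) a b) v = act M a (act M b v)) \<and>
     (\<forall>c. \<forall>a\<in>vecs (carrier G \<times> carrier G). \<forall>v\<in>vecs (idx M). act M (c \<cdot>\<^sub>v a) v = c \<cdot>\<^sub>v act M a v) \<and>
     (\<forall>v\<in>vecs (idx M). act M (unitc (drinfeld G)) v = v)}"

type_synonym 'k lmap = "(nat \<Rightarrow> 'k) \<Rightarrow> nat \<Rightarrow> 'k"

definition lmaps :: "nat set \<Rightarrow> nat set \<Rightarrow> 'k::field lmap set" where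
  "lmaps A B = {f \<in> extensional (vecs A). linear_between A B f}"

definition dg_hom :: "('g, 'm) monoid_scheme \<Rightarrow> ('g, 'k::field) dg_mod \<Rightarrow> ('g, 'k) dg_mod \<Rightarrow> 'k lmap set" where
  "dg_hom G M N = {f \<in> lmaps (idx M) (idx N).
     \<forall>a\<in>vecs (carrier G \<times> carrier G). \<forall>v\<in>vecs (idx M). f (act M a v) = act N a (f v)}"

definition id_mor :: "('g, 'k::field) dg_mod \<Rightarrow> 'k lmap" where
  "id_mor M = restrict (\<lambda>v. v) (vecs (idx M))"

abbreviation comp_mor :: "('g, 'k::field) dg_mod \<Rightarrow> 'k lmap \<Rightarrow> 'k lmap \<Rightarrow> 'k lmap" where
  "comp_mor M g f \<equiv> compose (vecs (idx M)) g f"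

definition dg_iso :: "('g, 'm) monoid_scheme \<Rightarrow> ('g, 'k::field) dg_mod \<Rightarrow> ('g, 'k) dg_mod \<Rightarrow> 'k lmap set" where
  "dg_iso G M N = {f \<in> dg_hom G M N. \<exists>g\<in>dg_hom G N M.
     comp_mor M g f = id_mor M \<and> comp_mor N f g = id_mor N}"

definition vtens :: "(nat \<Rightarrow> 'k::field) \<Rightarrow> (nat \<Rightarrow> 'k) \<Rightarrow> nat \<Rightarrow> 'k" (infixl "\<otimes>\<^sub>v" 76) where
  "v \<otimes>\<^sub>v w = (\<lambda>n. pure v w (prod_decode n))"

definition tens_idx :: "nat set \<Rightarrow> nat set \<Rightarrow> nat set" where
  "tens_idx A B = prod_encode ` (A \<times> B)"

definition tens_lin :: "nat set \<Rightarrow> nat set \<Rightarrow> 'k::field lmap \<Rightarrow> 'k lmap \<Rightarrow> 'k lmap" where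
  "tens_lin A B f g t = (\<Sum>i\<in>A. \<Sum>j\<in>B. t (prod_encode (i, j)) \<cdot>\<^sub>v (f (ket i) \<otimes>\<^sub>v g (ket j)))"

text \<open>The action of \<open>S = S\<^sub>1 \<otimes> S\<^sub>2 \<in> DG \<otimes> DG\<close> on \<open>M \<otimes> N\<close>.\<close>

definition act2 :: "('g, 'm) monoid_scheme \<Rightarrow> ('g, 'k::field) dg_mod \<Rightarrow> ('g, 'k) dg_mod \<Rightarrow>
    (('g \<times> 'g) \<times> ('g \<times> 'g) \<Rightarrow> 'k) \<Rightarrow> 'k lmap" where
  "act2 G M N S t = (\<Sum>p\<in>carrier G \<times> carrier G. \<Sum>q\<in>carrier G \<times> carrier G.
     S (p, q) \<cdot>\<^sub>v tens_lin (idx M) (idx N) (act M (ket p)) (act N (ket q)) t)"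

definition tens_mod :: "('g, 'm) monoid_scheme \<Rightarrow> ('g, 'k::field) dg_mod \<Rightarrow> ('g, 'k) dg_mod \<Rightarrow> ('g, 'k) dg_mod" where
  "tens_mod G M N = \<lparr>idx = tens_idx (idx M) (idx N),
     act = (\<lambda>a. act2 G M N (bcomul (drinfeld G) a))\<rparr>"

definition tens_mor :: "('g, 'k::field) dg_mod \<Rightarrow> ('g, 'k) dg_mod \<Rightarrow> 'k lmap \<Rightarrow> 'k lmap \<Rightarrow> 'k lmap" where
  "tens_mor M N f g = restrict (tens_lin (idx M) (idx N) f g) (vecs (tens_idx (idx M) (idx N)))"

definition unit_mod :: "('g, 'm) monoid_scheme \<Rightarrow> ('g, 'k::field) dg_mod" where
  "unit_mod G = \<lparr>idx = {0}, act = (\<lambda>a v. bcounit (drinfeld G) a \<cdot>\<^sub>v v)\<rparr>"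

text \<open>\<open>assoc_mor : (M \<otimes> N) \<otimes> L \<rightarrow> M \<otimes> (N \<otimes> L)\<close>, \<open>lunit_mor : 1 \<otimes> M \<rightarrow> M\<close> and
  \<open>runit_mor : M \<otimes> 1 \<rightarrow> M\<close>.\<close>

definition assoc_mor :: "('g, 'm) monoid_scheme \<Rightarrow> ('g, 'k::field) dg_mod \<Rightarrow> ('g, 'k) dg_mod \<Rightarrow> ('g, 'k) dg_mod \<Rightarrow> 'k lmap" where
  "assoc_mor G M N L = restrict
     (\<lambda>t n. let (i, m) = prod_decode n; (j, l) = prod_decode m
            in t (prod_encode (prod_encode (i, j), l)))
     (vecs (idx (tens_mod G (tens_mod G M N) L)))"

definition lunit_mor :: "('g, 'm) monoid_scheme \<Rightarrow> ('g, 'k::field) dg_mod \<Rightarrow> 'k lmap" where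
  "lunit_mor G M = restrict (\<lambda>t i. t (prod_encode (0, i))) (vecs (idx (tens_mod G (unit_mod G) M)))"

definition runit_mor :: "('g, 'm) monoid_scheme \<Rightarrow> ('g, 'k::field) dg_mod \<Rightarrow> 'k lmap" where
  "runit_mor G M = restrict (\<lambda>t i. t (prod_encode (i, 0))) (vecs (idx (tens_mod G M (unit_mod G))))"

text \<open>The \<open>R\<close>-matrix \<open>\<Sum>\<^sub>g (e\<^sub>g \<times> 1) \<otimes> (1 \<times> g)\<close> and the braiding
  \<open>m \<otimes> n \<mapsto> R\<^sub>2.n \<otimes> R\<^sub>1.m\<close>.\<close>

definition r_matrix :: "('g, 'm) monoid_scheme \<Rightarrow> ('g \<times> 'g) \<times> ('g \<times> 'g) \<Rightarrow> 'k::field" where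
  "r_matrix G = (\<Sum>g\<in>carrier G. pure (ket (g, \<one>\<^bsub>G\<^esub>)) (\<lambda>(x, y). if x \<in> carrier G \<and> y = g then 1 else 0))"

definition flip :: "'k lmap" where
  "flip t = (\<lambda>n. let (i, j) = prod_decode n in t (prod_encode (j, i)))"

definition braiding :: "('g, 'm) monoid_scheme \<Rightarrow> ('g, 'k::field) dg_mod \<Rightarrow> ('g, 'k) dg_mod \<Rightarrow> 'k lmap" where
  "braiding G M N = restrict (\<lambda>t. flip (act2 G M N (r_matrix G) t)) (vecs (idx (tens_mod G M N)))"

section \<open>Braided monoidal autoequivalences\<close>

record ('g, 'k) dg_functor =
  obj :: "('g, 'k) dg_mod \<Rightarrow> ('g, 'k) dg_mod"
  mor :: "('g, 'k) dg_mod \<Rightarrow> ('g, 'k) dg_mod \<Rightarrow> 'k lmap \<Rightarrow> 'k lmap"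

definition is_functor :: "('g, 'm) monoid_scheme \<Rightarrow> ('g, 'k::field) dg_functor \<Rightarrow> bool" where
  "is_functor G F \<longleftrightarrow>
     (\<forall>M\<in>dg_modules G. obj F M \<in> dg_modules G \<and> mor F M M (id_mor M) = id_mor (obj F M)) \<and>
     (\<forall>M\<in>dg_modules G. \<forall>N\<in>dg_modules G. \<forall>f\<in>dg_hom G M N.
        mor F M N f \<in> dg_hom G (obj F M) (obj F N)) \<and>
     (\<forall>M\<in>dg_modules G. \<forall>N\<in>dg_modules G. \<forall>L\<in>dg_modules G. \<forall>f\<in>dg_hom G M N. \<forall>g\<in>dg_hom G N L.
        mor F M L (comp_mor M g f) = comp_mor (obj F M) (mor F N L g) (mor F M N f))"

definition id_functor :: "('g, 'k::field) dg_functor" where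
  "id_functor = \<lparr>obj = (\<lambda>M. M), mor = (\<lambda>M N f. f)\<rparr>"

definition comp_functor :: "('g, 'k::field) dg_functor \<Rightarrow> ('g, 'k) dg_functor \<Rightarrow> ('g, 'k) dg_functor" where
  "comp_functor Q F = \<lparr>obj = (\<lambda>M. obj Q (obj F M)),
     mor = (\<lambda>M N f. mor Q (obj F M) (obj F N) (mor F M N f))\<rparr>"

definition nat_iso :: "('g, 'm) monoid_scheme \<Rightarrow> ('g, 'k::field) dg_functor \<Rightarrow> ('g, 'k) dg_functor \<Rightarrow>
    (('g, 'k) dg_mod \<Rightarrow> 'k lmap) \<Rightarrow> bool" where
  "nat_iso G F F' \<eta> \<longleftrightarrow>
     (\<forall>M\<in>dg_modules G. \<eta> M \<in> dg_iso G (obj F M) (obj F' M)) \<and>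
     (\<forall>M\<in>dg_modules G. \<forall>N\<in>dg_modules G. \<forall>f\<in>dg_hom G M N.
        comp_mor (obj F M) (\<eta> N) (mor F M N f) = comp_mor (obj F M) (mor F' M N f) (\<eta> M))"

definition is_autoequivalence :: "('g, 'm) monoid_scheme \<Rightarrow> ('g, 'k::field) dg_functor \<Rightarrow> bool" where
  "is_autoequivalence G F \<longleftrightarrow> is_functor G F \<and> (\<exists>Q. is_functor G Q \<and>
     (\<exists>\<eta>. nat_iso G id_functor (comp_functor Q F) \<eta>) \<and>
     (\<exists>\<epsilon>. nat_iso G (comp_functor F Q) id_functor \<epsilon>))"

type_synonym ('g, 'k) mon_str = "('g, 'k) dg_mod \<Rightarrow> ('g, 'k) dg_mod \<Rightarrow> 'k lmap"

text \<open>Strong monoidal functors, \<open>J M N : F M \<otimes> F N \<rightarrow> F (M \<otimes> N)\<close>; as usual for tensor functors the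
  isomorphism \<open>u : 1 \<rightarrow> F 1\<close> is only required to exist.\<close>

definition is_monoidal_functor :: "('g, 'm) monoid_scheme \<Rightarrow> ('g, 'k::field) dg_functor \<times> ('g, 'k) mon_str \<Rightarrow> bool" where
  "is_monoidal_functor G FJ \<longleftrightarrow> (case FJ of (F, J) \<Rightarrow> is_functor G F \<and>
     (\<forall>M\<in>dg_modules G. \<forall>N\<in>dg_modules G.
        J M N \<in> dg_iso G (tens_mod G (obj F M) (obj F N)) (obj F (tens_mod G M N))) \<and>
     (\<forall>M\<in>dg_modules G. \<forall>N\<in>dg_modules G. \<forall>M'\<in>dg_modules G. \<forall>N'\<in>dg_modules G.
      \<forall>f\<in>dg_hom G M M'. \<forall>g\<in>dg_hom G N N'.
        comp_mor (tens_mod G (obj F M) (obj F N)) (J M' N')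
          (tens_mor (obj F M) (obj F N) (mor F M M' f) (mor F N N' g))
      = comp_mor (tens_mod G (obj F M) (obj F N))
          (mor F (tens_mod G M N) (tens_mod G M' N') (tens_mor M N f g)) (J M N)) \<and>
     (\<forall>M\<in>dg_modules G. \<forall>N\<in>dg_modules G. \<forall>L\<in>dg_modules G.
      (let V = tens_mod G (tens_mod G (obj F M) (obj F N)) (obj F L) in
        comp_mor V (mor F (tens_mod G (tens_mod G M N) L) (tens_mod G M (tens_mod G N L)) (assoc_mor G M N L))
          (comp_mor V (J (tens_mod G M N) L)
            (tens_mor (tens_mod G (obj F M) (obj F N)) (obj F L) (J M N) (id_mor (obj F L))))
      = comp_mor V (J M (tens_mod G N L))
          (comp_mor V (tens_mor (obj F M) (tens_mod G (obj F N) (obj F L)) (id_mor (obj F M)) (J N L))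
            (assoc_mor G (obj F M) (obj F N) (obj F L))))) \<and>
     (\<exists>u\<in>dg_iso G (unit_mod G) (obj F (unit_mod G)). \<forall>M\<in>dg_modules G.
        comp_mor (tens_mod G (unit_mod G) (obj F M))
          (mor F (tens_mod G (unit_mod G) M) M (lunit_mor G M))
          (comp_mor (tens_mod G (unit_mod G) (obj F M)) (J (unit_mod G) M)
            (tens_mor (unit_mod G) (obj F M) u (id_mor (obj F M))))
        = lunit_mor G (obj F M) \<and>
        comp_mor (tens_mod G (obj F M) (unit_mod G))
          (mor F (tens_mod G M (unit_mod G)) M (runit_mor G M))
          (comp_mor (tens_mod G (obj F M) (unit_mod G)) (J M (unit_mod G))
            (tens_mor (obj F M) (unit_mod G) (id_mor (obj F M)) u))
        = runit_mor G (obj F M)))"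

definition is_braided_autoequivalence :: "('g, 'm) monoid_scheme \<Rightarrow> ('g, 'k::field) dg_functor \<times> ('g, 'k) mon_str \<Rightarrow> bool" where
  "is_braided_autoequivalence G FJ \<longleftrightarrow> is_autoequivalence G (fst FJ) \<and> is_monoidal_functor G FJ \<and>
     (case FJ of (F, J) \<Rightarrow> \<forall>M\<in>dg_modules G. \<forall>N\<in>dg_modules G.
        comp_mor (tens_mod G (obj F M) (obj F N))
          (mor F (tens_mod G M N) (tens_mod G N M) (braiding G M N)) (J M N)
      = comp_mor (tens_mod G (obj F M) (obj F N)) (J N M) (braiding G (obj F M) (obj F N)))"

section \<open>The functor \<open>\<Psi>(\<phi>, \<sigma>)\<close>\<close>

text \<open>\<open>f \<times> g \<mapsto> u(f\<^sub>1) b(g) \<times> a(f\<^sub>2) v(g)\<close>, extended linearly from \<open>f = e\<^sub>x\<close>.\<close>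

definition assemble :: "('g, 'm) monoid_scheme \<Rightarrow>
    (('g \<Rightarrow> 'k::field) \<Rightarrow> 'g \<Rightarrow> 'k) \<Rightarrow> (('g \<Rightarrow> 'k) \<Rightarrow> 'g \<Rightarrow> 'k) \<Rightarrow>
    (('g \<Rightarrow> 'k) \<Rightarrow> 'g \<Rightarrow> 'k) \<Rightarrow> (('g \<Rightarrow> 'k) \<Rightarrow> 'g \<Rightarrow> 'k) \<Rightarrow>
    ('g \<times> 'g \<Rightarrow> 'k) \<Rightarrow> 'g \<times> 'g \<Rightarrow> 'k" where
  "assemble G u b a v = lin_ext (carrier G \<times> carrier G) (\<lambda>(x, g).
     \<Sum>(x1, x2)\<in>carrier G \<times> carrier G. comulc (fun_alg G) x (x1, x2) \<cdot>\<^sub>v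
       pure (bmul (fun_alg G) (u (ket x1)) (b (ket g))) (bmul (group_alg G) (a (ket x2)) (v (ket g))))"

definition grp_lin :: "('g, 'm) monoid_scheme \<Rightarrow> ('g \<Rightarrow> 'g) \<Rightarrow> ('g \<Rightarrow> 'k::field) \<Rightarrow> 'g \<Rightarrow> 'k" where
  "grp_lin G v = lin_ext (carrier G) (\<lambda>g. ket (v g))"

definition is_components where
  "is_components G \<phi> = (\<lambda>(u, b, a, v).
     u \<in> hopf_hom (fun_alg G) (fun_alg G) \<and> b \<in> hopf_hom (group_alg G) (fun_alg G) \<and>
     a \<in> hopf_hom (fun_alg G) (group_alg G) \<and> v \<in> hom G G \<and>
     (\<forall>T\<in>vecs (carrier G \<times> carrier G). \<phi> T = assemble G u b a (grp_lin G v) T))"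

text \<open>The components of a Hopf automorphism are unique as maps on the carriers, and only their
  values there enter.\<close>

definition dagger :: "('g, 'm) monoid_scheme \<Rightarrow> (('g \<times> 'g \<Rightarrow> 'k::field) \<Rightarrow> 'g \<times> 'g \<Rightarrow> 'k) \<Rightarrow>
    ('g \<times> 'g \<Rightarrow> 'k) \<Rightarrow> 'g \<times> 'g \<Rightarrow> 'k" where
  "dagger G \<phi> = (let (u, b, a, v) = (SOME q. is_components G \<phi> q);
                     d = dual_map (carrier G) (carrier G)
                 in assemble G (d (grp_lin G v)) (d b) (d a) (d u))"

definition twist_functor :: "('g, 'm) monoid_scheme \<Rightarrow> (('g \<times> 'g \<Rightarrow> 'k::field) \<Rightarrow> 'g \<times> 'g \<Rightarrow> 'k) \<Rightarrow> ('g, 'k) dg_functor" where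
  "twist_functor G \<phi> = \<lparr>obj = (\<lambda>M. \<lparr>idx = idx M, act = (\<lambda>a. act M (dagger G \<phi> a))\<rparr>),
     mor = (\<lambda>M N f. f)\<rparr>"

text \<open>A cocycle \<open>\<sigma>\<close> on \<open>DG\<^sup>*\<close> has the same coordinates as the corresponding element
  \<open>\<sigma>\<^sub>1 \<otimes> \<sigma>\<^sub>2\<close> of \<open>DG \<otimes> DG\<close>.\<close>

definition cocycle_str :: "('g, 'm) monoid_scheme \<Rightarrow> (('g \<times> 'g) \<times> ('g \<times> 'g) \<Rightarrow> 'k::field) \<Rightarrow> ('g, 'k) mon_str" where
  "cocycle_str G \<sigma> = (\<lambda>M N. restrict (act2 G M N \<sigma>) (vecs (idx (tens_mod G M N))))"

definition Psi :: "('g, 'm) monoid_scheme \<Rightarrow> (('g \<times> 'g \<Rightarrow> 'k::field) \<Rightarrow> 'g \<times> 'g \<Rightarrow> 'k) \<Rightarrow>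
    (('g \<times> 'g) \<times> ('g \<times> 'g) \<Rightarrow> 'k) \<Rightarrow> ('g, 'k) dg_functor \<times> ('g, 'k) mon_str" where
  "Psi G \<phi> \<sigma> = (twist_functor G \<phi>, cocycle_str G \<sigma>)"

section \<open>Simple objects\<close>

definition centralizer :: "('g, 'm) monoid_scheme \<Rightarrow> 'g \<Rightarrow> 'g set" where
  "centralizer G g = {z \<in> carrier G. z \<otimes>\<^bsub>G\<^esub> g = g \<otimes>\<^bsub>G\<^esub> z}"

definition irreducible_rep :: "('g, 'm) monoid_scheme \<Rightarrow> nat set \<Rightarrow> ('g \<Rightarrow> 'k::field lmap) \<Rightarrow> bool" where
  "irreducible_rep K B \<rho> \<longleftrightarrow> finite B \<and> B \<noteq> {} \<and>
     (\<forall>z\<in>carrier K. linear_between B B (\<rho> z)) \<and>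
     (\<forall>v\<in>vecs B. \<rho> \<one>\<^bsub>K\<^esub> v = v) \<and>
     (\<forall>y\<in>carrier K. \<forall>z\<in>carrier K. \<forall>v\<in>vecs B. \<rho> (y \<otimes>\<^bsub>K\<^esub> z) v = \<rho> y (\<rho> z v)) \<and>
     (\<forall>U. U \<subseteq> vecs B \<and> module.subspace scl U \<and> (\<forall>z\<in>carrier K. \<rho> z ` U \<subseteq> U) \<longrightarrow> U = {0} \<or> U = vecs B)"

text \<open>\<open>is_induced G K B \<rho> V \<tau>\<close>: the space \<open>vecs V\<close> together with \<open>(y, w) \<mapsto> y \<otimes> w = \<tau> y w\<close> is the
  balanced tensor product \<open>kG \<otimes>\<^sub>k\<^sub>K vecs B\<close>.\<close>

definition balanced :: "('g, 'm) monoid_scheme \<Rightarrow> 'g set \<Rightarrow> nat set \<Rightarrow> ('g \<Rightarrow> 'k::field lmap) \<Rightarrow> nat set \<Rightarrow>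
    ('g \<Rightarrow> 'k lmap) \<Rightarrow> bool" where
  "balanced G K B \<rho> V \<beta> \<longleftrightarrow>
     (\<forall>y\<in>carrier G. linear_between B V (\<beta> y)) \<and>
     (\<forall>y\<in>carrier G. \<forall>z\<in>K. \<forall>w\<in>vecs B. \<beta> (y \<otimes>\<^bsub>G\<^esub> z) w = \<beta> y (\<rho> z w))"

definition is_induced :: "('g, 'm) monoid_scheme \<Rightarrow> 'g set \<Rightarrow> nat set \<Rightarrow> ('g \<Rightarrow> 'k::field lmap) \<Rightarrow> nat set \<Rightarrow>
    ('g \<Rightarrow> 'k lmap) \<Rightarrow> bool" where
  "is_induced G K B \<rho> V \<tau> \<longleftrightarrow> balanced G K B \<rho> V \<tau> \<and>
     (\<forall>Y \<beta>. finite Y \<and> balanced G K B \<rho> Y \<beta> \<longrightarrow>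
        (\<exists>!f. f \<in> lmaps V Y \<and> (\<forall>y\<in>carrier G. \<forall>w\<in>vecs B. f (\<tau> y w) = \<beta> y w)))"

text \<open>\<open>M\<close> with \<open>\<tau>\<close> is the simple object \<open>\<O>\<^sub>g\<^sup>\<rho> = kG \<otimes> W\<close>, where \<open>W = vecs B\<close>.\<close>

definition is_simple_object :: "('g, 'm) monoid_scheme \<Rightarrow> 'g \<Rightarrow> nat set \<Rightarrow> ('g \<Rightarrow> 'k::field lmap) \<Rightarrow>
    ('g, 'k) dg_mod \<Rightarrow> ('g \<Rightarrow> 'k lmap) \<Rightarrow> bool" where
  "is_simple_object G g B \<rho> M \<tau> \<longleftrightarrow> g \<in> carrier G \<and>
     irreducible_rep (G\<lparr>carrier := centralizer G g\<rparr>) B \<rho> \<and>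
     M \<in> dg_modules G \<and> is_induced G (centralizer G g) B \<rho> (idx M) \<tau> \<and>
     (\<forall>h\<in>carrier G. \<forall>t\<in>carrier G. \<forall>y\<in>carrier G. \<forall>w\<in>vecs B.
        act M (ket (h, t)) (\<tau> y w) =
          (if h = (t \<otimes>\<^bsub>G\<^esub> y) \<otimes>\<^bsub>G\<^esub> g \<otimes>\<^bsub>G\<^esub> inv\<^bsub>G\<^esub> (t \<otimes>\<^bsub>G\<^esub> y) then \<tau> (t \<otimes>\<^bsub>G\<^esub> y) w else 0))"

definition left_transversal :: "('g, 'm) monoid_scheme \<Rightarrow> 'g set \<Rightarrow> 'g set \<Rightarrow> bool" where
  "left_transversal G K S \<longleftrightarrow> S \<subseteq> carrier G \<and> (\<forall>x\<in>carrier G. \<exists>!s. s \<in> S \<and> x \<in> s <#\<^bsub>G\<^esub> K)"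

section \<open>Reflections\<close>

definition is_reflection_datum :: "('g, 'm) monoid_scheme \<Rightarrow> 'g set \<Rightarrow> 'g set \<Rightarrow>
    (('g \<Rightarrow> 'k::field) \<Rightarrow> 'g \<Rightarrow> 'k) \<Rightarrow> bool" where
  "is_reflection_datum G H C \<delta> \<longleftrightarrow> subgroup H G \<and> subgroup C G \<and> comm_group (G\<lparr>carrier := C\<rparr>) \<and>
     (\<lambda>(h, c). h \<otimes>\<^bsub>G\<^esub> c) \<in> iso (G\<lparr>carrier := H\<rparr> \<times>\<times> G\<lparr>carrier := C\<rparr>) G \<and>
     \<delta> \<in> hopf_iso (group_alg (G\<lparr>carrier := C\<rparr>)) (fun_alg (G\<lparr>carrier := C\<rparr>))"

definition decompose :: "('g, 'm) monoid_scheme \<Rightarrow> 'g set \<Rightarrow> 'g set \<Rightarrow> 'g \<Rightarrow> 'g \<times> 'g" where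
  "decompose G H C = the_inv_into (H \<times> C) (\<lambda>(h, c). h \<otimes>\<^bsub>G\<^esub> c)"

abbreviation hpart :: "('g, 'm) monoid_scheme \<Rightarrow> 'g set \<Rightarrow> 'g set \<Rightarrow> 'g \<Rightarrow> 'g" where
  "hpart G H C x \<equiv> fst (decompose G H C x)"

abbreviation cpart :: "('g, 'm) monoid_scheme \<Rightarrow> 'g set \<Rightarrow> 'g set \<Rightarrow> 'g \<Rightarrow> 'g" where
  "cpart G H C x \<equiv> snd (decompose G H C x)"

text \<open>The element \<open>(f\<^sub>H, f\<^sub>C)\<close> of \<open>k\<^sup>H \<otimes> k\<^sup>C = k\<^sup>G\<close>, and likewise of \<open>kH \<otimes> kC = kG\<close>.\<close>

definition join :: "('g, 'm) monoid_scheme \<Rightarrow> 'g set \<Rightarrow> 'g set \<Rightarrow> ('g \<Rightarrow> 'k::field) \<Rightarrow> ('g \<Rightarrow> 'k) \<Rightarrow> 'g \<Rightarrow> 'k" where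
  "join G H C f f' = (\<lambda>x. if x \<in> carrier G then f (hpart G H C x) * f' (cpart G H C x) else 0)"

text \<open>\<open>(f\<^sub>H, f\<^sub>C) \<times> (h, c) \<mapsto> (f\<^sub>H, \<delta>(c)) \<times> (h, \<delta>\<^sup>-\<^sup>1(f\<^sub>C))\<close>, extended linearly from delta functions.\<close>

definition reflection :: "('g, 'm) monoid_scheme \<Rightarrow> 'g set \<Rightarrow> 'g set \<Rightarrow> (('g \<Rightarrow> 'k::field) \<Rightarrow> 'g \<Rightarrow> 'k) \<Rightarrow>
    ('g \<times> 'g \<Rightarrow> 'k) \<Rightarrow> 'g \<times> 'g \<Rightarrow> 'k" where
  "reflection G H C \<delta> = lin_ext (carrier G \<times> carrier G) (\<lambda>(x, y).
     pure (join G H C (ket (hpart G H C x)) (\<delta> (ket (cpart G H C y))))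
          (join G H C (ket (hpart G H C y)) (the_inv_into (vecs C) \<delta> (ket (cpart G H C x)))))"

definition is_lazy_reflection_pairing :: "('g, 'm) monoid_scheme \<Rightarrow> 'g set \<Rightarrow> 'g set \<Rightarrow>
    (('g \<Rightarrow> 'k::field) \<Rightarrow> ('g \<Rightarrow> 'k) \<Rightarrow> 'k) \<Rightarrow> bool" where
  "is_lazy_reflection_pairing G H C l \<longleftrightarrow> (\<forall>h\<in>H. \<forall>c\<in>C. \<forall>h'\<in>H. \<forall>c'\<in>C.
     l (ket (h \<otimes>\<^bsub>G\<^esub> c)) (ket (h' \<otimes>\<^bsub>G\<^esub> c')) =
       (if c = c' then 1 else 0) * bcounit (group_alg G) (ket h) * bcounit (fun_alg G) (ket h'))"

definition lazy_reflections :: "('g, 'm) monoid_scheme \<Rightarrow>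
    ((('g \<times> 'g \<Rightarrow> 'k::field) \<Rightarrow> 'g \<times> 'g \<Rightarrow> 'k) \<times> (('g \<Rightarrow> 'k) \<Rightarrow> ('g \<Rightarrow> 'k) \<Rightarrow> 'k)) set" where
  "lazy_reflections G = {(reflection G H C \<delta>, l) | H C \<delta> l.
     is_reflection_datum G H C \<delta> \<and> l \<in> central_pairings G \<and> is_lazy_reflection_pairing G H C l}"

text \<open>Characters of \<open>C\<close>, as elements of \<open>k\<^sup>C\<close>.\<close>

definition chars :: "('g, 'm) monoid_scheme \<Rightarrow> 'g set \<Rightarrow> ('g \<Rightarrow> 'k::field) set" where
  "chars G C = {\<chi> \<in> vecs C. (\<forall>x\<in>C. \<chi> x \<noteq> 0) \<and> (\<forall>x\<in>C. \<forall>y\<in>C. \<chi> (x \<otimes>\<^bsub>G\<^esub> y) = \<chi> x * \<chi> y)}"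

definition delta_inv :: "'g set \<Rightarrow> (('g \<Rightarrow> 'k::field) \<Rightarrow> 'g \<Rightarrow> 'k) \<Rightarrow> ('g \<Rightarrow> 'k) \<Rightarrow> 'g" where
  "delta_inv C \<delta> \<chi> = (THE d. d \<in> C \<and> ket d = the_inv_into (vecs C) \<delta> \<chi>)"

text \<open>The representation \<open>\<rho>\<^sub>H \<rho>\<^sub>C\<close> on the space of \<open>\<rho>\<^sub>H\<close>.\<close>

definition rep_join :: "('g, 'm) monoid_scheme \<Rightarrow> 'g set \<Rightarrow> 'g set \<Rightarrow> ('g \<Rightarrow> 'k::field lmap) \<Rightarrow> ('g \<Rightarrow> 'k) \<Rightarrow>
    'g \<Rightarrow> 'k lmap" where
  "rep_join G H C \<rho> \<chi> z v = \<chi> (cpart G H C z) \<cdot>\<^sub>v \<rho> (hpart G H C z) v"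

text \<open>\<open>M\<close> with \<open>\<tau>\<close> is the simple object of the group element \<open>hc\<close> and the representation
  \<open>\<rho>\<^sub>H \<rho>\<^sub>C\<close>. As \<open>C\<close> is abelian, \<open>\<rho>\<^sub>C\<close> is a character and \<open>vecs B\<close> carries \<open>\<rho>\<^sub>H\<close>.\<close>

definition is_split_simple :: "('g, 'm) monoid_scheme \<Rightarrow> 'g set \<Rightarrow> 'g set \<Rightarrow> 'g \<Rightarrow> 'g \<Rightarrow> nat set \<Rightarrow>
    ('g \<Rightarrow> 'k::field lmap) \<Rightarrow> ('g \<Rightarrow> 'k) \<Rightarrow> ('g, 'k) dg_mod \<Rightarrow> ('g \<Rightarrow> 'k lmap) \<Rightarrow> bool" where
  "is_split_simple G H C h c B \<rho> \<chi> M \<tau> \<longleftrightarrow> h \<in> H \<and> c \<in> C \<and> \<chi> \<in> chars G C \<and>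
     irreducible_rep (G\<lparr>carrier := centralizer (G\<lparr>carrier := H\<rparr>) h\<rparr>) B \<rho> \<and>
     is_simple_object G (h \<otimes>\<^bsub>G\<^esub> c) B (rep_join G H C \<rho> \<chi>) M \<tau>"

text \<open>Symmetry of the bicharacter \<open>\<delta>(c)(c')\<close>. The map \<open>(c, \<rho>) \<mapsto> (\<delta>\<^sup>-\<^sup>1(\<rho>), \<delta>(c))\<close> preserves the
  self-braiding \<open>\<rho>(c)\<close> of the invertible objects of \<open>DC\<close> only if this holds.\<close>

definition is_symmetric_iso :: "'g set \<Rightarrow> (('g \<Rightarrow> 'k::field) \<Rightarrow> 'g \<Rightarrow> 'k) \<Rightarrow> bool" where
  "is_symmetric_iso C \<delta> \<longleftrightarrow> (\<forall>c\<in>C. \<forall>c'\<in>C. \<delta> (ket c) c' = \<delta> (ket c') c)"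

end

theory Submission
  imports Defs
begin

text \<open>
  Each of the objects involved becomes transparent in suitable coordinates.

  \<^item> The reflection. Let \<open>\<beta>(c, c') = \<delta>(c)(c')\<close>, a nondegenerate bicharacter of \<open>C\<close>. The elements
    \<open>e\<^sub>h \<delta>(c) \<times> yd\<close> with \<open>h, y \<in> H\<close> and \<open>c, d \<in> C\<close> span \<open>DG\<close>, and \<open>r\<close> exchanges \<open>c\<close> and \<open>d\<close>.
    All structure maps of \<open>DG\<close> are symmetric in \<open>c\<close> and \<open>d\<close> on these elements, so \<open>r\<close> is an involutive
    Hopf automorphism (\<open>reflection_hopf_aut\<close>). The components of a Hopf automorphism can be read off
    by applying counits to its values (\<open>components_determined\<close>). Hence \<open>r\<close> determines \<open>H\<close>, \<open>C\<close> and
    \<open>\<delta>\<close>, and \<open>r\<^sup>\<dagger>\<close> is the reflection of the transposed bicharacter (\<open>dagger_reflection\<close>).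

  \<^item> Modules. A \<open>DG\<close>-module is a \<open>G\<close>-graded space with a compatible action of \<open>G\<close>, and a linear map
    is determined on homogeneous vectors. Let the pairing be given by \<open>p : G \<rightarrow> Z(G)\<close>. Then
    \<open>J(v \<otimes> w) = p(h).v \<otimes> w\<close> for \<open>w\<close> of degree \<open>h\<close> (\<open>J_vtens\<close>). Since \<open>p\<close> is a homomorphism into the
    centre, the pairing is a lazy cocycle (\<open>sigma_lazy\<close>) and \<open>J\<close> is a natural and coherent isomorphism of modules \<open>M \<otimes> N \<rightarrow> M \<otimes> N\<close>. As \<open>r\<^sup>\<dagger>\<close> is a coalgebra
    map, \<open>F M \<otimes> F N\<close> and \<open>F (M \<otimes> N)\<close> are the same module (\<open>act_tens_twist\<close>), so \<open>(F, J)\<close> is a monoidal functor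
    (\<open>twist_monoidal\<close>); it is an autoequivalence because \<open>r\<^sup>\<dagger>\<close> is an involution.

  \<^item> Simple objects. For \<open>v\<close> of degree \<open>a\<close>, the element \<open>r(e\<^sub>x \<times> y)\<close> acts on \<open>v\<close> by an explicit
    combination of elements of \<open>C\<close>, followed by a scalar multiple of \<open>y\<^sub>H\<close> (\<open>act_reflection\<close>). For \<open>r\<^sup>\<dagger>\<close> instead of \<open>r\<close>
    and \<open>v\<close> in \<open>\<O>\<^bsub>hc\<^esub>\<close> with representation \<open>\<rho>\<^sub>H \<rho>\<^sub>C\<close>, the combination acts by the coefficient of \<open>\<delta>\<^sup>-\<^sup>1(\<rho>\<^sub>C)\<close> at \<open>x\<^sub>C\<close>.
    As a character is group-like, \<open>\<delta>\<^sup>-\<^sup>1(\<rho>\<^sub>C)\<close> is a group element, which becomes the \<open>C\<close>-part of the degree. The scalar is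
    \<open>\<delta>(c)(y\<^sub>C)\<close>, which becomes the action of \<open>C\<close>. This identifies \<open>F \<O>\<^bsub>hc\<^esub>\<close> (\<open>split_simple_twist\<close>).

  The braiding condition, evaluated at homogeneous \<open>v\<close> and \<open>w\<close> of degrees \<open>g\<close> and \<open>h\<close>, reads
  \<open>g.w \<otimes> p(h).v = \<Sum>\<^sub>d K(d, h\<^sub>C) p(g) g\<^sub>H.w \<otimes> d.v\<close>, summed over \<open>d \<in> C\<close>. Here \<open>K\<close> is the inverse of the
  matrix \<open>\<beta>\<close> times the transpose of \<open>\<beta>\<close>, the identity exactly if \<open>\<beta>\<close> is symmetric (\<open>compare_iff\<close>). If \<open>p\<close> is
  the projection to \<open>C\<close> and \<open>\<beta>\<close> is symmetric, both sides agree. Conversely the regular module is free, so there the coefficients can be compared: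
  they give \<open>g = p(g) g\<^sub>H\<close> for all \<open>g\<close>, and then that \<open>K\<close> is the identity (\<open>braided_at_regular\<close>).
\<close>

section \<open>Linear algebra in coordinates\<close>

lemma sum_fun_app: "(\<Sum>a\<in>A. f a) x = (\<Sum>a\<in>A. f a x)"
  by (induction A rule: infinite_finite_induct) auto

lemma ket_app: "ket i j = (if j = i then 1 else 0)"
  by (simp add: ket_def)

lemma scl_app: "(c \<cdot>\<^sub>v v) i = c * v i"
  by (simp add: scl_def)

lemma scl_simps [simp]:
  "1 \<cdot>\<^sub>v v = v" "0 \<cdot>\<^sub>v v = 0" "c \<cdot>\<^sub>v (0 :: 'i \<Rightarrow> 'k::field) = 0"
  "c \<cdot>\<^sub>v (d \<cdot>\<^sub>v v) = (c * d) \<cdot>\<^sub>v v"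
  by (auto simp: scl_def fun_eq_iff)

lemma scl_sum: "c \<cdot>\<^sub>v (\<Sum>a\<in>A. f a) = (\<Sum>a\<in>A. c \<cdot>\<^sub>v f a)"
  by (auto simp: scl_def fun_eq_iff sum_fun_app sum_distrib_left)

lemma scl_add: "c \<cdot>\<^sub>v (v + w) = c \<cdot>\<^sub>v v + c \<cdot>\<^sub>v w"
  by (auto simp: scl_def fun_eq_iff algebra_simps)

lemma sum_scl: "(\<Sum>a\<in>A. f a) \<cdot>\<^sub>v v = (\<Sum>a\<in>A. f a \<cdot>\<^sub>v v)"
  by (auto simp: scl_def fun_eq_iff sum_fun_app sum_distrib_right)

lemma vecs_zero [simp]: "0 \<in> vecs B"
  and vecs_add: "v \<in> vecs B \<Longrightarrow> w \<in> vecs B \<Longrightarrow> v + w \<in> vecs B"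
  and vecs_scl: "v \<in> vecs B \<Longrightarrow> c \<cdot>\<^sub>v v \<in> vecs B"
  and vecs_ket: "i \<in> B \<Longrightarrow> ket i \<in> vecs B"
  by (auto simp: vecs_def scl_def ket_def)

lemma vecs_out: "v \<in> vecs B \<Longrightarrow> i \<notin> B \<Longrightarrow> v i = 0"
  by (auto simp: vecs_def)

lemma vecs_sum: "(\<And>a. a \<in> A \<Longrightarrow> f a \<in> vecs B) \<Longrightarrow> (\<Sum>a\<in>A. f a) \<in> vecs B"
  by (auto simp: vecs_def sum_fun_app intro!: sum.neutral)

lemma vecs_eqI: "v \<in> vecs B \<Longrightarrow> w \<in> vecs B \<Longrightarrow> (\<And>i. i \<in> B \<Longrightarrow> v i = w i) \<Longrightarrow> v = w"
  by (auto simp: vecs_def fun_eq_iff) metis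

lemma sum_ket_mult:
  "finite A \<Longrightarrow> (\<Sum>a\<in>A. ket i a * f a) = (if i \<in> A then f i else 0)"
  "finite A \<Longrightarrow> (\<Sum>a\<in>A. f a * ket i a) = (if i \<in> A then f i else 0)"
  by (auto simp: ket_def if_distrib[of "\<lambda>x. _ * x"] if_distrib[of "\<lambda>x. x * _"] cong: if_cong)

lemma vecs_expand: "finite B \<Longrightarrow> v \<in> vecs B \<Longrightarrow> v = (\<Sum>i\<in>B. v i \<cdot>\<^sub>v ket i)"
  by (rule vecs_eqI[of _ B])
     (auto intro!: vecs_sum vecs_scl vecs_ket simp: sum_fun_app scl_app ket_app
        if_distrib[of "\<lambda>x. _ * x"] cong: if_cong)

lemma lin_ext_app: "lin_ext B f v j = (\<Sum>i\<in>B. v i * f i j)"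
  by (simp add: lin_ext_def sum_fun_app scl_app)

lemma lin_ext_ket: "finite B \<Longrightarrow> i \<in> B \<Longrightarrow> lin_ext B f (ket i) = f i"
  by (auto simp: fun_eq_iff lin_ext_app sum_ket_mult)

lemma linear_betweenI:
  assumes "\<And>v. v \<in> vecs A \<Longrightarrow> f v \<in> vecs B"
    and "\<And>v w. v \<in> vecs A \<Longrightarrow> w \<in> vecs A \<Longrightarrow> f (v + w) = f v + f w"
    and "\<And>c v. v \<in> vecs A \<Longrightarrow> f (c \<cdot>\<^sub>v v) = c \<cdot>\<^sub>v f v"
  shows "linear_between A B f"
  using assms by (auto simp: linear_between_def)

lemma linear_betweenD:
  assumes "linear_between A B f"
  shows "v \<in> vecs A \<Longrightarrow> f v \<in> vecs B"
    and "v \<in> vecs A \<Longrightarrow> w \<in> vecs A \<Longrightarrow> f (v + w) = f v + f w"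
    and "v \<in> vecs A \<Longrightarrow> f (c \<cdot>\<^sub>v v) = c \<cdot>\<^sub>v f v"
  using assms by (auto simp: linear_between_def)

lemma linear_between_cong:
  "(\<And>v. v \<in> vecs A \<Longrightarrow> f v = g v) \<Longrightarrow> linear_between A B f \<longleftrightarrow> linear_between A B g"
  by (auto simp: linear_between_def Pi_iff vecs_add vecs_scl)

lemma linear_between_zero: "linear_between A B f \<Longrightarrow> f 0 = 0"
  using linear_betweenD(3)[of A B f 0 0] by simp

lemma linear_between_sum:
  assumes "linear_between A B f" "\<And>a. a \<in> I \<Longrightarrow> v a \<in> vecs A"
  shows "f (\<Sum>a\<in>I. v a) = (\<Sum>a\<in>I. f (v a))"
  using assms(2)
proof (induction I rule: infinite_finite_induct)
  case (insert x F)
  have "f (\<Sum>a\<in>insert x F. v a) = f (v x + (\<Sum>a\<in>F. v a))"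
    by (subst sum.insert[OF insert(1,2)]) (rule refl)
  also have "\<dots> = f (v x) + f (\<Sum>a\<in>F. v a)"
    by (rule linear_betweenD(2)[OF assms(1)]) (auto intro!: vecs_sum insert.prems)
  also have "f (\<Sum>a\<in>F. v a) = (\<Sum>a\<in>F. f (v a))"
    by (rule insert.IH) (auto intro!: insert.prems)
  finally show ?case
    by (subst sum.insert[OF insert(1,2)])
qed (simp_all add: linear_between_zero[OF assms(1)])

lemma linear_between_expand:
  assumes "linear_between A B f" "finite A" "v \<in> vecs A"
  shows "f v = (\<Sum>i\<in>A. v i \<cdot>\<^sub>v f (ket i))"
proof -
  have "f v = f (\<Sum>i\<in>A. v i \<cdot>\<^sub>v ket i)"
    using vecs_expand[OF assms(2,3)] by simp
  also have "\<dots> = (\<Sum>i\<in>A. v i \<cdot>\<^sub>v f (ket i))"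
    by (simp add: linear_between_sum[OF assms(1)] vecs_scl vecs_ket linear_betweenD(3)[OF assms(1)])
  finally show ?thesis .
qed

lemma linear_between_eqI:
  assumes "linear_between A B f" "linear_between A B' g" "finite A"
    and "\<And>i. i \<in> A \<Longrightarrow> f (ket i) = g (ket i)" "v \<in> vecs A"
  shows "f v = g v"
  using assms by (simp add: linear_between_expand[of A B f] linear_between_expand[of A B' g])

lemma linear_between_lin_ext:
  "(\<And>i. i \<in> A \<Longrightarrow> f i \<in> vecs B) \<Longrightarrow> linear_between A B (lin_ext A f)"
  by (rule linear_betweenI)
     (auto simp: fun_eq_iff lin_ext_app scl_app sum.distrib algebra_simps sum_distrib_left,
      auto simp: lin_ext_def intro!: vecs_sum vecs_scl)

lemma linear_between_comp:
  "linear_between A B f \<Longrightarrow> linear_between B C g \<Longrightarrow> linear_between A C (\<lambda>v. g (f v))"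
  by (auto simp: linear_between_def Pi_iff)

lemma linear_between_id: "linear_between A A (\<lambda>v. v)"
  by (rule linear_betweenI) auto

lemma linear_between_sum_fun:
  "(\<And>a. a \<in> I \<Longrightarrow> linear_between A B (f a)) \<Longrightarrow> linear_between A B (\<lambda>v. \<Sum>a\<in>I. f a v)"
  unfolding linear_between_def Pi_iff
  by (auto simp: sum.distrib[symmetric] scl_sum intro!: vecs_sum sum.cong)

lemma linear_between_scl_fun:
  "linear_between A B f \<Longrightarrow> linear_between A B (\<lambda>v. c \<cdot>\<^sub>v f v)"
  unfolding linear_between_def Pi_iff by (auto simp: scl_add mult.commute intro!: vecs_scl)

text \<open>A linear functional on \<open>vecs A\<close>, for finite \<open>A\<close>, expressed through its values on the basis.\<close>

definition functional :: "'i set \<Rightarrow> (('i \<Rightarrow> 'k::field) \<Rightarrow> 'k) \<Rightarrow> bool" where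
  "functional A f \<longleftrightarrow> (\<forall>v\<in>vecs A. f v = (\<Sum>i\<in>A. v i * f (ket i)))"

lemma functional_eqI:
  assumes "functional A f" "functional A g" "\<And>i. i \<in> A \<Longrightarrow> f (ket i) = g (ket i)" "v \<in> vecs A"
  shows "f v = g v"
  using assms by (simp add: functional_def)

lemma functional_sum:
  assumes "functional A f" "\<And>a. a \<in> I \<Longrightarrow> v a \<in> vecs A"
  shows "f (\<Sum>a\<in>I. c a \<cdot>\<^sub>v v a) = (\<Sum>a\<in>I. c a * f (v a))"
proof -
  have "f (\<Sum>a\<in>I. c a \<cdot>\<^sub>v v a) = (\<Sum>i\<in>A. (\<Sum>a\<in>I. c a \<cdot>\<^sub>v v a) i * f (ket i))"
    using assms by (simp add: functional_def vecs_sum vecs_scl)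
  also have "\<dots> = (\<Sum>a\<in>I. \<Sum>i\<in>A. c a * (v a i * f (ket i)))"
    by (subst sum.swap) (simp add: sum_fun_app scl_app sum_distrib_right mult.assoc)
  also have "\<dots> = (\<Sum>a\<in>I. c a * f (v a))"
    using assms by (simp add: functional_def sum_distrib_left)
  finally show ?thesis .
qed

lemma functional_linear:
  assumes "linear_between A B f" "finite A" shows "functional A (\<lambda>v. f v j)"
  unfolding functional_def
  by (auto simp: linear_between_expand[OF assms] sum_fun_app scl_app)

lemma functional_comp:
  fixes f :: "('i \<Rightarrow> 'k::field) \<Rightarrow> 'j \<Rightarrow> 'k"
  assumes "functional B h" "linear_between A B f" "finite A"
  shows "functional A (\<lambda>v. h (f v))"
  unfolding functional_def
proof
  fix v :: "'i \<Rightarrow> 'k" assume v: "v \<in> vecs A"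
  have "h (f v) = h (\<Sum>i\<in>A. v i \<cdot>\<^sub>v f (ket i))"
    using linear_between_expand[OF assms(2,3) v] by simp
  also have "\<dots> = (\<Sum>i\<in>A. v i * h (f (ket i)))"
    by (rule functional_sum[OF assms(1)]) (auto intro!: linear_betweenD(1)[OF assms(2)] vecs_ket)
  finally show "h (f v) = (\<Sum>i\<in>A. v i * h (f (ket i)))" .
qed

lemma functional_mult:
  "functional A f \<Longrightarrow> functional A (\<lambda>v. c * f v)"
  "functional A f \<Longrightarrow> functional A (\<lambda>v. f v * c)"
  by (simp_all add: functional_def sum_distrib_left sum_distrib_right algebra_simps)

lemma functional_coord: "finite A \<Longrightarrow> functional A (\<lambda>v. v i)"
  by (auto simp: functional_def ket_app vecs_def if_distrib[of "\<lambda>x. _ * x"] cong: if_cong)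

section \<open>Tensor products in coordinates\<close>

lemma pure_app: "pure v w (i, j) = v i * w j"
  by (simp add: pure_def)

lemma pure_vecs: "v \<in> vecs A \<Longrightarrow> w \<in> vecs B \<Longrightarrow> pure v w \<in> vecs (A \<times> B)"
  by (auto simp: vecs_def pure_def)

lemma pure_ket: "pure (ket i) (ket j) = ket (i, j)"
  by (auto simp: pure_def ket_def fun_eq_iff)

lemma map_pure_pure:
  fixes f :: "('i \<Rightarrow> 'k::field) \<Rightarrow> 'm \<Rightarrow> 'k" and g :: "('j \<Rightarrow> 'k) \<Rightarrow> 'n \<Rightarrow> 'k"
  assumes "finite A" "finite B" "linear_between A A' f" "linear_between B B' g"
    and "v \<in> vecs A" "w \<in> vecs B"
  shows "map_pure A B f g (pure v w) = pure (f v) (g w)"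
proof
  fix p :: "'m \<times> 'n"
  obtain i j where p: "p = (i, j)" by (cases p)
  have "map_pure A B f g (pure v w) p = (\<Sum>a\<in>A. \<Sum>b\<in>B. (v a * f (ket a) i) * (w b * g (ket b) j))"
    by (simp add: map_pure_def lin_ext_app p sum.cartesian_product mult.assoc
        mult.left_commute case_prod_beta' pure_def)
  also have "\<dots> = (\<Sum>a\<in>A. v a * f (ket a) i) * (\<Sum>b\<in>B. w b * g (ket b) j)"
    by (simp add: sum_product)
  also have "\<dots> = pure (f v) (g w) p"
    using assms by (simp add: p pure_app linear_between_expand[of A A' f] linear_between_expand[of B B' g]
        sum_fun_app scl_app)
  finally show "map_pure A B f g (pure v w) p = pure (f v) (g w) p" .
qed

lemma linear_between_map_pure:
  assumes "linear_between A A' f" "linear_between B B' g"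
  shows "linear_between (A \<times> B) (A' \<times> B') (map_pure A B f g)"
  unfolding map_pure_def
  by (rule linear_between_lin_ext)
     (auto intro!: pure_vecs linear_betweenD(1)[OF assms(1)] linear_betweenD(1)[OF assms(2)] vecs_ket)

lemma vtens_app: "(v \<otimes>\<^sub>v w) (prod_encode (i, j)) = v i * w j"
  by (simp add: vtens_def pure_def)

lemma ket_vtens: "ket i \<otimes>\<^sub>v ket j = ket (prod_encode (i, j))"
  by (auto simp: vtens_def pure_ket ket_app fun_eq_iff) (metis prod_decode_inverse)

lemma vtens_eqI: "(\<And>i j. t (prod_encode (i, j)) = u (prod_encode (i, j))) \<Longrightarrow> t = u"
  by (metis ext prod_decode_inverse surj_pair)

lemma vtens_lin:
  "(v + v') \<otimes>\<^sub>v w = v \<otimes>\<^sub>v w + v' \<otimes>\<^sub>v w" "v \<otimes>\<^sub>v (w + w') = v \<otimes>\<^sub>v w + v \<otimes>\<^sub>v w'"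
  "(c \<cdot>\<^sub>v v) \<otimes>\<^sub>v w = c \<cdot>\<^sub>v (v \<otimes>\<^sub>v w)" "v \<otimes>\<^sub>v (c \<cdot>\<^sub>v w) = c \<cdot>\<^sub>v (v \<otimes>\<^sub>v w)"
  "0 \<otimes>\<^sub>v w = 0" "v \<otimes>\<^sub>v 0 = 0"
  "(\<Sum>a\<in>I. f a) \<otimes>\<^sub>v w = (\<Sum>a\<in>I. f a \<otimes>\<^sub>v w)" "v \<otimes>\<^sub>v (\<Sum>a\<in>I. f a) = (\<Sum>a\<in>I. v \<otimes>\<^sub>v f a)"
  by (auto intro!: vtens_eqI simp: vtens_app algebra_simps scl_app sum_fun_app sum_distrib_left sum_distrib_right)

lemma finite_tens_idx: "finite A \<Longrightarrow> finite B \<Longrightarrow> finite (tens_idx A B)"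
  by (simp add: tens_idx_def)

lemma vtens_vecs: "v \<in> vecs A \<Longrightarrow> w \<in> vecs B \<Longrightarrow> v \<otimes>\<^sub>v w \<in> vecs (tens_idx A B)"
  unfolding vecs_def tens_idx_def
  by (auto simp: vtens_def pure_def split: prod.split) (metis SigmaI image_eqI prod_decode_inverse)

lemma tens_ket_eqI:
  fixes f g :: "(nat \<Rightarrow> 'k::field) \<Rightarrow> 'x \<Rightarrow> 'k"
  assumes "linear_between (tens_idx A B) V f" "linear_between (tens_idx A B) V' g"
    and "finite A" "finite B"
    and "\<And>i j. i \<in> A \<Longrightarrow> j \<in> B \<Longrightarrow> f (ket i \<otimes>\<^sub>v ket j) = g (ket i \<otimes>\<^sub>v ket j)"
    and "t \<in> vecs (tens_idx A B)"
  shows "f t = g t"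
  using assms(1,2) finite_tens_idx[OF assms(3,4)] _ assms(6)
  by (rule linear_between_eqI) (use assms(5) in \<open>auto simp: tens_idx_def ket_vtens\<close>)

lemma linear_between_vtens:
  "w \<in> vecs B \<Longrightarrow> linear_between A (tens_idx A B) (\<lambda>v. v \<otimes>\<^sub>v w)"
  "v \<in> vecs A \<Longrightarrow> linear_between B (tens_idx A B) (\<lambda>w. v \<otimes>\<^sub>v w)"
  by (auto intro!: linear_betweenI simp: vtens_lin vtens_vecs)

lemma linear_between_tens_lin:
  assumes "linear_between A A' f" "linear_between B B' g"
  shows "linear_between (tens_idx A B) (tens_idx A' B') (tens_lin A B f g)"
proof (rule linear_betweenI)
  show "tens_lin A B f g v \<in> vecs (tens_idx A' B')" for v
    unfolding tens_lin_def
    by (intro vecs_sum vecs_scl vtens_vecs linear_betweenD(1)[OF assms(1)]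
        linear_betweenD(1)[OF assms(2)] vecs_ket)
qed (auto simp: tens_lin_def fun_eq_iff sum_fun_app scl_app algebra_simps sum.distrib sum_distrib_left)

lemma tens_lin_vtens:
  assumes "finite A" "finite B" "linear_between A A' f" "linear_between B B' g"
    and "v \<in> vecs A" "w \<in> vecs B"
  shows "tens_lin A B f g (v \<otimes>\<^sub>v w) = f v \<otimes>\<^sub>v g w"
proof -
  have "tens_lin A B f g (v \<otimes>\<^sub>v w)
    = (\<Sum>i\<in>A. v i \<cdot>\<^sub>v f (ket i)) \<otimes>\<^sub>v (\<Sum>j\<in>B. w j \<cdot>\<^sub>v g (ket j))"
    by (simp add: tens_lin_def vtens_app vtens_lin scl_sum mult.commute) (rule sum.swap)
  then show ?thesis
    using assms by (simp add: linear_between_expand[of A A' f] linear_between_expand[of B B' g])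
qed

section \<open>Hopf algebra homomorphisms\<close>

text \<open>The structure constants of \<open>A\<close> stay inside the span of its finite basis.\<close>

definition closed_bialg :: "('i, 'k::field) bialg \<Rightarrow> bool" where
  "closed_bialg A \<longleftrightarrow> finite (bas A) \<and> (\<forall>i\<in>bas A. \<forall>j\<in>bas A. mulc A i j \<in> vecs (bas A)) \<and>
     (\<forall>i\<in>bas A. comulc A i \<in> vecs (bas A \<times> bas A))"

lemma bmul_app: "bmul A v w x = (\<Sum>i\<in>bas A. \<Sum>j\<in>bas A. v i * w j * mulc A i j x)"
  by (simp add: bmul_def sum_fun_app scl_app)

lemma bmul_vecs: "closed_bialg A \<Longrightarrow> bmul A v w \<in> vecs (bas A)"
  unfolding bmul_def closed_bialg_def by (intro vecs_sum vecs_scl) auto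

lemma bmul_ket: "finite (bas A) \<Longrightarrow> i \<in> bas A \<Longrightarrow> j \<in> bas A \<Longrightarrow> bmul A (ket i) (ket j) = mulc A i j"
  by (simp add: fun_eq_iff bmul_app mult.assoc sum_distrib_left[symmetric] sum_ket_mult)

lemma linear_between_bmul:
  assumes "closed_bialg A"
  shows "linear_between (bas A) (bas A) (\<lambda>v. bmul A v w)"
    and "linear_between (bas A) (bas A) (\<lambda>w. bmul A v w)"
  by (auto intro!: linear_betweenI bmul_vecs assms
      simp: fun_eq_iff bmul_app scl_app algebra_simps sum.distrib sum_distrib_left)

lemma linear_between_bcomul:
  "closed_bialg A \<Longrightarrow> linear_between (bas A) (bas A \<times> bas A) (bcomul A)"
  unfolding bcomul_def by (rule linear_between_lin_ext) (auto simp: closed_bialg_def)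

lemma functional_bcounit: "finite (bas A) \<Longrightarrow> functional (bas A) (bcounit A)"
  by (simp add: functional_def bcounit_def sum_ket_mult)

lemma hopf_homD:
  assumes "f \<in> hopf_hom A B"
  shows "linear_between (bas A) (bas B) f"
    and "v \<in> vecs (bas A) \<Longrightarrow> w \<in> vecs (bas A) \<Longrightarrow> f (bmul A v w) = bmul B (f v) (f w)"
    and "f (unitc A) = unitc B"
    and "v \<in> vecs (bas A) \<Longrightarrow> bcomul B (f v) = map_pure (bas A) (bas A) f f (bcomul A v)"
    and "v \<in> vecs (bas A) \<Longrightarrow> bcounit B (f v) = bcounit A v"
  using assms by (auto simp: hopf_hom_def)

text \<open>A set spans if linear functionals are determined by their values on it.\<close>

definition spanning :: "'i set \<Rightarrow> ('i \<Rightarrow> 'k::field) set \<Rightarrow> bool" where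
  "spanning A S \<longleftrightarrow> S \<subseteq> vecs A \<and> (\<forall>f g. functional A f \<longrightarrow> functional A g \<longrightarrow>
     (\<forall>s\<in>S. f s = g s) \<longrightarrow> (\<forall>v\<in>vecs A. f v = g v))"

lemma spanning_ket: "spanning A (ket ` A)"
  by (auto simp: spanning_def vecs_ket functional_def)

lemma spanningD:
  assumes "spanning A S" "functional A f" "functional A g" "\<And>s. s \<in> S \<Longrightarrow> f s = g s" "v \<in> vecs A"
  shows "f v = g v"
  using assms by (auto simp: spanning_def)

text \<open>It suffices to test the axioms of a Hopf homomorphism on a spanning set.\<close>

lemma hopf_homI_spanning:
  assumes A: "closed_bialg A" and B: "closed_bialg B" and S: "spanning (bas A) S"
    and f: "linear_between (bas A) (bas B) f"
    and mult: "\<And>s t. s \<in> S \<Longrightarrow> t \<in> S \<Longrightarrow> f (bmul A s t) = bmul B (f s) (f t)"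
    and unit: "f (unitc A) = unitc B"
    and comult: "\<And>s. s \<in> S \<Longrightarrow> bcomul B (f s) = map_pure (bas A) (bas A) f f (bcomul A s)"
    and counit: "\<And>s. s \<in> S \<Longrightarrow> bcounit B (f s) = bcounit A s"
  shows "f \<in> hopf_hom A B"
proof -
  have finA: "finite (bas A)" and finB: "finite (bas B)"
    using A B by (auto simp: closed_bialg_def)
  note comp = functional_comp[OF _ f finA] functional_comp[OF functional_linear[OF f finA]]
  have m1: "f (bmul A v t) = bmul B (f v) (f t)" if "v \<in> vecs (bas A)" "t \<in> S" for v t
  proof
    fix x
    show "f (bmul A v t) x = bmul B (f v) (f t) x"
      by (rule spanningD[OF S _ _ _ that(1)])
         (auto simp: mult that intro!: comp linear_between_bmul[OF A] finA finB
           functional_linear[OF linear_between_bmul(1)[OF B]])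
  qed
  have m2: "f (bmul A v w) = bmul B (f v) (f w)" if "v \<in> vecs (bas A)" "w \<in> vecs (bas A)" for v w
  proof
    fix x
    show "f (bmul A v w) x = bmul B (f v) (f w) x"
      by (rule spanningD[OF S _ _ _ that(2)])
         (auto simp: m1 that intro!: comp linear_between_bmul[OF A] finA finB
           functional_linear[OF linear_between_bmul(2)[OF B]])
  qed
  have c: "bcomul B (f v) = map_pure (bas A) (bas A) f f (bcomul A v)" if "v \<in> vecs (bas A)" for v
  proof
    fix x
    show "bcomul B (f v) x = map_pure (bas A) (bas A) f f (bcomul A v) x"
      by (rule spanningD[OF S _ _ _ that])
         (auto simp: comult intro!: comp(1) functional_linear[OF linear_between_bcomul[OF B]] finA finB
           functional_linear[OF linear_between_comp[OF linear_between_bcomul[OF A] linear_between_map_pure[OF f f]]])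
  qed
  have e: "bcounit B (f v) = bcounit A v" if "v \<in> vecs (bas A)" for v
    by (rule spanningD[OF S _ _ _ that]) (auto simp: counit intro!: comp(1) functional_bcounit finA finB)
  show ?thesis
    unfolding hopf_hom_def using f m2 unit c e by auto
qed

lemma hopf_homI_ket:
  assumes A: "closed_bialg A" and B: "closed_bialg B"
    and f: "linear_between (bas A) (bas B) f"
    and mult: "\<And>i j. i \<in> bas A \<Longrightarrow> j \<in> bas A \<Longrightarrow> f (mulc A i j) = bmul B (f (ket i)) (f (ket j))"
    and unit: "f (unitc A) = unitc B"
    and comult: "\<And>i. i \<in> bas A \<Longrightarrow> bcomul B (f (ket i)) = map_pure (bas A) (bas A) f f (comulc A i)"
    and counit: "\<And>i. i \<in> bas A \<Longrightarrow> bcounit B (f (ket i)) = counitc A i"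
  shows "f \<in> hopf_hom A B"
proof (rule hopf_homI_spanning[OF A B spanning_ket f _ unit])
  have fin: "finite (bas A)"
    using A by (simp add: closed_bialg_def)
  show "f (bmul A s t) = bmul B (f s) (f t)" if "s \<in> ket ` bas A" "t \<in> ket ` bas A" for s t
    using that mult by (auto simp: bmul_ket[OF fin])
  show "bcomul B (f s) = map_pure (bas A) (bas A) f f (bcomul A s)" if "s \<in> ket ` bas A" for s
    using that comult by (auto simp: bcomul_def[of A] lin_ext_ket[OF fin])
  show "bcounit B (f s) = bcounit A s" if "s \<in> ket ` bas A" for s
    using that counit by (auto simp: bcounit_def[of A] sum_ket_mult[OF fin])
qed

lemma map_pure_comp:
  assumes "finite A" "finite B" "finite A'" "finite B'"
    and "linear_between A A' f" "linear_between B B' g" "linear_between A' A'' f'" "linear_between B' B'' g'"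
    and "t \<in> vecs (A \<times> B)"
  shows "map_pure A' B' f' g' (map_pure A B f g t) = map_pure A B (\<lambda>v. f' (f v)) (\<lambda>v. g' (g v)) t"
proof (rule linear_between_eqI[of "A \<times> B" "A'' \<times> B''" _ "A'' \<times> B''"])
  show "linear_between (A \<times> B) (A'' \<times> B'') (\<lambda>t. map_pure A' B' f' g' (map_pure A B f g t))"
    by (rule linear_between_comp[OF linear_between_map_pure[OF assms(5,6)] linear_between_map_pure[OF assms(7,8)]])
  show "linear_between (A \<times> B) (A'' \<times> B'') (map_pure A B (\<lambda>v. f' (f v)) (\<lambda>v. g' (g v)))"
    by (rule linear_between_map_pure[OF linear_between_comp[OF assms(5,7)] linear_between_comp[OF assms(6,8)]])
  fix p assume "p \<in> A \<times> B"
  then obtain i j where p: "p = (i, j)" "i \<in> A" "j \<in> B" by auto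
  show "map_pure A' B' f' g' (map_pure A B f g (ket p)) = map_pure A B (\<lambda>v. f' (f v)) (\<lambda>v. g' (g v)) (ket p)"
    using map_pure_pure[OF assms(1,2,5,6), of "ket i" "ket j"]
      map_pure_pure[OF assms(3,4,7,8), of "f (ket i)" "g (ket j)"]
      map_pure_pure[OF assms(1,2) linear_between_comp[OF assms(5,7)] linear_between_comp[OF assms(6,8)],
        of "ket i" "ket j"]
    by (simp add: p pure_ket vecs_ket linear_betweenD(1)[OF assms(5)] linear_betweenD(1)[OF assms(6)])
qed (use assms in auto)

lemma hopf_hom_comp:
  assumes A: "closed_bialg A" and B: "closed_bialg B"
    and f: "f \<in> hopf_hom A B" and g: "g \<in> hopf_hom B D"
  shows "(\<lambda>v. g (f v)) \<in> hopf_hom A D"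
proof -
  have fin: "finite (bas A)" "finite (bas B)"
    using A B by (auto simp: closed_bialg_def)
  note F = hopf_homD[OF f] and G = hopf_homD[OF g]
  note fv = linear_betweenD(1)[OF F(1)]
  have "bcomul D (g (f v)) = map_pure (bas A) (bas A) (\<lambda>v. g (f v)) (\<lambda>v. g (f v)) (bcomul A v)"
    if "v \<in> vecs (bas A)" for v
    using that by (simp add: G(4) F(4) fv map_pure_comp[OF fin(1,1,2,2) F(1,1) G(1,1)]
        linear_betweenD(1)[OF linear_between_bcomul[OF A]])
  then show ?thesis
    unfolding hopf_hom_def
    using linear_between_comp[OF F(1) G(1)] by (auto simp: F G fv)
qed

lemma unitc_group_alg_vecs: "group G \<Longrightarrow> unitc (group_alg G) \<in> vecs (bas (group_alg G))"
  by (simp add: group_alg_def vecs_ket group.is_monoid)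

lemma map_pure_inverse:
  assumes "finite A" "finite B" "linear_between A B f" "linear_between B A g"
    and "\<And>v. v \<in> vecs A \<Longrightarrow> g (f v) = v" and "t \<in> vecs (A \<times> A)"
  shows "map_pure B B g g (map_pure A A f f t) = t"
proof -
  have "map_pure B B g g (map_pure A A f f t) = map_pure A A (\<lambda>v. g (f v)) (\<lambda>v. g (f v)) t"
    using assms by (intro map_pure_comp) auto
  also have "\<dots> = t"
  proof (rule linear_between_eqI[of "A \<times> A" "A \<times> A" _ "A \<times> A"])
    have gf: "linear_between A A (\<lambda>v. g (f v))"
      by (rule linear_between_comp[OF assms(3,4)])
    show "linear_between (A \<times> A) (A \<times> A) (map_pure A A (\<lambda>v. g (f v)) (\<lambda>v. g (f v)))"
      by (rule linear_between_map_pure[OF gf gf])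
    show "map_pure A A (\<lambda>v. g (f v)) (\<lambda>v. g (f v)) (ket p) = ket p" if "p \<in> A \<times> A" for p
      using that map_pure_pure[OF assms(1,1) gf gf, of "ket (fst p)" "ket (snd p)"]
      by (auto simp: pure_ket vecs_ket assms(5))
  qed (use assms in \<open>auto intro: linear_between_id\<close>)
  finally show ?thesis .
qed

lemma hopf_iso_inverse:
  fixes f :: "('i \<Rightarrow> 'k::field) \<Rightarrow> 'j \<Rightarrow> 'k"
  assumes A: "closed_bialg A" and B: "closed_bialg B" and f: "f \<in> hopf_iso A B"
    and unit: "unitc A \<in> vecs (bas A)"
  defines "g \<equiv> the_inv_into (vecs (bas A)) f"
  shows "g \<in> hopf_hom B A" "\<And>v. v \<in> vecs (bas A) \<Longrightarrow> g (f v) = v" "\<And>w. w \<in> vecs (bas B) \<Longrightarrow> f (g w) = w"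
proof -
  have hom: "f \<in> hopf_hom A B" and bij: "bij_betw f (vecs (bas A)) (vecs (bas B))"
    using f by (auto simp: hopf_iso_def)
  have fin: "finite (bas A)" "finite (bas B)"
    using A B by (auto simp: closed_bialg_def)
  note F = hopf_homD[OF hom]
  note fv = linear_betweenD(1)[OF F(1)]
  show gf: "g (f v) = v" if "v \<in> vecs (bas A)" for v
    unfolding g_def using bij that by (simp add: the_inv_into_f_f bij_betw_imp_inj_on)
  show fg: "f (g w) = w" if "w \<in> vecs (bas B)" for w
    unfolding g_def using bij that by (simp add: f_the_inv_into_f_bij_betw)
  have gv: "g w \<in> vecs (bas A)" if "w \<in> vecs (bas B)" for w
    unfolding g_def using bij_betw_the_inv_into[OF bij] that by (rule bij_betwE[rule_format])
  have lin: "linear_between (bas B) (bas A) g"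
  proof (rule linear_betweenI)
    fix v w :: "'j \<Rightarrow> 'k" assume v: "v \<in> vecs (bas B)" "w \<in> vecs (bas B)"
    have "g (v + w) = g (f (g v) + f (g w))" using v by (simp only: fg)
    also have "f (g v) + f (g w) = f (g v + g w)"
      using v by (simp only: linear_betweenD(2)[OF F(1)] gv)
    also have "g \<dots> = g v + g w" using v by (intro gf vecs_add gv)
    finally show "g (v + w) = g v + g w" .
  next
    fix c and v :: "'j \<Rightarrow> 'k" assume v: "v \<in> vecs (bas B)"
    have "g (c \<cdot>\<^sub>v v) = g (c \<cdot>\<^sub>v f (g v))" using v by (simp only: fg)
    also have "c \<cdot>\<^sub>v f (g v) = f (c \<cdot>\<^sub>v g v)"
      using v by (simp only: linear_betweenD(3)[OF F(1)] gv)
    also have "g \<dots> = c \<cdot>\<^sub>v g v" using v by (intro gf vecs_scl gv)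
    finally show "g (c \<cdot>\<^sub>v v) = c \<cdot>\<^sub>v g v" .
  qed (rule gv)
  have mult: "g (bmul B v w) = bmul A (g v) (g w)" if "v \<in> vecs (bas B)" "w \<in> vecs (bas B)" for v w
    using gf[OF bmul_vecs[OF A], of "g v" "g w"] F(2)[OF gv gv, OF that] that by (simp add: fg)
  have comult: "bcomul A (g w) = map_pure (bas B) (bas B) g g (bcomul B w)" if "w \<in> vecs (bas B)" for w
    using F(4)[OF gv[OF that]] map_pure_inverse[OF fin F(1) lin gf, of "bcomul A (g w)"] that
      linear_betweenD(1)[OF linear_between_bcomul[OF A] gv[OF that]] by (simp add: fg)
  have counit: "bcounit A (g w) = bcounit B w" if "w \<in> vecs (bas B)" for w
    using F(5)[OF gv[OF that]] that by (simp add: fg)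
  have "g (unitc B) = unitc A"
    using gf[OF unit] F(3) by simp
  then show "g \<in> hopf_hom B A"
    unfolding hopf_hom_def using lin mult comult counit by auto
qed

section \<open>Group algebras and function algebras\<close>

lemma bas_simps [simp]:
  "bas (group_alg G) = carrier G" "bas (fun_alg G) = carrier G"
  "bas (drinfeld G) = carrier G \<times> carrier G" "bas (drinfeld_dual G) = carrier G \<times> carrier G"
  by (simp_all add: group_alg_def fun_alg_def drinfeld_def drinfeld_dual_def)

lemma struct_simps:
  "mulc (group_alg G) g h = ket (g \<otimes>\<^bsub>G\<^esub> h)" "comulc (group_alg G) g = ket (g, g)"
  "counitc (group_alg G) g = 1"
  "mulc (fun_alg G) x y = (if x = y then ket x else 0)"
  "comulc (fun_alg G) x (y, z) = (if y \<in> carrier G \<and> z \<in> carrier G \<and> y \<otimes>\<^bsub>G\<^esub> z = x then 1 else 0)"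
  "counitc (fun_alg G) x = (if x = \<one>\<^bsub>G\<^esub> then 1 else 0)"
  by (simp_all add: group_alg_def fun_alg_def)

lemma fun_alg_simps:
  "finite (carrier G) \<Longrightarrow> bmul (fun_alg G) v w x = (if x \<in> carrier G then v x * w x else 0)"
  "finite (carrier G) \<Longrightarrow> group G \<Longrightarrow> bcomul (fun_alg G) v (x, y) = (if x \<in> carrier G \<and> y \<in> carrier G then v (x \<otimes>\<^bsub>G\<^esub> y) else 0)"
  "finite (carrier G) \<Longrightarrow> group G \<Longrightarrow> bcounit (fun_alg G) v = v \<one>\<^bsub>G\<^esub>"
  "unitc (fun_alg G) x = (if x \<in> carrier G then 1 else 0)"
proof -
  assume fin: "finite (carrier G)"
  have "bmul (fun_alg G) v w x = (\<Sum>i\<in>carrier G. \<Sum>j\<in>carrier G. if j = i then (if i = x then v i * w i else 0) else 0)"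
    unfolding bmul_app by (auto simp: fun_alg_def ket_app intro!: sum.cong)
  then show "bmul (fun_alg G) v w x = (if x \<in> carrier G then v x * w x else 0)"
    using fin by (simp add: if_distrib[of "\<lambda>x. _ * x"] if_distrib[of "\<lambda>x. x * _"] cong: if_cong)
  assume G: "group G"
  interpret group G by (rule G)
  show "bcomul (fun_alg G) v (x, y) = (if x \<in> carrier G \<and> y \<in> carrier G then v (x \<otimes>\<^bsub>G\<^esub> y) else 0)"
    using fin by (auto simp: bcomul_def lin_ext_app fun_alg_def if_distrib[of "\<lambda>x. _ * x"] cong: if_cong)
  show "bcounit (fun_alg G) v = v \<one>\<^bsub>G\<^esub>"
    using fin by (auto simp: bcounit_def fun_alg_def if_distrib[of "\<lambda>x. _ * x"] cong: if_cong)
qed (simp add: fun_alg_def)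

lemma group_alg_simps:
  "finite (carrier G) \<Longrightarrow> g \<in> carrier G \<Longrightarrow> h \<in> carrier G \<Longrightarrow> bmul (group_alg G) (ket g) (ket h) = ket (g \<otimes>\<^bsub>G\<^esub> h)"
  "finite (carrier G) \<Longrightarrow> bcomul (group_alg G) v (x, y) = (if x \<in> carrier G \<and> x = y then v x else 0)"
  "bcounit (group_alg G) v = (\<Sum>x\<in>carrier G. v x)"
  "unitc (group_alg G) = ket \<one>\<^bsub>G\<^esub>"
proof -
  assume fin: "finite (carrier G)"
  show "bcomul (group_alg G) v (x, y) = (if x \<in> carrier G \<and> x = y then v x else 0)"
    using fin by (auto simp: bcomul_def lin_ext_app group_alg_def ket_app if_distrib[of "\<lambda>x. _ * x"]
        cong: if_cong intro!: sum.neutral)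
  assume "g \<in> carrier G" "h \<in> carrier G"
  then show "bmul (group_alg G) (ket g) (ket h) = ket (g \<otimes>\<^bsub>G\<^esub> h)"
    using fin by (simp add: bmul_ket) (simp add: group_alg_def)
qed (simp_all add: bcounit_def group_alg_def)

lemma closed_group_alg: "group G \<Longrightarrow> finite (carrier G) \<Longrightarrow> closed_bialg (group_alg G)"
  by (auto simp: closed_bialg_def group_alg_def intro!: vecs_ket group.is_monoid monoid.m_closed)

lemma closed_fun_alg: "group G \<Longrightarrow> finite (carrier G) \<Longrightarrow> closed_bialg (fun_alg G)"
  by (auto simp: closed_bialg_def fun_alg_def intro!: vecs_ket) (auto simp: vecs_def)

text \<open>Functoriality of \<open>kG\<close> and of \<open>k\<^sup>G\<close> in the group.\<close>

lemma grp_lin_ket: "finite (carrier G) \<Longrightarrow> g \<in> carrier G \<Longrightarrow> grp_lin G q (ket g) = ket (q g)"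
  by (simp add: grp_lin_def lin_ext_ket)

lemma hopf_hom_grp_lin:
  fixes G :: "('g, 'm) monoid_scheme" and K :: "('g, 'n) monoid_scheme"
  assumes G: "group G" "finite (carrier G)" and K: "group K" "finite (carrier K)" and q: "q \<in> hom G K"
  shows "(grp_lin G q :: ('g \<Rightarrow> 'k::field) \<Rightarrow> _) \<in> hopf_hom (group_alg G) (group_alg K)"
proof (rule hopf_homI_ket[OF closed_group_alg[OF G] closed_group_alg[OF K]])
  have qc: "q g \<in> carrier K" if "g \<in> carrier G" for g using q that by (auto simp: hom_def)
  show lin: "linear_between (bas (group_alg G)) (bas (group_alg K)) (grp_lin G q :: ('g \<Rightarrow> 'k::field) \<Rightarrow> _)"
    unfolding grp_lin_def by (auto intro!: linear_between_lin_ext vecs_ket qc)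
  show "grp_lin G q (mulc (group_alg G) i j) = bmul (group_alg K) (grp_lin G q (ket i)) (grp_lin G q (ket j))"
    if "i \<in> bas (group_alg G)" "j \<in> bas (group_alg G)" for i j
    using that G K q by (simp add: grp_lin_ket group_alg_simps qc)
      (simp add: group_alg_def grp_lin_ket group.is_monoid monoid.m_closed hom_mult)
  show "grp_lin G q (unitc (group_alg G)) = unitc (group_alg K)"
    using G K q by (simp add: group_alg_simps grp_lin_ket group.is_monoid hom_one)
  show "bcomul (group_alg K) (grp_lin G q (ket i :: 'g \<Rightarrow> 'k)) =
      map_pure (bas (group_alg G)) (bas (group_alg G)) (grp_lin G q) (grp_lin G q) (comulc (group_alg G) i)"
    if "i \<in> bas (group_alg G)" for i
  proof -
    have "map_pure (carrier G) (carrier G) (grp_lin G q) (grp_lin G q) (comulc (group_alg G) i) = (ket (q i, q i) :: _ \<Rightarrow> 'k)"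
      using map_pure_pure[OF _ _ lin lin, of "ket i" "ket i"] that G
      by (simp add: pure_ket grp_lin_ket vecs_ket struct_simps)
    then show ?thesis
      using that G K by (auto simp: fun_eq_iff group_alg_simps grp_lin_ket ket_app qc)
  qed
  show "bcounit (group_alg K) (grp_lin G q (ket i)) = counitc (group_alg G) i"
    if "i \<in> bas (group_alg G)" for i
    using that G K by (simp add: grp_lin_ket group_alg_simps ket_app qc) (simp add: group_alg_def)
qed

text \<open>Composition with \<open>q\<close>, as a map between function algebras. Functions vanish off the carrier.\<close>

definition pullback :: "('g, 'm) monoid_scheme \<Rightarrow> ('g \<Rightarrow> 'h) \<Rightarrow> ('h \<Rightarrow> 'k::field) \<Rightarrow> 'g \<Rightarrow> 'k" where
  "pullback G q f = (\<lambda>g. if g \<in> carrier G then f (q g) else 0)"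

lemma hopf_hom_pullback:
  fixes G :: "('g, 'm) monoid_scheme" and K :: "('h, 'n) monoid_scheme"
  assumes G: "group G" "finite (carrier G)" and K: "group K" "finite (carrier K)" and q: "q \<in> hom G K"
  shows "(pullback G q :: ('h \<Rightarrow> 'k::field) \<Rightarrow> _) \<in> hopf_hom (fun_alg K) (fun_alg G)"
proof (rule hopf_homI_ket[OF closed_fun_alg[OF K] closed_fun_alg[OF G]])
  have qc: "q g \<in> carrier K" if "g \<in> carrier G" for g using q that by (auto simp: hom_def)
  show lin: "linear_between (bas (fun_alg K)) (bas (fun_alg G)) (pullback G q :: ('h \<Rightarrow> 'k::field) \<Rightarrow> _)"
    by (auto intro!: linear_betweenI simp: pullback_def fun_eq_iff scl_app vecs_def)
  show "pullback G q (mulc (fun_alg K) i j) = bmul (fun_alg G) (pullback G q (ket i)) (pullback G q (ket j))" for i j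
    using G by (auto simp: fun_eq_iff fun_alg_simps) (auto simp: fun_alg_def pullback_def ket_app)
  show "pullback G q (unitc (fun_alg K)) = unitc (fun_alg G)"
    by (auto simp: fun_eq_iff fun_alg_simps pullback_def qc)
  show "bcounit (fun_alg G) (pullback G q (ket i)) = counitc (fun_alg K) i" for i
    using G K q by (simp add: fun_alg_simps pullback_def group.is_monoid hom_one ket_app struct_simps)
  show "bcomul (fun_alg G) (pullback G q (ket i :: 'h \<Rightarrow> 'k)) =
      map_pure (bas (fun_alg K)) (bas (fun_alg K)) (pullback G q) (pullback G q) (comulc (fun_alg K) i)"
    if i: "i \<in> bas (fun_alg K)" for i
  proof
    fix p :: "'g \<times> 'g"
    obtain x y where p: "p = (x, y)" by (cases p)
    have fin: "finite (carrier K \<times> carrier K)" using K by simp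
    have "map_pure (bas (fun_alg K)) (bas (fun_alg K)) (pullback G q) (pullback G q) (comulc (fun_alg K) i) p
      = (\<Sum>r\<in>carrier K \<times> carrier K. comulc (fun_alg K) i r *
          (if r = (q x, q y) then (if x \<in> carrier G \<and> y \<in> carrier G then 1 else 0) else 0) :: 'k)"
      unfolding map_pure_def lin_ext_app
      by (intro sum.cong) (auto simp: p pure_app pullback_def ket_app split: if_splits)
    also have "\<dots> = (if x \<in> carrier G \<and> y \<in> carrier G then comulc (fun_alg K) i (q x, q y) else 0)"
      using fin by (simp add: if_distrib[of "\<lambda>x. _ * x"] qc cong: if_cong)
    finally show "bcomul (fun_alg G) (pullback G q (ket i :: 'h \<Rightarrow> 'k)) p = map_pure (bas (fun_alg K)) (bas (fun_alg K)) (pullback G q) (pullback G q) (comulc (fun_alg K) i) p"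
      using G q by (simp add: p fun_alg_simps pullback_def struct_simps ket_app qc hom_mult group.is_monoid monoid.m_closed)
  qed
qed

text \<open>A Hopf algebra homomorphism \<open>kG \<rightarrow> k\<^sup>G\<close> is a bicharacter.\<close>

lemma hopf_hom_group_fun_iff:
  fixes f :: "('g \<Rightarrow> 'k::field) \<Rightarrow> 'g \<Rightarrow> 'k"
  assumes G: "group G" "finite (carrier G)" and lin: "linear_between (carrier G) (carrier G) f"
  shows "f \<in> hopf_hom (group_alg G) (fun_alg G) \<longleftrightarrow>
    (\<forall>c\<in>carrier G. f (ket c) \<one>\<^bsub>G\<^esub> = 1 \<and> f (ket \<one>\<^bsub>G\<^esub>) c = 1) \<and>
    (\<forall>c\<in>carrier G. \<forall>d\<in>carrier G. \<forall>x\<in>carrier G.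
       f (ket (c \<otimes>\<^bsub>G\<^esub> d)) x = f (ket c) x * f (ket d) x \<and>
       f (ket x) (c \<otimes>\<^bsub>G\<^esub> d) = f (ket x) c * f (ket x) d)"
proof -
  interpret group G by (rule G)
  have fv: "f v \<in> vecs (carrier G)" if "v \<in> vecs (carrier G)" for v
    using lin that by (rule linear_betweenD(1))
  have out: "f (ket c) x = 0" if "c \<in> carrier G" "x \<notin> carrier G" for c x
    using vecs_out[OF fv[OF vecs_ket]] that by auto
  have mp: "map_pure (carrier G) (carrier G) f f (comulc (group_alg G) c) = pure (f (ket c)) (f (ket c))"
    if "c \<in> carrier G" for c
    using map_pure_pure[OF G(2) G(2) lin lin, of "ket c" "ket c"] that
    by (simp add: group_alg_def pure_ket vecs_ket)
  have bc: "bcomul (group_alg G) (ket c) = comulc (group_alg G) c" if "c \<in> carrier G" for c :: 'g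
    using that G by (simp add: bcomul_def lin_ext_ket)
  show ?thesis
  proof
    assume f: "f \<in> hopf_hom (group_alg G) (fun_alg G)"
    note D = hopf_homD[OF f, simplified]
    have e1: "f (ket c) \<one>\<^bsub>G\<^esub> = 1" if "c \<in> carrier G" for c
      using D(5)[OF vecs_ket[OF that]] that G by (simp add: fun_alg_simps group_alg_simps ket_app)
    have e2: "f (ket \<one>\<^bsub>G\<^esub>) c = 1" if "c \<in> carrier G" for c
      using fun_cong[OF D(3), of c] that by (simp add: fun_alg_simps group_alg_simps)
    have e3: "f (ket (c \<otimes>\<^bsub>G\<^esub> d)) x = f (ket c) x * f (ket d) x"
      if "c \<in> carrier G" "d \<in> carrier G" "x \<in> carrier G" for c d x
      using fun_cong[OF D(2)[OF vecs_ket vecs_ket], of c d x] that G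
      by (simp add: fun_alg_simps group_alg_simps)
    have e4: "f (ket x) (c \<otimes>\<^bsub>G\<^esub> d) = f (ket x) c * f (ket x) d"
      if "c \<in> carrier G" "d \<in> carrier G" "x \<in> carrier G" for c d x
      using fun_cong[OF D(4)[OF vecs_ket], of x "(c, d)"] that G
      by (simp add: fun_alg_simps bc mp pure_app)
    show "(\<forall>c\<in>carrier G. f (ket c) \<one>\<^bsub>G\<^esub> = 1 \<and> f (ket \<one>\<^bsub>G\<^esub>) c = 1) \<and>
    (\<forall>c\<in>carrier G. \<forall>d\<in>carrier G. \<forall>x\<in>carrier G.
       f (ket (c \<otimes>\<^bsub>G\<^esub> d)) x = f (ket c) x * f (ket d) x \<and>
       f (ket x) (c \<otimes>\<^bsub>G\<^esub> d) = f (ket x) c * f (ket x) d)"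
      by (intro conjI ballI) (rule e1 e2 e3 e4; assumption)+
  next
    assume R: "(\<forall>c\<in>carrier G. f (ket c) \<one>\<^bsub>G\<^esub> = 1 \<and> f (ket \<one>\<^bsub>G\<^esub>) c = 1) \<and>
    (\<forall>c\<in>carrier G. \<forall>d\<in>carrier G. \<forall>x\<in>carrier G.
       f (ket (c \<otimes>\<^bsub>G\<^esub> d)) x = f (ket c) x * f (ket d) x \<and>
       f (ket x) (c \<otimes>\<^bsub>G\<^esub> d) = f (ket x) c * f (ket x) d)"
    show "f \<in> hopf_hom (group_alg G) (fun_alg G)"
    proof (rule hopf_homI_ket[OF closed_group_alg[OF G] closed_fun_alg[OF G]], unfold bas_simps)
      show "f (mulc (group_alg G) i j) = bmul (fun_alg G) (f (ket i)) (f (ket j))"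
        if "i \<in> carrier G" "j \<in> carrier G" for i j
        using that G R by (auto simp: fun_eq_iff fun_alg_simps) (auto simp: group_alg_def out)
      show "f (unitc (group_alg G)) = unitc (fun_alg G)"
        using R by (auto simp: fun_eq_iff fun_alg_simps group_alg_simps out)
      show "bcomul (fun_alg G) (f (ket i)) = map_pure (carrier G) (carrier G) f f (comulc (group_alg G) i)"
        if "i \<in> carrier G" for i
        using that G R by (auto simp: fun_eq_iff fun_alg_simps mp pure_app out)
      show "bcounit (fun_alg G) (f (ket i)) = counitc (group_alg G) i" if "i \<in> carrier G" for i
        using that G R by (auto simp: fun_alg_simps) (auto simp: group_alg_def)
    qed (rule lin)
  qed
qed

section \<open>The Drinfeld double\<close>

lemma drinfeld_struct:
  "mulc (drinfeld G) (x, y) (x', y') =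
    (if x = y \<otimes>\<^bsub>G\<^esub> x' \<otimes>\<^bsub>G\<^esub> inv\<^bsub>G\<^esub> y then ket (x, y \<otimes>\<^bsub>G\<^esub> y') else 0)"
  "unitc (drinfeld G) (x, y) = (if x \<in> carrier G \<and> y = \<one>\<^bsub>G\<^esub> then 1 else 0)"
  "comulc (drinfeld G) (x, y) ((x1, y1), (x2, y2)) =
    (if x1 \<in> carrier G \<and> x2 \<in> carrier G \<and> x1 \<otimes>\<^bsub>G\<^esub> x2 = x \<and> y1 = y \<and> y2 = y then 1 else 0)"
  "counitc (drinfeld G) (x, y) = (if x = \<one>\<^bsub>G\<^esub> then 1 else 0)"
  by (simp_all add: drinfeld_def)

locale fin_group = group G for G :: "('g, 'm) monoid_scheme" (structure) +
  assumes fin: "finite (carrier G)"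
begin

text \<open>The index set of the basis of \<open>DG\<close> and of its dual.\<close>

abbreviation GG :: "('g \<times> 'g) set" where
  "GG \<equiv> carrier G \<times> carrier G"

lemma closed_drinfeld: "closed_bialg (drinfeld G :: ('g \<times> 'g, 'k::field) bialg)"
  using fin by (auto simp: closed_bialg_def drinfeld_struct vecs_ket)
    (auto simp: vecs_def drinfeld_def)

lemma drinfeld_simps:
  "bcomul (drinfeld G) v ((x1, y1), (x2, y2)) =
     (if x1 \<in> carrier G \<and> x2 \<in> carrier G \<and> y1 \<in> carrier G \<and> y2 = y1 then v (x1 \<otimes> x2, y1) else 0)"
  "bcounit (drinfeld G) v = (\<Sum>y\<in>carrier G. v (\<one>, y))"
proof -
  have "bcomul (drinfeld G) v ((x1, y1), (x2, y2)) = (\<Sum>p\<in>GG.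
      if p = (x1 \<otimes> x2, y1) then (if x1 \<in> carrier G \<and> x2 \<in> carrier G \<and> y2 = y1 then v p else 0) else 0)"
    unfolding bcomul_def lin_ext_app bas_simps
    by (intro sum.cong) (auto simp: drinfeld_struct split: if_splits)
  then show "bcomul (drinfeld G) v ((x1, y1), (x2, y2)) =
     (if x1 \<in> carrier G \<and> x2 \<in> carrier G \<and> y1 \<in> carrier G \<and> y2 = y1 then v (x1 \<otimes> x2, y1) else 0)"
    using fin by simp
  have "bcounit (drinfeld G) v = (\<Sum>x\<in>carrier G. \<Sum>y\<in>carrier G. if x = \<one> then v (\<one>, y) else 0)"
    unfolding bcounit_def bas_simps sum.cartesian_product
    by (intro sum.cong) (auto simp: drinfeld_struct)
  then show "bcounit (drinfeld G) v = (\<Sum>y\<in>carrier G. v (\<one>, y))"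
    using fin by (subst (asm) sum.swap) simp
qed

text \<open>\<open>(f \<times> y)(f' \<times> y') = f \<cdot> \<^sup>yf' \<times> yy'\<close>.\<close>

lemma bmul_drinfeld_pure:
  assumes f: "f \<in> vecs (carrier G)" "f' \<in> vecs (carrier G)" and y: "y \<in> carrier G" "y' \<in> carrier G"
  shows "bmul (drinfeld G) (pure f (ket y)) (pure f' (ket y')) =
    pure (\<lambda>x. if x \<in> carrier G then f x * f' (inv y \<otimes> x \<otimes> y) else 0) (ket (y \<otimes> y'))"
proof
  fix p :: "'g \<times> 'g"
  obtain x z where p: "p = (x, z)" by (cases p)
  have inner: "(\<Sum>j\<in>GG. pure f (ket y) (a, b) * pure f' (ket y') j * mulc (drinfeld G) (a, b) j p)
     = (if b = y then if a = x then f x * f' (inv y \<otimes> x \<otimes> y) * ket (y \<otimes> y') z else 0 else 0)"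
    if "a \<in> carrier G" "b \<in> carrier G" for a b
  proof -
    have eq: "a = y \<otimes> a' \<otimes> inv y \<longleftrightarrow> a' = inv y \<otimes> a \<otimes> y" if "a' \<in> carrier G" "a \<in> carrier G" for a a'
      using that y by (auto simp: m_assoc) (simp_all add: m_assoc[symmetric])
    have "(\<Sum>j\<in>GG. pure f (ket y) (a, b) * pure f' (ket y') j * mulc (drinfeld G) (a, b) j p)
      = (\<Sum>j\<in>GG. if j = (inv y \<otimes> a \<otimes> y, y')
           then if b = y then if a = x then f x * f' (inv y \<otimes> x \<otimes> y) * ket (y \<otimes> y') z else 0 else 0 else 0)"
      using that by (intro sum.cong refl) (auto simp: pure_app ket_app drinfeld_struct p eq split: if_splits)
    also have "\<dots> = (if b = y then if a = x then f x * f' (inv y \<otimes> x \<otimes> y) * ket (y \<otimes> y') z else 0 else 0)"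
      using fin that y by simp
    finally show ?thesis .
  qed
  have "bmul (drinfeld G) (pure f (ket y)) (pure f' (ket y')) p
     = (\<Sum>i\<in>GG. if i = (x, y) then f x * f' (inv y \<otimes> x \<otimes> y) * ket (y \<otimes> y') z else 0)"
    unfolding bmul_app bas_simps by (rule sum.cong) (auto simp: inner split: if_splits)
  also have "\<dots> = pure (\<lambda>x. if x \<in> carrier G then f x * f' (inv y \<otimes> x \<otimes> y) else 0) (ket (y \<otimes> y')) p"
    using fin y by (auto simp: p pure_app)
  finally show "bmul (drinfeld G) (pure f (ket y)) (pure f' (ket y')) p = \<dots>" .
qed

end

section \<open>Dual maps\<close>

lemma linear_between_dual_map: "linear_between B A (dual_map A B f)"
  by (rule linear_betweenI)
     (auto simp: dual_map_def vecs_def fun_eq_iff scl_app algebra_simps sum.distrib sum_distrib_left)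

lemma dual_map_comp:
  assumes "finite A" "finite B" "linear_between A B f" "linear_between B A g"
    and "\<And>v. v \<in> vecs A \<Longrightarrow> g (f v) = v" and "w \<in> vecs A"
  shows "dual_map A B f (dual_map B A g w) = w"
proof (rule vecs_eqI)
  fix i assume i: "i \<in> A"
  have "dual_map A B f (dual_map B A g w) i = (\<Sum>j\<in>B. \<Sum>k\<in>A. w k * (f (ket i) j * g (ket j) k))"
    using i by (simp add: dual_map_def sum_distrib_right mult.assoc mult.left_commute mult.commute[of "f (ket i) _"])
  also have "\<dots> = (\<Sum>k\<in>A. w k * (\<Sum>j\<in>B. f (ket i) j * g (ket j) k))"
    by (subst sum.swap) (simp add: sum_distrib_left)
  also have "\<dots> = (\<Sum>k\<in>A. w k * g (f (ket i)) k)"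
    using linear_between_expand[OF assms(4,2) linear_betweenD(1)[OF assms(3) vecs_ket[OF i]]]
    by (simp add: sum_fun_app scl_app)
  also have "\<dots> = w i"
    using i assms(1) by (simp add: assms(5) vecs_ket sum_ket_mult)
  finally show "dual_map A B f (dual_map B A g w) i = w i" .
qed (auto intro!: linear_betweenD(1)[OF linear_between_dual_map] assms(6))

section \<open>Reflections\<close>

text \<open>A reflection \<open>r\<^bsub>H,C,\<delta>\<^esub>\<close>. Here \<open>hp\<close> and \<open>cp\<close> are the projections to the two factors, and \<open>\<delta>i\<close> is
  the inverse of \<open>\<delta>\<close> on \<open>k\<^sup>C\<close>.\<close>

locale refl_datum = fin_group G for G :: "('g, 'm) monoid_scheme" (structure) +
  fixes H C :: "'g set" and \<delta> :: "('g \<Rightarrow> 'k::field) \<Rightarrow> 'g \<Rightarrow> 'k"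
  assumes datum: "is_reflection_datum G H C \<delta>"
begin

abbreviation hp where "hp \<equiv> hpart G H C"
abbreviation cp where "cp \<equiv> cpart G H C"
abbreviation \<delta>i where "\<delta>i \<equiv> the_inv_into (vecs C) \<delta>"
abbreviation GH where "GH \<equiv> G\<lparr>carrier := H\<rparr>"
abbreviation GC where "GC \<equiv> G\<lparr>carrier := C\<rparr>"

lemma subH: "subgroup H G" and subC: "subgroup C G"
  using datum by (auto simp: is_reflection_datum_def)

lemma groupC: "group GC"
  by (rule subgroup.subgroup_is_group[OF subC is_group])

lemma HG [simp, intro]: "h \<in> H \<Longrightarrow> h \<in> carrier G" and CG [simp, intro]: "c \<in> C \<Longrightarrow> c \<in> carrier G"
  using subgroup.subset[OF subH] subgroup.subset[OF subC] by auto

lemma one_HC [simp, intro]: "\<one> \<in> H" "\<one> \<in> C"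
  using subgroup.one_closed[OF subH] subgroup.one_closed[OF subC] by auto

lemma closed_HC [simp, intro]:
  "h \<in> H \<Longrightarrow> h' \<in> H \<Longrightarrow> h \<otimes> h' \<in> H" "c \<in> C \<Longrightarrow> c' \<in> C \<Longrightarrow> c \<otimes> c' \<in> C"
  "h \<in> H \<Longrightarrow> inv h \<in> H" "c \<in> C \<Longrightarrow> inv c \<in> C"
  using subgroup.m_closed[OF subH] subgroup.m_closed[OF subC]
    subgroup.m_inv_closed[OF subH] subgroup.m_inv_closed[OF subC] by auto

lemma finHC: "finite H" "finite C"
  using fin subgroup.subset[OF subH] subgroup.subset[OF subC] finite_subset by blast+

lemma bij_HC: "bij_betw (\<lambda>(h, c). h \<otimes> c) (H \<times> C) (carrier G)"
  using datum by (auto simp: is_reflection_datum_def iso_def)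

lemma commute_CC: "c \<in> C \<Longrightarrow> d \<in> C \<Longrightarrow> c \<otimes> d = d \<otimes> c"
  using datum comm_monoid.m_comm[of GC c d] by (auto simp: is_reflection_datum_def comm_group_def)

lemma mult_parts:
  assumes "h \<in> H" "h' \<in> H" "c \<in> C" "c' \<in> C"
  shows "(h \<otimes> c) \<otimes> (h' \<otimes> c') = (h \<otimes> h') \<otimes> (c \<otimes> c')"
proof -
  have "(\<lambda>(h, c). h \<otimes> c) \<in> hom (GH \<times>\<times> GC) G"
    using datum by (auto simp: is_reflection_datum_def iso_def)
  from hom_mult[OF this, of "(h, c)" "(h', c')"] show ?thesis
    using assms by simp
qed

lemma commute_HC: "h \<in> H \<Longrightarrow> c \<in> C \<Longrightarrow> c \<otimes> h = h \<otimes> c"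
  using mult_parts[of \<one> h c \<one>] by simp

lemma parts [simp]: "x \<in> carrier G \<Longrightarrow> hp x \<in> H" "x \<in> carrier G \<Longrightarrow> cp x \<in> C"
  and parts_mult: "x \<in> carrier G \<Longrightarrow> hp x \<otimes> cp x = x"
  and parts_of [simp]: "h \<in> H \<Longrightarrow> c \<in> C \<Longrightarrow> hp (h \<otimes> c) = h" "h \<in> H \<Longrightarrow> c \<in> C \<Longrightarrow> cp (h \<otimes> c) = c"
proof -
  let ?m = "\<lambda>(h, c). h \<otimes> c"
  have inj: "inj_on ?m (H \<times> C)" and im: "?m ` (H \<times> C) = carrier G"
    using bij_HC by (auto simp: bij_betw_def)
  {
    assume x: "x \<in> carrier G"
    have "decompose G H C x \<in> H \<times> C"
      unfolding decompose_def by (rule the_inv_into_into[OF inj]) (use x im in auto)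
    then show "hp x \<in> H" "cp x \<in> C" by (auto simp: mem_Times_iff)
    have "?m (decompose G H C x) = x"
      unfolding decompose_def by (rule f_the_inv_into_f[OF inj]) (use x im in auto)
    then show "hp x \<otimes> cp x = x" by (simp add: case_prod_beta')
  }
  assume hc: "h \<in> H" "c \<in> C"
  have "decompose G H C (h \<otimes> c) = (h, c)"
    unfolding decompose_def using the_inv_into_f_f[OF inj, of "(h, c)"] hc by simp
  then show "hp (h \<otimes> c) = h" "cp (h \<otimes> c) = c" by auto
qed

lemma parts_eqI: "x \<in> carrier G \<Longrightarrow> y \<in> carrier G \<Longrightarrow> hp x = hp y \<Longrightarrow> cp x = cp y \<Longrightarrow> x = y"
  by (metis parts_mult)

lemma parts_hom:
  assumes "x \<in> carrier G" "y \<in> carrier G"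
  shows "hp (x \<otimes> y) = hp x \<otimes> hp y" "cp (x \<otimes> y) = cp x \<otimes> cp y"
proof -
  have "x \<otimes> y = (hp x \<otimes> hp y) \<otimes> (cp x \<otimes> cp y)"
    using mult_parts[of "hp x" "hp y" "cp x" "cp y"] assms by (simp add: parts_mult)
  then show "hp (x \<otimes> y) = hp x \<otimes> hp y" "cp (x \<otimes> y) = cp x \<otimes> cp y"
    using assms by simp_all
qed

lemma hom_parts: "hp \<in> hom G GH" "hp \<in> hom G G" "cp \<in> hom G GC" "cp \<in> hom G G"
  by (auto simp: hom_def parts_hom)

lemma parts_own [simp]: "h \<in> H \<Longrightarrow> hp h = h" "h \<in> H \<Longrightarrow> cp h = \<one>" "c \<in> C \<Longrightarrow> hp c = \<one>" "c \<in> C \<Longrightarrow> cp c = c"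
  using parts_of[of h \<one>] parts_of[of \<one> c] by auto

lemma parts_inv: "x \<in> carrier G \<Longrightarrow> hp (inv x) = inv (hp x)" "x \<in> carrier G \<Longrightarrow> cp (inv x) = inv (cp x)"
  using group_hom.hom_inv[of G G hp x] group_hom.hom_inv[of G G cp x] hom_parts is_group
  by (auto simp: group_hom_def group_hom_axioms_def)

lemma central: "c \<in> C \<Longrightarrow> x \<in> carrier G \<Longrightarrow> c \<otimes> x = x \<otimes> c"
  by (rule parts_eqI) (auto simp: parts_hom commute_CC)

lemma hopf_\<delta>: "\<delta> \<in> hopf_iso (group_alg GC) (fun_alg GC)"
  using datum by (simp add: is_reflection_datum_def)

lemma lin_\<delta>: "linear_between C C \<delta>"
  using hopf_\<delta> by (auto simp: hopf_iso_def hopf_hom_def)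

lemma bichar:
  assumes "c \<in> C" "d \<in> C" "x \<in> C"
  shows "\<delta> (ket (c \<otimes> d)) x = \<delta> (ket c) x * \<delta> (ket d) x" "\<delta> (ket x) (c \<otimes> d) = \<delta> (ket x) c * \<delta> (ket x) d"
    and "\<delta> (ket c) \<one> = 1" "\<delta> (ket \<one>) c = 1"
  using hopf_hom_group_fun_iff[of GC \<delta>] groupC finHC lin_\<delta> hopf_\<delta> assms
  by (auto simp: hopf_iso_def)

lemma bichar_one: "c \<in> C \<Longrightarrow> \<delta> (ket c) \<one> = 1" "c \<in> C \<Longrightarrow> \<delta> (ket \<one>) c = 1"
  using bichar(3,4)[of c \<one> \<one>] by auto

lemma hopf_\<delta>i: "\<delta>i \<in> hopf_hom (fun_alg GC) (group_alg GC)"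
  and \<delta>i_\<delta>: "v \<in> vecs C \<Longrightarrow> \<delta>i (\<delta> v) = v" and \<delta>_\<delta>i: "w \<in> vecs C \<Longrightarrow> \<delta> (\<delta>i w) = w"
  using hopf_iso_inverse[OF closed_group_alg closed_fun_alg hopf_\<delta> unitc_group_alg_vecs] groupC finHC
  by simp_all

lemma lin_\<delta>i: "linear_between C C \<delta>i"
  using hopf_\<delta>i by (auto simp: hopf_hom_def)

lemma \<delta>_vecs: "v \<in> vecs C \<Longrightarrow> \<delta> v \<in> vecs C" and \<delta>i_vecs: "v \<in> vecs C \<Longrightarrow> \<delta>i v \<in> vecs C"
  by (rule linear_betweenD(1)[OF lin_\<delta>] linear_betweenD(1)[OF lin_\<delta>i]; assumption)+

text \<open>In coordinates \<open>\<delta>\<close> and \<open>\<delta>\<^sup>-\<^sup>1\<close> are inverse matrices; this is Fourier inversion on \<open>C\<close>.\<close>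

lemma \<delta>_\<delta>i_sum: "w \<in> vecs C \<Longrightarrow> (\<Sum>d\<in>C. \<delta>i w d * \<delta> (ket d) x) = w x"
  using linear_between_expand[OF lin_\<delta> finHC(2) \<delta>i_vecs, of w]
  by (simp add: \<delta>_\<delta>i fun_eq_iff sum_fun_app scl_app)

lemma \<delta>i_\<delta>_sum: "v \<in> vecs C \<Longrightarrow> (\<Sum>c\<in>C. \<delta> v c * \<delta>i (ket c) x) = v x"
  using linear_between_expand[OF lin_\<delta>i finHC(2) \<delta>_vecs, of v]
  by (simp add: \<delta>i_\<delta> fun_eq_iff sum_fun_app scl_app)

lemma \<delta>i_sum: "w \<in> vecs C \<Longrightarrow> (\<Sum>c\<in>C. w c * \<delta>i (ket c) x) = \<delta>i w x"
  using linear_between_expand[OF lin_\<delta>i finHC(2), of w] by (simp add: sum_fun_app scl_app)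

lemma \<delta>i_unit: "(\<Sum>c\<in>C. \<delta>i (ket c) x) = ket \<one> x"
  using \<delta>i_\<delta>_sum[of "ket \<one>" x] by (simp add: bichar_one vecs_ket)

lemma join_app: "join G H C f f' x = (if x \<in> carrier G then f (hp x) * f' (cp x) else 0)"
  by (simp add: join_def)

lemma join_vecs: "join G H C f f' \<in> vecs (carrier G)"
  by (simp add: vecs_def join_app)

lemma join_ket: "h \<in> H \<Longrightarrow> c \<in> C \<Longrightarrow> join G H C (ket h) (ket c) = ket (h \<otimes> c)"
  by (auto simp: fun_eq_iff join_app ket_app parts_mult)

lemma reflection_ket:
  "x \<in> carrier G \<Longrightarrow> y \<in> carrier G \<Longrightarrow> reflection G H C \<delta> (ket (x, y)) =
     pure (join G H C (ket (hp x)) (\<delta> (ket (cp y)))) (join G H C (ket (hp y)) (\<delta>i (ket (cp x))))"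
  using fin by (simp add: reflection_def lin_ext_ket)

lemma lin_reflection: "linear_between GG GG (reflection G H C \<delta>)"
  unfolding reflection_def by (rule linear_between_lin_ext) (auto intro!: pure_vecs join_vecs)

text \<open>The element \<open>e\<^sub>h \<delta>(c) \<times> y\<close> of \<open>DG\<close>, where \<open>e\<^sub>h \<in> k\<^sup>H\<close>. For \<open>h \<in> H\<close>, \<open>c \<in> C\<close> and \<open>y \<in> G\<close> these
  span \<open>DG\<close>, and the reflection permutes them.\<close>

definition mixed :: "'g \<Rightarrow> 'g \<Rightarrow> 'g \<Rightarrow> 'g \<times> 'g \<Rightarrow> 'k" where
  "mixed h c y = pure (join G H C (ket h) (\<delta> (ket c))) (ket y)"

lemma mixed_vecs: "y \<in> carrier G \<Longrightarrow> mixed h c y \<in> vecs GG"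
  unfolding mixed_def by (intro pure_vecs join_vecs vecs_ket)

lemma reflection_mixed:
  assumes "h \<in> H" "c \<in> C" "y \<in> H" "d \<in> C"
  shows "reflection G H C \<delta> (mixed h c (y \<otimes> d)) = mixed h d (y \<otimes> c)"
proof -
  have "mixed h c (y \<otimes> d) = (\<Sum>a\<in>C. \<delta> (ket c) a \<cdot>\<^sub>v ket (h \<otimes> a, y \<otimes> d))"
  proof
    fix p :: "'g \<times> 'g"
    obtain x z where p: "p = (x, z)" by (cases p)
    have "(\<Sum>a\<in>C. \<delta> (ket c) a \<cdot>\<^sub>v ket (h \<otimes> a, y \<otimes> d)) p =
       (\<Sum>a\<in>C. if a = cp x then (if x \<in> carrier G \<and> hp x = h \<and> z = y \<otimes> d then \<delta> (ket c) a else 0) else 0)"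
      unfolding sum_fun_app scl_app p using assms by (intro sum.cong) (auto simp: ket_app parts_mult)
    then show "mixed h c (y \<otimes> d) p = (\<Sum>a\<in>C. \<delta> (ket c) a \<cdot>\<^sub>v ket (h \<otimes> a, y \<otimes> d)) p"
      using finHC by (auto simp: p mixed_def pure_app join_app ket_app)
  qed
  then have "reflection G H C \<delta> (mixed h c (y \<otimes> d)) =
      (\<Sum>a\<in>C. \<delta> (ket c) a \<cdot>\<^sub>v reflection G H C \<delta> (ket (h \<otimes> a, y \<otimes> d)))"
    using assms by (simp add: linear_between_sum[OF lin_reflection] vecs_scl vecs_ket
        linear_betweenD(3)[OF lin_reflection])
  also have "\<dots> = (\<Sum>a\<in>C. \<delta> (ket c) a \<cdot>\<^sub>v pure (join G H C (ket h) (\<delta> (ket d))) (join G H C (ket y) (\<delta>i (ket a))))"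
    using assms by (intro sum.cong) (auto simp: reflection_ket)
  also have "\<dots> = pure (join G H C (ket h) (\<delta> (ket d))) (join G H C (ket y) (ket c))"
  proof
    fix p :: "'g \<times> 'g"
    obtain x z where p: "p = (x, z)" by (cases p)
    have "(\<Sum>a\<in>C. \<delta> (ket c) a * (k1 * (k2 * (k3 * \<delta>i (ket a) z)))) = k1 * (k2 * (k3 * ket c z))" for k1 k2 k3 z
      using \<delta>i_\<delta>_sum[OF vecs_ket[OF assms(2)], of z]
      by (simp add: sum_distrib_left[symmetric] mult.left_commute[of "\<delta> _ _"])
    then show "(\<Sum>a\<in>C. \<delta> (ket c) a \<cdot>\<^sub>v pure (join G H C (ket h) (\<delta> (ket d))) (join G H C (ket y) (\<delta>i (ket a)))) p
      = pure (join G H C (ket h) (\<delta> (ket d))) (join G H C (ket y) (ket c)) p"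
      by (simp add: sum_fun_app scl_app p pure_app join_app mult.assoc)
  qed
  finally show ?thesis
    using assms by (simp add: join_ket mixed_def)
qed

lemma spanning_mixed:
  "spanning GG {mixed h c (y \<otimes> d) | h c y d. h \<in> H \<and> c \<in> C \<and> y \<in> H \<and> d \<in> C}"
    (is "spanning _ ?S")
  unfolding spanning_def
proof (intro conjI allI impI)
  show "?S \<subseteq> vecs GG"
    by (auto intro!: mixed_vecs)
  fix f g :: "('g \<times> 'g \<Rightarrow> 'k) \<Rightarrow> 'k"
  assume fg: "functional GG f" "functional GG g"
    and eq: "\<forall>s\<in>?S. f s = g s"
  show "\<forall>v\<in>vecs GG. f v = g v"
  proof (rule ballI, rule functional_eqI[OF fg])
    fix p assume "p \<in> GG"
    then obtain x y where p: "p = (x, y)" and xy: "x \<in> carrier G" "y \<in> carrier G" by auto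
    \<comment> \<open>\<open>e\<^bsub>x\<^esub> = e\<^bsub>hp x\<^esub> e\<^bsub>cp x\<^esub>\<close>, and the second factor is expanded in characters\<close>
    have k: "ket p = (\<Sum>c\<in>C. \<delta>i (ket (cp x)) c \<cdot>\<^sub>v mixed (hp x) c y)"
    proof
      fix q :: "'g \<times> 'g"
      obtain x' y' where q: "q = (x', y')" by (cases q)
      have "(\<Sum>c\<in>C. \<delta>i (ket (cp x)) c \<cdot>\<^sub>v mixed (hp x) c y) q =
        (if x' \<in> carrier G then ket (hp x) (hp x') * ((\<Sum>c\<in>C. \<delta>i (ket (cp x)) c * \<delta> (ket c) (cp x')) * ket y y') else 0)"
        by (simp add: sum_fun_app scl_app q mixed_def pure_app join_app sum_distrib_left sum_distrib_right
            mult.left_commute mult.assoc)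
      also have "\<dots> = ket p q"
        using xy parts_eqI[of x' x] by (auto simp: \<delta>_\<delta>i_sum vecs_ket p q ket_app)
      finally show "ket p q = (\<Sum>c\<in>C. \<delta>i (ket (cp x)) c \<cdot>\<^sub>v mixed (hp x) c y) q" by simp
    qed
    have "f (mixed (hp x) c y) = g (mixed (hp x) c y)" if "c \<in> C" for c
    proof -
      have "mixed (hp x) c (hp y \<otimes> cp y) \<in> ?S"
        by (rule CollectI, rule exI[of _ "hp x"], rule exI[of _ c], rule exI[of _ "hp y"], rule exI[of _ "cp y"])
           (use xy that in simp)
      then show ?thesis using eq xy by (simp add: parts_mult)
    qed
    then show "f (ket p) = g (ket p)"
      unfolding k using xy
      by (simp add: functional_sum[OF fg(1)] functional_sum[OF fg(2)] mixed_vecs)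
  qed
qed

lemma bmul_mixed:
  assumes "h \<in> H" "c \<in> C" "h' \<in> H" "c' \<in> C" "y \<in> carrier G" "y' \<in> carrier G"
  shows "bmul (drinfeld G) (mixed h c y) (mixed h' c' y') =
    (if h = hp y \<otimes> h' \<otimes> inv (hp y) then mixed h (c \<otimes> c') (y \<otimes> y') else 0)"
proof -
  have eq: "inv (hp y) \<otimes> h \<otimes> hp y = h' \<longleftrightarrow> h = hp y \<otimes> h' \<otimes> inv (hp y)"
    using assms by (auto simp: m_assoc) (simp_all add: m_assoc[symmetric])
  have "cp (inv y \<otimes> x \<otimes> y) = cp x" if "x \<in> carrier G" for x
  proof -
    have "cp (inv y \<otimes> x \<otimes> y) = cp x \<otimes> inv (cp y) \<otimes> cp y"
      using that assms commute_CC[of "inv (cp y)" "cp x"] by (simp add: parts_hom parts_inv)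
    then show ?thesis using that assms by (simp add: m_assoc)
  qed
  note cpc = this
  show ?thesis
  proof
    fix p :: "'g \<times> 'g"
    obtain x z where p: "p = (x, z)" by (cases p)
    show "bmul (drinfeld G) (mixed h c y) (mixed h' c' y') p =
      (if h = hp y \<otimes> h' \<otimes> inv (hp y) then mixed h (c \<otimes> c') (y \<otimes> y') else 0) p"
    proof (cases "x \<in> carrier G \<and> hp x = h")
      case True
      have "hp (inv y \<otimes> x \<otimes> y) = inv (hp y) \<otimes> h \<otimes> hp y"
        using True assms by (simp add: parts_hom parts_inv)
      then show ?thesis
        using True assms eq
        by (simp add: mixed_def bmul_drinfeld_pure[OF join_vecs join_vecs assms(5,6)] p pure_app join_app cpc
            bichar ket_app)
    qed (auto simp: mixed_def bmul_drinfeld_pure[OF join_vecs join_vecs assms(5,6)] p pure_app join_app ket_app)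
  qed
qed

lemma unit_mixed: "unitc (drinfeld G) = (\<Sum>h\<in>H. mixed h \<one> \<one>)"
proof
  fix p :: "'g \<times> 'g"
  obtain x y where p: "p = (x, y)" by (cases p)
  have "(\<Sum>h\<in>H. mixed h \<one> \<one>) p = (\<Sum>h\<in>H. if h = hp x then (if x \<in> carrier G \<and> y = \<one> then 1 else 0) else 0)"
    unfolding sum_fun_app p by (intro sum.cong) (auto simp: mixed_def pure_app join_app ket_app bichar_one)
  then show "unitc (drinfeld G) p = (\<Sum>h\<in>H. mixed h \<one> \<one>) p"
    using finHC by (auto simp: p drinfeld_struct)
qed

lemma bcomul_mixed:
  assumes "h \<in> H" "c \<in> C" "y \<in> carrier G"
  shows "bcomul (drinfeld G) (mixed h c y) = (\<Sum>h'\<in>H. pure (mixed h' c y) (mixed (inv h' \<otimes> h) c y))"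
proof
  fix p :: "('g \<times> 'g) \<times> ('g \<times> 'g)"
  obtain x1 y1 x2 y2 where p: "p = ((x1, y1), (x2, y2))" by (metis surj_pair)
  have eq: "hp x2 = inv h' \<otimes> h \<longleftrightarrow> h' \<otimes> hp x2 = h" if "x2 \<in> carrier G" "h' \<in> H" for h'
    using that assms by (auto simp: m_assoc[symmetric])
  have "(\<Sum>h'\<in>H. pure (mixed h' c y) (mixed (inv h' \<otimes> h) c y)) p =
    (\<Sum>h'\<in>H. if h' = hp x1 then (if x1 \<in> carrier G \<and> x2 \<in> carrier G \<and> h' \<otimes> hp x2 = h \<and> y1 = y \<and> y2 = y
        then \<delta> (ket c) (cp x1) * \<delta> (ket c) (cp x2) else 0) else 0)"
    unfolding sum_fun_app p by (intro sum.cong) (auto simp: mixed_def pure_app join_app ket_app eq)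
  also have "\<dots> = bcomul (drinfeld G) (mixed h c y) p"
    using finHC assms
    by (auto simp: p drinfeld_simps mixed_def pure_app join_app ket_app parts_hom bichar)
  finally show "bcomul (drinfeld G) (mixed h c y) p = (\<Sum>h'\<in>H. pure (mixed h' c y) (mixed (inv h' \<otimes> h) c y)) p"
    by simp
qed

lemma bcounit_mixed:
  "h \<in> H \<Longrightarrow> c \<in> C \<Longrightarrow> y \<in> carrier G \<Longrightarrow> bcounit (drinfeld G) (mixed h c y) = (if h = \<one> then 1 else 0)"
  using fin by (auto simp: drinfeld_simps mixed_def pure_app join_app bichar_one ket_app)

lemma reflection_hopf_hom: "reflection G H C \<delta> \<in> hopf_hom (drinfeld G) (drinfeld G)"
proof (rule hopf_homI_spanning[OF closed_drinfeld closed_drinfeld])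
  let ?S = "{mixed h c (y \<otimes> d) | h c y d. h \<in> H \<and> c \<in> C \<and> y \<in> H \<and> d \<in> C}"
  let ?r = "reflection G H C \<delta>"
  show "spanning (bas (drinfeld G)) ?S"
    using spanning_mixed by simp
  show "linear_between (bas (drinfeld G)) (bas (drinfeld G)) ?r"
    using lin_reflection by simp
  show "?r (bmul (drinfeld G) s t) = bmul (drinfeld G) (?r s) (?r t)" if st: "s \<in> ?S" "t \<in> ?S" for s t
  proof -
    from st(1) obtain h c y d where s: "s = mixed h c (y \<otimes> d)" "h \<in> H" "c \<in> C" "y \<in> H" "d \<in> C" by blast
    from st(2) obtain h' c' y' d' where t: "t = mixed h' c' (y' \<otimes> d')" "h' \<in> H" "c' \<in> C" "y' \<in> H" "d' \<in> C" by blast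
    show ?thesis
      using s(2-) t(2-) linear_between_zero[OF lin_reflection]
        mult_parts[of y y' d d'] mult_parts[of y y' c c'] reflection_mixed[of h "c \<otimes> c'" "y \<otimes> y'" "d \<otimes> d'"]
      by (simp add: s(1) t(1) bmul_mixed reflection_mixed)
  qed
  show "?r (unitc (drinfeld G)) = unitc (drinfeld G)"
    using reflection_mixed[of _ \<one> \<one> \<one>]
    by (simp add: unit_mixed linear_between_sum[OF lin_reflection] mixed_vecs)
  show "bcomul (drinfeld G) (?r s) = map_pure (bas (drinfeld G)) (bas (drinfeld G)) ?r ?r (bcomul (drinfeld G) s)"
    if st: "s \<in> ?S" for s
  proof -
    from st obtain h c y d where s: "s = mixed h c (y \<otimes> d)" "h \<in> H" "c \<in> C" "y \<in> H" "d \<in> C" by blast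
    have fin2: "finite GG" using fin by simp
    show ?thesis
      using s(2-)
      by (simp add: s(1) bcomul_mixed reflection_mixed mixed_vecs pure_vecs
          linear_between_sum[OF linear_between_map_pure[OF lin_reflection lin_reflection]]
          map_pure_pure[OF fin2 fin2 lin_reflection lin_reflection])
  qed
  show "bcounit (drinfeld G) (?r s) = bcounit (drinfeld G) s" if st: "s \<in> ?S" for s
  proof -
    from st obtain h c y d where s: "s = mixed h c (y \<otimes> d)" "h \<in> H" "c \<in> C" "y \<in> H" "d \<in> C" by blast
    show ?thesis
      using s(2-) by (simp add: s(1) bcounit_mixed reflection_mixed)
  qed
qed

lemma reflection_involution:
  assumes "v \<in> vecs GG"
  shows "reflection G H C \<delta> (reflection G H C \<delta> v) = v"
proof
  fix x
  have fin2: "finite GG" using fin by simp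
  show "reflection G H C \<delta> (reflection G H C \<delta> v) x = v x"
    by (rule spanningD[OF spanning_mixed _ _ _ assms])
       (auto simp: reflection_mixed intro!: functional_coord fin2
         functional_linear[OF linear_between_comp[OF lin_reflection lin_reflection]])
qed

lemma reflection_hopf_aut: "reflection G H C \<delta> \<in> hopf_aut (drinfeld G)"
proof -
  have "bij_betw (reflection G H C \<delta>) (vecs GG) (vecs GG)"
    using linear_betweenD(1)[OF lin_reflection] reflection_involution
    by (intro bij_betw_byWitness[where f' = "reflection G H C \<delta>"]) auto
  then show ?thesis
    using reflection_hopf_hom by (simp add: hopf_iso_def)
qed

end

section \<open>The components of a Hopf automorphism of the Drinfeld double\<close>

context fin_group
begin

text \<open>Applying the counit of \<open>kG\<close> or of \<open>k\<^sup>G\<close> (evaluation at \<open>\<one>\<close>) to the values of \<open>\<phi>\<close> at \<open>e\<^sub>x \<times> 1\<close> and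
  at \<open>1 \<times> y = \<Sum>\<^sub>z e\<^sub>z \<times> y\<close> isolates the four components.\<close>

lemma components_determined:
  fixes \<phi> :: "('g \<times> 'g \<Rightarrow> 'k::field) \<Rightarrow> 'g \<times> 'g \<Rightarrow> 'k"
  assumes q: "is_components G \<phi> (u, b, a, v)" and x: "x \<in> carrier G"
  shows "i \<in> carrier G \<Longrightarrow> u (ket x) i = (\<Sum>j\<in>carrier G. \<phi> (ket (x, \<one>)) (i, j))"
    and "i \<in> carrier G \<Longrightarrow> b (ket x) i = (\<Sum>z\<in>carrier G. \<Sum>j\<in>carrier G. \<phi> (ket (z, x)) (i, j))"
    and "a (ket x) j = \<phi> (ket (x, \<one>)) (\<one>, j)"
    and "ket (v x) j = (\<Sum>z\<in>carrier G. \<phi> (ket (z, x)) (\<one>, j))"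
proof -
  have u: "u \<in> hopf_hom (fun_alg G) (fun_alg G)" and b: "b \<in> hopf_hom (group_alg G) (fun_alg G)"
    and a: "a \<in> hopf_hom (fun_alg G) (group_alg G)" and v: "v \<in> hom G G"
    and \<phi>: "\<And>T. T \<in> vecs GG \<Longrightarrow> \<phi> T = assemble G u b a (grp_lin G v) T"
    using q by (auto simp: is_components_def)
  note U = hopf_homD[OF u, simplified] and B = hopf_homD[OF b, simplified] and A = hopf_homD[OF a, simplified]
  have vG: "v x \<in> carrier G" if "x \<in> carrier G" for x using v that by (auto simp: hom_def)
  have v1: "v \<one> = \<one>" using v by (simp add: hom_one)
  have av: "a (ket x) \<in> vecs (carrier G)" if "x \<in> carrier G" for x
    by (rule linear_betweenD(1)[OF A(1) vecs_ket[OF that]])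
  have \<phi>_eq: "\<phi> (ket (x, y)) (i, j) =
      (\<Sum>(x1, x2)\<in>GG. comulc (fun_alg G) x (x1, x2) *
         (u (ket x1) i * b (ket y) i * bmul (group_alg G) (a (ket x2)) (ket (v y)) j))"
    if "x \<in> carrier G" "y \<in> carrier G" "i \<in> carrier G" for x y i j
    using that fin
    by (simp add: \<phi> vecs_ket assemble_def lin_ext_ket sum_fun_app scl_app pure_app fun_alg_simps grp_lin_ket
        case_prod_beta')
  have cm: "(\<Sum>(x1, x2)\<in>GG. comulc (fun_alg G) x (x1, x2) * (F x1 * E x2)) = F x"
    if "x \<in> carrier G" "\<And>x2. x2 \<in> carrier G \<Longrightarrow> E x2 = (if x2 = \<one> then 1 else 0)"
    for x and F E :: "'g \<Rightarrow> 'k"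
  proof -
    have "(\<Sum>(x1, x2)\<in>GG. comulc (fun_alg G) x (x1, x2) * (F x1 * E x2))
      = (\<Sum>p\<in>GG. if p = (x, \<one>) then F x else 0)"
      using that by (intro sum.cong) (auto simp: struct_simps split: if_splits)
    then show ?thesis using fin that by simp
  qed
  have cm': "(\<Sum>(x1, x2)\<in>GG. comulc (fun_alg G) x (x1, x2) * (E x1 * F x2)) = F x"
    if "x \<in> carrier G" "\<And>x2. x2 \<in> carrier G \<Longrightarrow> E x2 = (if x2 = \<one> then 1 else 0)"
    for x and F E :: "'g \<Rightarrow> 'k"
  proof -
    have "(\<Sum>(x1, x2)\<in>GG. comulc (fun_alg G) x (x1, x2) * (E x1 * F x2))
      = (\<Sum>p\<in>GG. if p = (\<one>, x) then F x else 0)"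
      using that by (intro sum.cong) (auto simp: struct_simps split: if_splits)
    then show ?thesis using fin that by simp
  qed
  have cnt: "(\<Sum>j\<in>carrier G. bmul (group_alg G) w (ket g) j) = (\<Sum>j\<in>carrier G. w j)"
    if w: "w \<in> vecs (carrier G)" and g: "g \<in> carrier G" for w g
  proof -
    have "(\<Sum>j\<in>carrier G. bmul (group_alg G) w (ket g) j) = (\<Sum>j\<in>carrier G. \<Sum>i\<in>carrier G. w i * ket (i \<otimes> g) j)"
      unfolding bmul_app using fin g by (simp add: struct_simps mult.assoc sum_distrib_left[symmetric] sum_ket_mult)
    also have "\<dots> = (\<Sum>i\<in>carrier G. \<Sum>j\<in>carrier G. w i * ket (i \<otimes> g) j)"
      by (rule sum.swap)
    also have "\<dots> = (\<Sum>i\<in>carrier G. w i)"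
      using fin g by (intro sum.cong refl) (simp add: sum_ket_mult)
    finally show ?thesis .
  qed
  have mu1: "bmul (group_alg G) w (ket \<one>) = w" if w: "w \<in> vecs (carrier G)" for w
    by (rule linear_between_eqI[of "carrier G" "carrier G" _ "carrier G"])
       (use linear_between_bmul(1)[OF closed_group_alg[OF is_group fin]] w fin in
         \<open>auto intro: linear_between_id simp: group_alg_simps\<close>)
  have row: "(\<Sum>j\<in>carrier G. \<phi> (ket (x, y)) (i, j)) = u (ket x) i * b (ket y) i"
    if xy: "x \<in> carrier G" "y \<in> carrier G" "i \<in> carrier G" for x y i
  proof -
    have "(\<Sum>j\<in>carrier G. \<phi> (ket (x, y)) (i, j)) = (\<Sum>q\<in>GG. \<Sum>j\<in>carrier G.
       comulc (fun_alg G) x q * (u (ket (fst q)) i * b (ket y) i * bmul (group_alg G) (a (ket (snd q))) (ket (v y)) j))"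
      using xy by (subst sum.swap) (simp add: \<phi>_eq case_prod_beta')
    also have "\<dots> = (\<Sum>q\<in>GG. comulc (fun_alg G) x q *
       (u (ket (fst q)) i * b (ket y) i * (\<Sum>j\<in>carrier G. bmul (group_alg G) (a (ket (snd q))) (ket (v y)) j)))"
      by (simp add: sum_distrib_left)
    also have "\<dots> = (\<Sum>(x1, x2)\<in>GG.
       comulc (fun_alg G) x (x1, x2) * ((u (ket x1) i * b (ket y) i) * bcounit (group_alg G) (a (ket x2))))"
    proof (intro sum.cong refl, clarify)
      fix x1 x2 assume x2: "x2 \<in> carrier G"
      show "comulc (fun_alg G) x (x1, x2) * (u (ket (fst (x1, x2))) i * b (ket y) i *
          (\<Sum>j\<in>carrier G. bmul (group_alg G) (a (ket (snd (x1, x2)))) (ket (v y)) j)) =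
        comulc (fun_alg G) x (x1, x2) * (u (ket x1) i * b (ket y) i * bcounit (group_alg G) (a (ket x2)))"
        by (simp only: fst_conv snd_conv cnt[OF av[OF x2] vG[OF xy(2)]] group_alg_simps(3))
    qed
    also have "\<dots> = u (ket x) i * b (ket y) i"
      using xy fin by (intro cm) (auto simp: A(5)[OF vecs_ket] fun_alg_simps ket_app)
    finally show ?thesis .
  qed
  have one: "\<phi> (ket (x, y)) (\<one>, j) = bmul (group_alg G) (a (ket x)) (ket (v y)) j"
    if xy: "x \<in> carrier G" "y \<in> carrier G" for x y j
  proof -
    have b1: "b (ket y) \<one> = 1"
      using B(5)[OF vecs_ket[OF xy(2)]] fin xy by (simp add: fun_alg_simps group_alg_simps ket_app)
    have "\<phi> (ket (x, y)) (\<one>, j) = (\<Sum>(x1, x2)\<in>GG.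
        comulc (fun_alg G) x (x1, x2) * (u (ket x1) \<one> * bmul (group_alg G) (a (ket x2)) (ket (v y)) j))"
      using xy by (simp add: \<phi>_eq b1)
    also have "\<dots> = bmul (group_alg G) (a (ket x)) (ket (v y)) j"
      using xy fin U(5)[OF vecs_ket] by (intro cm') (auto simp: fun_alg_simps ket_app)
    finally show ?thesis .
  qed
  have one_fun: "unitc (fun_alg G) = (\<Sum>z\<in>carrier G. (ket z :: 'g \<Rightarrow> 'k))"
    using fin by (auto simp: fun_eq_iff fun_alg_simps sum_fun_app ket_app)
  have us: "(\<Sum>z\<in>carrier G. u (ket z) i) = 1" if "i \<in> carrier G" for i
    using fun_cong[OF U(3), of i] that
    by (simp add: one_fun linear_between_sum[OF U(1)] vecs_ket sum_fun_app)
       (use fin in \<open>simp add: ket_app\<close>)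
  have as: "(\<Sum>z\<in>carrier G. a (ket z)) = ket \<one>"
    using A(3) by (simp add: one_fun linear_between_sum[OF A(1)] vecs_ket group_alg_simps)
  show "u (ket x) i = (\<Sum>j\<in>carrier G. \<phi> (ket (x, \<one>)) (i, j))" if "i \<in> carrier G"
    using that x row[of x \<one> i] fun_cong[OF B(3), of i] by (simp add: group_alg_simps fun_alg_simps)
  show "b (ket x) i = (\<Sum>z\<in>carrier G. \<Sum>j\<in>carrier G. \<phi> (ket (z, x)) (i, j))" if "i \<in> carrier G"
    using that x us[OF that] by (simp add: row sum_distrib_right[symmetric])
  show "a (ket x) j = \<phi> (ket (x, \<one>)) (\<one>, j)"
    using x one[of x \<one> j] by (simp add: v1 mu1 av)
  have "(\<Sum>z\<in>carrier G. \<phi> (ket (z, x)) (\<one>, j)) = bmul (group_alg G) (\<Sum>z\<in>carrier G. a (ket z)) (ket (v x)) j"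
    using x av linear_between_sum[OF linear_between_bmul(1)[OF closed_group_alg[OF is_group fin], simplified],
        of "carrier G" "\<lambda>z. a (ket z)"]
    by (simp add: one sum_fun_app)
  then show "ket (v x) j = (\<Sum>z\<in>carrier G. \<phi> (ket (z, x)) (\<one>, j))"
    using x vG fin by (simp add: as group_alg_simps)
qed

end

section \<open>The transposed reflection\<close>

context refl_datum
begin

text \<open>In dual bases, \<open>dual_map C C \<delta>\<close> is the bicharacter \<open>(c, d) \<mapsto> \<delta>(d)(c)\<close>.\<close>

lemma transpose_ket: "c \<in> C \<Longrightarrow> d \<in> C \<Longrightarrow> dual_map C C \<delta> (ket c) d = \<delta> (ket d) c"
  "c \<in> C \<Longrightarrow> d \<in> C \<Longrightarrow> dual_map C C \<delta>i (ket c) d = \<delta>i (ket d) c"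
  using finHC by (simp_all add: dual_map_def sum_ket_mult)

lemma transpose_inverse:
  "v \<in> vecs C \<Longrightarrow> dual_map C C \<delta> (dual_map C C \<delta>i v) = v"
  "v \<in> vecs C \<Longrightarrow> dual_map C C \<delta>i (dual_map C C \<delta> v) = v"
  using finHC lin_\<delta> lin_\<delta>i \<delta>_\<delta>i \<delta>i_\<delta> by (auto intro!: dual_map_comp)

lemma transpose_bij: "bij_betw (dual_map C C \<delta>) (vecs C) (vecs C)"
  by (rule bij_betw_byWitness[where f' = "dual_map C C \<delta>i"])
     (auto simp: transpose_inverse intro: linear_betweenD(1)[OF linear_between_dual_map])

lemma transpose_datum: "is_reflection_datum G H C (dual_map C C \<delta>)"
proof -
  have "dual_map C C \<delta> \<in> hopf_hom (group_alg GC) (fun_alg GC)"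
    using hopf_hom_group_fun_iff[of GC "dual_map C C \<delta>"] groupC finHC linear_between_dual_map[of C C \<delta>]
    by (auto simp: transpose_ket bichar bichar_one)
  then show ?thesis
    using datum transpose_bij by (auto simp: is_reflection_datum_def hopf_iso_def)
qed

lemma transpose_the_inv: "w \<in> vecs C \<Longrightarrow> the_inv_into (vecs C) (dual_map C C \<delta>) w = dual_map C C \<delta>i w"
  using transpose_bij linear_betweenD(1)[OF linear_between_dual_map[of C C \<delta>i]]
  by (intro the_inv_into_f_eq) (auto simp: bij_betw_def transpose_inverse)

lemma bmul_group_alg_parts:
  assumes "w \<in> vecs C" "h \<in> H"
  shows "bmul (group_alg G) w (ket h) j = (if j \<in> carrier G \<and> hp j = h then w (cp j) else 0)"
proof -
  have "bmul (group_alg G) w (ket h) j = (\<Sum>i\<in>carrier G. w i * ket (i \<otimes> h) j)"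
    unfolding bmul_app using fin assms
    by (simp add: struct_simps mult.assoc sum_distrib_left[symmetric] sum_ket_mult)
  also have "\<dots> = (\<Sum>i\<in>C. w i * ket (i \<otimes> h) j)"
    using fin vecs_out[OF assms(1)] by (intro sum.mono_neutral_right) auto
  also have "\<dots> = (\<Sum>i\<in>C. w i * ket (h \<otimes> i) j)"
    by (intro sum.cong) (simp_all add: commute_HC[OF assms(2)])
  also have "\<dots> = (\<Sum>i\<in>C. if i = cp j then if j \<in> carrier G \<and> hp j = h then w (cp j) else 0 else 0)"
    using assms by (intro sum.cong) (auto simp: ket_app parts_mult)
  also have "\<dots> = (if j \<in> carrier G \<and> hp j = h then w (cp j) else 0)"
    using finHC by auto
  finally show ?thesis .
qed

text \<open>The hypotheses only constrain values on the basis, so that the lemma applies to the components of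
  \<open>r\<close> and, for the transposed \<open>\<delta>\<close>, to their duals.\<close>

lemma assemble_reflection:
  assumes u: "\<And>x i. x \<in> carrier G \<Longrightarrow> i \<in> carrier G \<Longrightarrow> u (ket x) i = (if hp i = x then 1 else 0)"
    and b: "\<And>y i. y \<in> carrier G \<Longrightarrow> i \<in> carrier G \<Longrightarrow> b (ket y) i = \<delta> (ket (cp y)) (cp i)"
    and a: "\<And>x. x \<in> carrier G \<Longrightarrow> a (ket x) = (if x \<in> C then \<delta>i (ket x) else 0)"
    and v: "\<And>y. y \<in> carrier G \<Longrightarrow> v (ket y) = ket (hp y)"
  shows "assemble G u b a v = reflection G H C \<delta>"
proof -
  have "(\<Sum>(x1, x2)\<in>GG. comulc (fun_alg G) x (x1, x2) \<cdot>\<^sub>v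
       pure (bmul (fun_alg G) (u (ket x1)) (b (ket g))) (bmul (group_alg G) (a (ket x2)) (v (ket g))))
     = pure (join G H C (ket (hp x)) (\<delta> (ket (cp g)))) (join G H C (ket (hp g)) (\<delta>i (ket (cp x))))"
    (is "?L = ?R") if xg: "x \<in> carrier G" "g \<in> carrier G" for x g
  proof
    fix p :: "'g \<times> 'g"
    obtain i j where p: "p = (i, j)" by (cases p)
    have aC: "bmul (group_alg G) (a (ket x2)) (ket (hp g)) j =
        (if x2 \<in> C \<and> j \<in> carrier G \<and> hp j = hp g then \<delta>i (ket x2) (cp j) else 0)" if "x2 \<in> carrier G" for x2
      using that xg a bmul_group_alg_parts[of "\<delta>i (ket x2)" "hp g" j] bmul_group_alg_parts[of 0 "hp g" j]
      by (auto simp: \<delta>i_vecs vecs_ket)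
    have "?L p = (\<Sum>(x1, x2)\<in>GG. comulc (fun_alg G) x (x1, x2) *
       ((if i \<in> carrier G then u (ket x1) i * b (ket g) i else 0) * bmul (group_alg G) (a (ket x2)) (ket (hp g)) j))"
      using xg v fin by (simp add: sum_fun_app scl_app p pure_app fun_alg_simps case_prod_beta')
    also have "\<dots> = (\<Sum>q\<in>GG. if q = (hp x, cp x) then ?R p else 0)"
    proof (rule sum.cong)
      fix q assume "q \<in> GG"
      then obtain x1 x2 where q: "q = (x1, x2)" "x1 \<in> carrier G" "x2 \<in> carrier G" by auto
      show "(case q of (x1, x2) \<Rightarrow> comulc (fun_alg G) x (x1, x2) *
         ((if i \<in> carrier G then u (ket x1) i * b (ket g) i else 0) * bmul (group_alg G) (a (ket x2)) (ket (hp g)) j))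
        = (if q = (hp x, cp x) then ?R p else 0)"
      proof (cases "q = (hp x, cp x)")
        case True
        then have "x1 = hp x" "x2 = cp x" using q(1) by (simp_all del: prod.collapse)
        then show ?thesis
          using xg q(2,3) True
          by (simp add: q(1) struct_simps aC u b p pure_app join_app parts_mult ket_app del: prod.collapse)
      next
        case False
        have "x1 \<otimes> x2 \<noteq> x \<or> \<not> (i \<in> carrier G \<and> hp i = x1) \<or> x2 \<notin> C"
        proof (rule ccontr)
          assume "\<not> ?thesis"
          then have *: "x1 \<otimes> x2 = x" "x1 \<in> H" "x2 \<in> C" by auto
          then have "x1 = hp x" "x2 = cp x" by auto
          then show False using False q(1) by simp
        qed
        moreover have "comulc (fun_alg G) x (x1, x2) = (0 :: 'k)" if "x1 \<otimes> x2 \<noteq> x"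
          using that by (simp add: struct_simps)
        moreover have "(if i \<in> carrier G then u (ket x1) i * b (ket g) i else 0) = 0"
          if "\<not> (i \<in> carrier G \<and> hp i = x1)"
          using that u[OF q(2)] by auto
        moreover have "bmul (group_alg G) (a (ket x2)) (ket (hp g)) j = 0" if "x2 \<notin> C"
          using that aC[OF q(3)] by simp
        ultimately show ?thesis
          using False q(1) by auto
      qed
    qed simp
    also have "\<dots> = ?R p" using fin xg by (simp del: prod.collapse)
    finally show "?L p = ?R p" .
  qed
  note basis = this
  show ?thesis
  proof (rule ext)
    fix T
    show "assemble G u b a v T = reflection G H C \<delta> T"
      unfolding assemble_def reflection_def lin_ext_def by (rule sum.cong) (auto simp: basis)
  qed
qed

text \<open>The components \<open>u\<close>, \<open>b\<close>, \<open>a\<close> of \<open>r\<close>; the fourth is \<open>hp\<close>. The first is pullback along \<open>hp\<close>. The second is \<open>\<delta>\<close>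
  between the maps \<open>kG \<rightarrow> kC\<close> and \<open>k\<^sup>C \<rightarrow> k\<^sup>G\<close> induced by \<open>cp\<close>, and the third is \<open>\<delta>\<^sup>-\<^sup>1\<close> between the maps \<open>k\<^sup>G \<rightarrow> k\<^sup>C\<close>
  and \<open>kC \<rightarrow> kG\<close> induced by the inclusion of \<open>C\<close>.\<close>

definition "comp_u = (pullback G hp :: ('g \<Rightarrow> 'k) \<Rightarrow> 'g \<Rightarrow> 'k)"
definition "comp_b = (\<lambda>w :: 'g \<Rightarrow> 'k. pullback G cp (\<delta> (grp_lin G cp w)))"
definition "comp_a = (\<lambda>f :: 'g \<Rightarrow> 'k. grp_lin GC (\<lambda>c. c) (\<delta>i (pullback GC (\<lambda>c. c) f)))"

lemma comp_ket:
  "x \<in> carrier G \<Longrightarrow> i \<in> carrier G \<Longrightarrow> comp_u (ket x) i = (if hp i = x then 1 else 0)"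
  "x \<in> carrier G \<Longrightarrow> i \<in> carrier G \<Longrightarrow> comp_b (ket x) i = \<delta> (ket (cp x)) (cp i)"
  "x \<in> carrier G \<Longrightarrow> comp_a (ket x) = (if x \<in> C then \<delta>i (ket x) else 0)"
proof -
  assume x: "x \<in> carrier G"
  have "pullback GC (\<lambda>c. c) (ket x) = (if x \<in> C then ket x else (0 :: 'g \<Rightarrow> 'k))"
    by (auto simp: pullback_def fun_eq_iff ket_app)
  moreover have "grp_lin GC (\<lambda>c. c) w = w" if "w \<in> vecs C" for w :: "'g \<Rightarrow> 'k"
    unfolding grp_lin_def lin_ext_def using vecs_expand[OF finHC(2) that] by simp
  ultimately show "comp_a (ket x) = (if x \<in> C then \<delta>i (ket x) else 0)"
    by (simp add: comp_a_def \<delta>i_vecs vecs_ket linear_between_zero[OF lin_\<delta>i])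
  assume i: "i \<in> carrier G"
  show "comp_u (ket x) i = (if hp i = x then 1 else 0)"
    using i by (simp add: comp_u_def pullback_def ket_app)
  show "comp_b (ket x) i = \<delta> (ket (cp x)) (cp i)"
    using x i fin by (simp add: comp_b_def pullback_def grp_lin_ket)
qed

lemma reflection_components: "is_components G (reflection G H C \<delta>) (comp_u, comp_b, comp_a, hp)"
proof -
  have C: "finite (carrier GC)" using finHC by simp
  have i: "(\<lambda>c. c) \<in> hom GC G" by (auto simp: hom_def)
  have hd: "\<delta> \<in> hopf_hom (group_alg GC) (fun_alg GC)" using hopf_\<delta> by (simp add: hopf_iso_def)
  note cG = closed_group_alg[OF is_group fin] closed_fun_alg[OF is_group fin]
    closed_group_alg[OF groupC C] closed_fun_alg[OF groupC C]
  have "comp_u \<in> hopf_hom (fun_alg G) (fun_alg G)"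
    unfolding comp_u_def by (rule hopf_hom_pullback[OF is_group fin is_group fin hom_parts(2)])
  moreover have "comp_b \<in> hopf_hom (group_alg G) (fun_alg G)"
    unfolding comp_b_def
    by (rule hopf_hom_comp[OF cG(1) cG(4) hopf_hom_comp[OF cG(1) cG(3) hopf_hom_grp_lin hd] hopf_hom_pullback])
       (use is_group fin groupC C hom_parts(3) in auto)
  moreover have "comp_a \<in> hopf_hom (fun_alg G) (group_alg G)"
    unfolding comp_a_def
    by (rule hopf_hom_comp[OF cG(2) cG(3) hopf_hom_comp[OF cG(2) cG(4) hopf_hom_pullback hopf_\<delta>i] hopf_hom_grp_lin])
       (use is_group fin groupC C i in auto)
  moreover have "assemble G comp_u comp_b comp_a (grp_lin G hp) = reflection G H C \<delta>"
    using fin by (intro assemble_reflection) (auto simp: comp_ket grp_lin_ket)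
  ultimately show ?thesis
    using hom_parts by (simp add: is_components_def)
qed

text \<open>On \<open>\<phi> = r\<^bsub>H,C,\<delta>\<^esub>\<close> the operation \<open>\<phi> \<mapsto> \<phi>\<^sup>\<dagger>\<close> transposes the bicharacter.\<close>

lemma dagger_reflection: "dagger G (reflection G H C \<delta>) = reflection G H C (dual_map C C \<delta>)"
proof -
  interpret T: refl_datum G H C "dual_map C C \<delta>"
    by unfold_locales (rule transpose_datum)
  obtain u b a v where q: "(SOME q. is_components G (reflection G H C \<delta>) q) = (u, b, a, v)"
    by (metis surj_pair)
  have uv: "is_components G (reflection G H C \<delta>) (u, b, a, v)"
    using someI[of "is_components G (reflection G H C \<delta>)", OF reflection_components] q by simp
  note D = components_determined[OF uv] and D' = components_determined[OF reflection_components]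
  have eq: "u (ket x) i = (if hp i = x then 1 else 0)" "b (ket x) i = \<delta> (ket (cp x)) (cp i)"
    "a (ket x) = (if x \<in> C then \<delta>i (ket x) else 0)" "v x = hp x"
    if "x \<in> carrier G" "i \<in> carrier G" for x i
  proof -
    show "u (ket x) i = (if hp i = x then 1 else 0)"
      using D(1)[OF that] D'(1)[OF that] comp_ket(1)[OF that] by simp
    show "b (ket x) i = \<delta> (ket (cp x)) (cp i)"
      using D(2)[OF that] D'(2)[OF that] comp_ket(2)[OF that] by simp
    have "a (ket x) = comp_a (ket x)"
      by (rule ext) (simp add: D(3)[OF that(1)] D'(3)[OF that(1)])
    then show "a (ket x) = (if x \<in> C then \<delta>i (ket x) else 0)"
      using comp_ket(3)[OF that(1)] by simp
    have "(ket (v x) :: 'g \<Rightarrow> 'k) = ket (hp x)"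
      by (rule ext) (simp add: D(4)[OF that(1)] D'(4)[OF that(1)])
    then show "v x = hp x"
      by (metis ket_app zero_neq_one)
  qed
  let ?d = "dual_map (carrier G) (carrier G)"
  have "assemble G (?d (grp_lin G v)) (?d b) (?d a) (?d u) = reflection G H C (dual_map C C \<delta>)"
  proof (rule T.assemble_reflection)
    fix x assume x: "x \<in> carrier G"
    show "?d (grp_lin G v) (ket x) i = (if hp i = x then 1 else 0)" if "i \<in> carrier G" for i
      using x that fin eq(4)[OF that that] by (simp add: dual_map_def sum_ket_mult grp_lin_ket) (simp add: ket_app)
    show "?d b (ket x) i = dual_map C C \<delta> (ket (cp x)) (cp i)" if "i \<in> carrier G" for i
      using x that fin eq(2)[OF that x] by (simp add: dual_map_def[of "carrier G"] sum_ket_mult transpose_ket)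
    show "?d u (ket x) = ket (hp x)"
      using x fin eq(1)[OF _ x] by (simp add: fun_eq_iff dual_map_def sum_ket_mult) (auto simp: ket_app)
    show "?d a (ket x) = (if x \<in> C then T.\<delta>i (ket x) else 0)"
    proof
      fix i
      show "?d a (ket x) i = (if x \<in> C then T.\<delta>i (ket x) else 0) i"
      proof (cases "i \<in> C")
        case True
        then show ?thesis
          using x fin eq(3)[OF CG[OF True] x] vecs_out[OF \<delta>i_vecs[OF vecs_ket[OF True]], of x]
          by (simp add: dual_map_def[of "carrier G"] sum_ket_mult transpose_the_inv vecs_ket transpose_ket)
      next
        case False
        then show ?thesis
          using x fin eq(3)[of i x] vecs_out[OF T.\<delta>i_vecs[OF vecs_ket], of x i]
          by (simp add: dual_map_def[of "carrier G"] sum_ket_mult)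
      qed
    qed
  qed
  then show ?thesis
    by (simp add: dagger_def q)
qed

lemma reflection_determines:
  assumes "is_reflection_datum G H' C' \<delta>'" "reflection G H' C' \<delta>' = reflection G H C \<delta>"
  shows "H' = H" "C' = C" "\<And>a. a \<in> vecs C \<Longrightarrow> \<delta>' a = \<delta> a"
proof -
  interpret R: refl_datum G H' C' \<delta>'
    by unfold_locales (rule assms(1))
  note D = components_determined[OF reflection_components]
  note D' = components_determined[OF R.reflection_components, unfolded assms(2)]
  have hp: "R.hp x = hp x" if "x \<in> carrier G" for x
  proof -
    have "(ket (R.hp x) :: 'g \<Rightarrow> 'k) = ket (hp x)"
      by (rule ext) (simp add: D(4)[OF that(1)] D'(4)[OF that(1)])
    then show ?thesis by (metis ket_app zero_neq_one)
  qed
  have imH: "H = hp ` carrier G" by (auto simp: image_iff) (metis HG parts_own(1))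
  have imH': "H' = R.hp ` carrier G" by (auto simp: image_iff) (metis R.HG R.parts_own(1))
  have kC: "C = {x \<in> carrier G. hp x = \<one>}" by auto (metis l_one parts(2) parts_mult CG)
  have kC': "C' = {x \<in> carrier G. R.hp x = \<one>}" by auto (metis l_one R.parts(2) R.parts_mult R.CG)
  show "H' = H"
    by (rule trans[OF imH' trans[OF image_cong[OF refl hp] imH[symmetric]]])
  show CC: "C' = C"
    by (rule trans[OF kC' trans[OF _ kC[symmetric]]]) (use hp in auto)
  fix a :: "'g \<Rightarrow> 'k" assume a: "a \<in> vecs C"
  have lin': "linear_between C C \<delta>'" using R.lin_\<delta> CC by simp
  show "\<delta>' a = \<delta> a"
  proof (rule linear_between_eqI[OF lin' lin_\<delta> finHC(2) _ a])
    fix c assume c: "c \<in> C"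
    show "\<delta>' (ket c) = \<delta> (ket c)"
    proof (rule vecs_eqI[of _ C])
      fix i assume i: "i \<in> C"
      show "\<delta>' (ket c) i = \<delta> (ket c) i"
      proof -
        have "R.comp_b (ket c) i = comp_b (ket c) i"
          using c i by (simp add: D(2) D'(2))
        then have "\<delta>' (ket (R.cp c)) (R.cp i) = \<delta> (ket (cp c)) (cp i)"
          using c i by (simp add: comp_ket(2) R.comp_ket(2))
        moreover have "R.cp c = c" "R.cp i = i"
          by (rule R.parts_own(4), simp add: CC c i)+
        ultimately show ?thesis using c i by simp
      qed
    qed (use c lin' in \<open>auto intro: \<delta>_vecs vecs_ket linear_betweenD(1)\<close>)
  qed
qed

end

section \<open>Central pairings as lazy cocycles\<close>

text \<open>A homomorphism \<open>p : G \<rightarrow> Z(G)\<close>.\<close>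

locale central_hom = fin_group G for G :: "('g, 'm) monoid_scheme" (structure) +
  fixes p :: "'g \<Rightarrow> 'g"
  assumes hom_p: "p \<in> hom G (G\<lparr>carrier := group_center G\<rparr>)"
begin

lemma p_carrier [simp]: "g \<in> carrier G \<Longrightarrow> p g \<in> carrier G"
  and p_mult: "g \<in> carrier G \<Longrightarrow> h \<in> carrier G \<Longrightarrow> p (g \<otimes> h) = p g \<otimes> p h"
  and p_central: "g \<in> carrier G \<Longrightarrow> x \<in> carrier G \<Longrightarrow> p g \<otimes> x = x \<otimes> p g"
  using hom_p by (auto simp: hom_def group_center_def)

lemma p_one: "p \<one> = \<one>"
  using p_mult[of \<one> \<one>] r_cancel_one'[of "p \<one>" "p \<one>"] by simp

lemma p_conj: "g \<in> carrier G \<Longrightarrow> x \<in> carrier G \<Longrightarrow> inv x \<otimes> p g \<otimes> x = p g"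
  "g \<in> carrier G \<Longrightarrow> x \<in> carrier G \<Longrightarrow> inv (p g) \<otimes> x \<otimes> p g = x"
proof -
  assume gx: "g \<in> carrier G" "x \<in> carrier G"
  have "inv x \<otimes> p g \<otimes> x = inv x \<otimes> (x \<otimes> p g)"
    using gx by (simp add: m_assoc p_central)
  then show "inv x \<otimes> p g \<otimes> x = p g"
    using gx by (simp add: m_assoc[symmetric])
  have "inv (p g) \<otimes> x \<otimes> p g = inv (p g) \<otimes> (p g \<otimes> x)"
    using gx by (simp add: m_assoc p_central)
  then show "inv (p g) \<otimes> x \<otimes> p g = x"
    using gx by (simp add: m_assoc[symmetric])
qed

lemma p_inv: "g \<in> carrier G \<Longrightarrow> p (inv g) = inv (p g)"
  using p_mult[of "inv g" g] by (intro inv_equality[symmetric]) (auto simp: p_one)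

lemma p_conj_arg: "g \<in> carrier G \<Longrightarrow> x \<in> carrier G \<Longrightarrow> p (inv x \<otimes> g \<otimes> x) = p g"
  using p_conj(1)[of g "p x"] by (simp add: p_mult p_inv)

lemma central_hom_inverse: "central_hom G (\<lambda>g. inv (p g))"
proof unfold_locales
  have c: "inv (p g) \<otimes> x = x \<otimes> inv (p g)" if "g \<in> carrier G" "x \<in> carrier G" for g x
    using that p_central[of "inv g" x] by (simp add: p_inv)
  have m: "inv (p (g \<otimes> h)) = inv (p g) \<otimes> inv (p h)" if "g \<in> carrier G" "h \<in> carrier G" for g h
    using that p_central[of "inv h" "inv (p g)"] by (simp add: p_mult inv_mult_group p_inv)
  show "(\<lambda>g. inv (p g)) \<in> hom G (G\<lparr>carrier := group_center G\<rparr>)"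
    by (rule homI) (auto simp: group_center_def m intro: c)
qed

text \<open>The cocycle of the pairing \<open>(g, f) \<mapsto> f (p g)\<close>.\<close>

definition sigma :: "('g \<times> 'g) \<times> ('g \<times> 'g) \<Rightarrow> 'k::field" where
  "sigma = pairing_cocycle G (\<lambda>a f. \<Sum>g\<in>carrier G. a g * f (p g))"

lemma sigma_app:
  "sigma ((g, x), (h, y)) = (if g \<in> carrier G \<and> h \<in> carrier G \<and> x = p h \<and> y = \<one> then 1 else 0)"
  using fin is_group
  by (simp add: sigma_def pairing_cocycle_def sum_ket_mult fun_alg_simps) (auto simp: ket_app)

lemma dual_struct:
  "mulc (drinfeld_dual G) (g, x) (h, y) = (if x = y then ket (g \<otimes> h, x) else 0)"
  "unitc (drinfeld_dual G) (g, x) = (if g = \<one> \<and> x \<in> carrier G then 1 else 0)"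
  "comulc (drinfeld_dual G) (g, x) ((g1, x1), (g2, x2)) = (if x1 \<in> carrier G \<and> x2 \<in> carrier G \<and>
     x1 \<otimes> x2 = x \<and> g1 = g \<and> g2 = inv x1 \<otimes> g \<otimes> x1 then 1 else 0)"
  "counitc (drinfeld_dual G) (g, x) = (if x = \<one> then 1 else 0)"
  by (simp_all add: drinfeld_dual_def)

text \<open>The coproduct of \<open>g \<times> e\<^sub>x\<close> as a sum over the first factor \<open>x\<^sub>1\<close> of \<open>x = x\<^sub>1 x\<^sub>2\<close>.\<close>

lemma dual_comul_sum:
  assumes gx: "g \<in> carrier G" "x \<in> carrier G"
  shows "(\<Sum>(a1, a2)\<in>GG \<times> GG.
       comulc (drinfeld_dual G) (g, x) (a1, a2) * F a1 a2) =
     (\<Sum>x1\<in>carrier G. F (g, x1) (inv x1 \<otimes> g \<otimes> x1, inv x1 \<otimes> x) :: 'k::field)"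
proof -
  let ?D = "GG \<times> GG"
  let ?f = "\<lambda>x1. ((g, x1), (inv x1 \<otimes> g \<otimes> x1, inv x1 \<otimes> x))"
  have "(\<Sum>(a1, a2)\<in>?D. comulc (drinfeld_dual G) (g, x) (a1, a2) * F a1 a2)
    = (\<Sum>(a1, a2)\<in>?f ` carrier G. comulc (drinfeld_dual G) (g, x) (a1, a2) * F a1 a2)"
  proof (rule sum.mono_neutral_right)
    show "\<forall>i\<in>?D - ?f ` carrier G. (case i of (a1, a2) \<Rightarrow> comulc (drinfeld_dual G) (g, x) (a1, a2) * F a1 a2) = 0"
    proof
      fix i assume i: "i \<in> ?D - ?f ` carrier G"
      then obtain g1 x1 g2 x2 where i': "i = ((g1, x1), (g2, x2))" "g1 \<in> carrier G" "x1 \<in> carrier G"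
        "g2 \<in> carrier G" "x2 \<in> carrier G" by auto
      have "x2 = inv x1 \<otimes> x" if "x1 \<otimes> x2 = x"
        using that i' by (auto simp: m_assoc[symmetric])
      then have "\<not> (x1 \<otimes> x2 = x \<and> g1 = g \<and> g2 = inv x1 \<otimes> g \<otimes> x1)"
        using i i' by auto
      then show "(case i of (a1, a2) \<Rightarrow> comulc (drinfeld_dual G) (g, x) (a1, a2) * F a1 a2) = 0"
        by (auto simp: i' dual_struct)
    qed
  qed (use fin gx in auto)
  also have "\<dots> = (\<Sum>x1\<in>carrier G. F (g, x1) (inv x1 \<otimes> g \<otimes> x1, inv x1 \<otimes> x))"
    using gx by (subst sum.reindex) (auto simp: inj_on_def dual_struct m_assoc[symmetric] intro!: sum.cong)
  finally show ?thesis .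
qed

text \<open>Convolution with \<open>\<sigma>\<close> from either side shifts \<open>x\<close> by \<open>p(h)\<^sup>-\<^sup>1\<close>. The results agree because \<open>p(h)\<close> is
  central; with the multiplicativity of \<open>p\<close> this yields laziness and the cocycle identity.\<close>

lemma sigma_left:
  assumes "g \<in> carrier G" "x \<in> carrier G" "h \<in> carrier G" "y \<in> carrier G"
  shows "(\<Sum>(a1, a2)\<in>GG \<times> GG.
      \<Sum>(b1, b2)\<in>GG \<times> GG.
       comulc (drinfeld_dual G) (g, x) (a1, a2) * comulc (drinfeld_dual G) (h, y) (b1, b2) *
       sigma (a1, b1) * F a2 b2) = (F (g, inv (p h) \<otimes> x) (h, y) :: 'k::field)"
proof -
  have "(\<Sum>(a1, a2)\<in>GG \<times> GG.
      \<Sum>(b1, b2)\<in>GG \<times> GG.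
       comulc (drinfeld_dual G) (g, x) (a1, a2) * comulc (drinfeld_dual G) (h, y) (b1, b2) *
       sigma (a1, b1) * F a2 b2)
    = (\<Sum>(a1, a2)\<in>GG \<times> GG.
       comulc (drinfeld_dual G) (g, x) (a1, a2) * (\<Sum>(b1, b2)\<in>GG \<times> GG.
       comulc (drinfeld_dual G) (h, y) (b1, b2) * (sigma (a1, b1) * F a2 b2)))"
    by (simp add: sum_distrib_left mult.assoc case_prod_beta')
  also have "\<dots> = (\<Sum>x1\<in>carrier G. \<Sum>y1\<in>carrier G. sigma ((g, x1), (h, y1)) *
      F (inv x1 \<otimes> g \<otimes> x1, inv x1 \<otimes> x) (inv y1 \<otimes> h \<otimes> y1, inv y1 \<otimes> y))"
    using assms by (simp add: dual_comul_sum)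
  also have "\<dots> = (\<Sum>x1\<in>carrier G. \<Sum>y1\<in>carrier G. if y1 = \<one> then if x1 = p h then
      F (g, inv (p h) \<otimes> x) (h, y) else 0 else 0)"
    using assms by (intro sum.cong) (auto simp: sigma_app p_conj)
  also have "\<dots> = F (g, inv (p h) \<otimes> x) (h, y)"
    using fin assms by simp
  finally show ?thesis .
qed

lemma sigma_right:
  assumes "g \<in> carrier G" "x \<in> carrier G" "h \<in> carrier G" "y \<in> carrier G"
  shows "(\<Sum>(a1, a2)\<in>GG \<times> GG.
      \<Sum>(b1, b2)\<in>GG \<times> GG.
       comulc (drinfeld_dual G) (g, x) (a1, a2) * comulc (drinfeld_dual G) (h, y) (b1, b2) *
       sigma (a2, b2) * F a1 b1) = (F (g, inv (p h) \<otimes> x) (h, y) :: 'k::field)"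
proof -
  have "(\<Sum>(a1, a2)\<in>GG \<times> GG.
      \<Sum>(b1, b2)\<in>GG \<times> GG.
       comulc (drinfeld_dual G) (g, x) (a1, a2) * comulc (drinfeld_dual G) (h, y) (b1, b2) *
       sigma (a2, b2) * F a1 b1)
    = (\<Sum>(a1, a2)\<in>GG \<times> GG.
       comulc (drinfeld_dual G) (g, x) (a1, a2) * (\<Sum>(b1, b2)\<in>GG \<times> GG.
       comulc (drinfeld_dual G) (h, y) (b1, b2) * (sigma (a2, b2) * F a1 b1)))"
    by (simp add: sum_distrib_left mult.assoc case_prod_beta')
  also have "\<dots> = (\<Sum>x1\<in>carrier G. \<Sum>y1\<in>carrier G.
      sigma ((inv x1 \<otimes> g \<otimes> x1, inv x1 \<otimes> x), (inv y1 \<otimes> h \<otimes> y1, inv y1 \<otimes> y)) * F (g, x1) (h, y1))"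
    using assms by (simp add: dual_comul_sum)
  also have "\<dots> = (\<Sum>x1\<in>carrier G. \<Sum>y1\<in>carrier G. if y1 = y then if x1 = inv (p h) \<otimes> x then
      F (g, inv (p h) \<otimes> x) (h, y) else 0 else 0)"
  proof (intro sum.cong refl)
    fix x1 y1 assume xy: "x1 \<in> carrier G" "y1 \<in> carrier G"
    have 1: "inv y1 \<otimes> y = \<one> \<longleftrightarrow> y1 = y"
      using xy assms by (metis inv_equality inv_inv inv_closed l_inv)
    have "inv x1 \<otimes> x = p h \<longleftrightarrow> x = x1 \<otimes> p h"
      using xy assms by (metis inv_solve_left p_carrier)
    also have "\<dots> \<longleftrightarrow> x = p h \<otimes> x1"
      using xy assms by (simp add: p_central)
    also have "\<dots> \<longleftrightarrow> x1 = inv (p h) \<otimes> x"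
      using xy assms by (metis inv_solve_left p_carrier)
    finally show "sigma ((inv x1 \<otimes> g \<otimes> x1, inv x1 \<otimes> x), (inv y1 \<otimes> h \<otimes> y1, inv y1 \<otimes> y)) * F (g, x1) (h, y1)
      = (if y1 = y then if x1 = inv (p h) \<otimes> x then F (g, inv (p h) \<otimes> x) (h, y) else 0 else 0)"
      using xy assms by (simp add: sigma_app p_conj_arg 1)
  qed
  also have "\<dots> = F (g, inv (p h) \<otimes> x) (h, y)"
    using fin assms by simp
  finally show ?thesis .
qed

lemma bil_mulc:
  assumes "g \<in> carrier G" "x \<in> carrier G" "h \<in> carrier G" "y \<in> carrier G" "i \<in> carrier G" "z \<in> carrier G"
  shows "bil (drinfeld_dual G) \<tau> (mulc (drinfeld_dual G) (g, x) (h, y)) (ket (i, z)) =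
      (if x = y then \<tau> ((g \<otimes> h, x), (i, z)) else 0)"
    and "bil (drinfeld_dual G) \<tau> (ket (i, z)) (mulc (drinfeld_dual G) (g, x) (h, y)) =
      (if x = y then \<tau> ((i, z), (g \<otimes> h, x)) else 0)"
  using assms fin
  by (simp_all add: bil_def dual_struct sum_ket_mult mult.assoc sum_distrib_left[symmetric])

lemma sigma_lazy: "(sigma :: _ \<Rightarrow> 'k::field) \<in> lazy_cocycles (drinfeld_dual G)"
proof -
  interpret I: central_hom G "\<lambda>g. inv (p g)"
    by (rule central_hom_inverse)
  let ?D = "drinfeld_dual G :: ('g \<times> 'g, 'k) bialg" and ?s = "sigma :: _ \<Rightarrow> 'k"
  have cv: "conv ?D ?s I.sigma (a, b) = counitc ?D a * counitc ?D b"
    "conv ?D I.sigma ?s (a, b) = counitc ?D a * counitc ?D b"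
    if in_bas: "a \<in> bas ?D" "b \<in> bas ?D" for a b
  proof -
    obtain g x h y where ab: "a = (g, x)" "b = (h, y)" "g \<in> carrier G" "x \<in> carrier G" "h \<in> carrier G" "y \<in> carrier G"
      using in_bas by auto
    have "p h \<otimes> x = p h \<longleftrightarrow> x = \<one>" "inv (p h) \<otimes> x = inv (p h) \<longleftrightarrow> x = \<one>"
      using ab by auto
    then show "conv ?D ?s I.sigma (a, b) = counitc ?D a * counitc ?D b"
      "conv ?D I.sigma ?s (a, b) = counitc ?D a * counitc ?D b"
      using ab by (simp_all add: conv_def sigma_left I.sigma_left)
        (auto simp: I.sigma_app sigma_app dual_struct)
  qed
  have vec: "?s \<in> vecs (bas ?D \<times> bas ?D)"
    by (auto simp: vecs_def sigma_app)
  have unit: "bil ?D ?s (unitc ?D) (ket b) = counitc ?D b" "bil ?D ?s (ket b) (unitc ?D) = counitc ?D b"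
    if in_bas: "b \<in> bas ?D" for b
  proof -
    obtain h y where b: "b = (h, y)" "h \<in> carrier G" "y \<in> carrier G" using in_bas by auto
    have "bil ?D ?s (unitc ?D) (ket b) = (\<Sum>i\<in>GG. unitc ?D i * ?s (i, b))"
      using b fin by (simp add: bil_def sum_ket_mult mult.assoc sum_distrib_left[symmetric])
    also have "\<dots> = (\<Sum>i\<in>GG. if i = (\<one>, p h) then if y = \<one> then 1 else 0 else 0)"
      using b by (intro sum.cong) (auto simp: dual_struct sigma_app split: if_splits)
    finally show "bil ?D ?s (unitc ?D) (ket b) = counitc ?D b"
      using fin b by (simp add: dual_struct)
    have "bil ?D ?s (ket b) (unitc ?D) = (\<Sum>i\<in>GG. unitc ?D i * ?s (b, i))"
      using b fin by (simp add: bil_def sum_ket_mult mult.assoc sum_distrib_left[symmetric])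
    also have "\<dots> = (\<Sum>i\<in>GG. if i = (\<one>, \<one>) then if y = \<one> then 1 else 0 else 0)"
      using b by (intro sum.cong) (auto simp: dual_struct sigma_app p_one split: if_splits)
    finally show "bil ?D ?s (ket b) (unitc ?D) = counitc ?D b"
      using fin b by (simp add: dual_struct)
  qed
  have coc: "(\<Sum>(a1, a2)\<in>bas ?D \<times> bas ?D. \<Sum>(b1, b2)\<in>bas ?D \<times> bas ?D.
          comulc ?D a (a1, a2) * comulc ?D b (b1, b2) * ?s (a1, b1) * bil ?D ?s (mulc ?D a2 b2) (ket c))
     = (\<Sum>(b1, b2)\<in>bas ?D \<times> bas ?D. \<Sum>(c1, c2)\<in>bas ?D \<times> bas ?D.
          comulc ?D b (b1, b2) * comulc ?D c (c1, c2) * ?s (b1, c1) * bil ?D ?s (ket a) (mulc ?D b2 c2))"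
    if in_bas: "a \<in> bas ?D" "b \<in> bas ?D" "c \<in> bas ?D" for a b c
  proof -
    obtain g x h y i z where abc: "a = (g, x)" "b = (h, y)" "c = (i, z)" "g \<in> carrier G" "x \<in> carrier G"
      "h \<in> carrier G" "y \<in> carrier G" "i \<in> carrier G" "z \<in> carrier G"
      using in_bas by auto
    have "inv (p h) \<otimes> x = y \<and> y = p i \<longleftrightarrow> y = p i \<and> x = p (h \<otimes> i)"
      using abc by (metis inv_solve_left p_carrier p_mult)
    moreover have "inv (p i) \<otimes> y = \<one> \<longleftrightarrow> y = p i"
      using abc by (metis inv_solve_left p_carrier r_one one_closed)
    ultimately show ?thesis
      using abc by (simp add: sigma_left bil_mulc) (auto simp: sigma_app)
  qed
  have lazy: "(\<Sum>(a1, a2)\<in>bas ?D \<times> bas ?D. \<Sum>(b1, b2)\<in>bas ?D \<times> bas ?D.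
          (comulc ?D a (a1, a2) * comulc ?D b (b1, b2) * ?s (a1, b1)) \<cdot>\<^sub>v mulc ?D a2 b2)
     = (\<Sum>(a1, a2)\<in>bas ?D \<times> bas ?D. \<Sum>(b1, b2)\<in>bas ?D \<times> bas ?D.
          (comulc ?D a (a1, a2) * comulc ?D b (b1, b2) * ?s (a2, b2)) \<cdot>\<^sub>v mulc ?D a1 b1)"
    if in_bas: "a \<in> bas ?D" "b \<in> bas ?D" for a b
  proof
    fix j
    obtain g x h y where ab: "a = (g, x)" "b = (h, y)" "g \<in> carrier G" "x \<in> carrier G" "h \<in> carrier G" "y \<in> carrier G"
      using in_bas by auto
    show "(\<Sum>(a1, a2)\<in>bas ?D \<times> bas ?D. \<Sum>(b1, b2)\<in>bas ?D \<times> bas ?D.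
          (comulc ?D a (a1, a2) * comulc ?D b (b1, b2) * ?s (a1, b1)) \<cdot>\<^sub>v mulc ?D a2 b2) j
     = (\<Sum>(a1, a2)\<in>bas ?D \<times> bas ?D. \<Sum>(b1, b2)\<in>bas ?D \<times> bas ?D.
          (comulc ?D a (a1, a2) * comulc ?D b (b1, b2) * ?s (a2, b2)) \<cdot>\<^sub>v mulc ?D a1 b1) j"
      using ab sigma_left[of g x h y "\<lambda>a b. mulc ?D a b j"] sigma_right[of g x h y "\<lambda>a b. mulc ?D a b j"]
      by (simp add: sum_fun_app scl_app case_prod_beta')
  qed
  have "conv_invertible ?D ?s"
    unfolding conv_invertible_def using cv by blast
  then have "?s \<in> cocycles ?D"
    unfolding cocycles_def using vec unit coc by blast
  then show ?thesis
    unfolding lazy_cocycles_def using lazy by blast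
qed

end

section \<open>Modules over the Drinfeld double\<close>

context fin_group
begin

abbreviation "DV \<equiv> vecs GG"

lemma finGG: "finite GG"
  using fin by simp

lemma dg_modulesD:
  assumes "M \<in> dg_modules G"
  shows "finite (idx M)"
    and "a \<in> DV \<Longrightarrow> linear_between (idx M) (idx M) (act M a)"
    and "a \<in> DV \<Longrightarrow> b \<in> DV \<Longrightarrow> v \<in> vecs (idx M) \<Longrightarrow> act M (a + b) v = act M a v + act M b v"
    and "a \<in> DV \<Longrightarrow> b \<in> DV \<Longrightarrow> v \<in> vecs (idx M) \<Longrightarrow> act M (bmul (drinfeld G) a b) v = act M a (act M b v)"
    and "a \<in> DV \<Longrightarrow> v \<in> vecs (idx M) \<Longrightarrow> act M (c \<cdot>\<^sub>v a) v = c \<cdot>\<^sub>v act M a v"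
    and "v \<in> vecs (idx M) \<Longrightarrow> act M (unitc (drinfeld G)) v = v"
    and "a \<in> DV \<Longrightarrow> v \<in> vecs (idx M) \<Longrightarrow> act M a v \<in> vecs (idx M)"
  using assms by (auto simp: dg_modules_def linear_between_def)

lemma act_linear:
  "M \<in> dg_modules G \<Longrightarrow> v \<in> vecs (idx M) \<Longrightarrow> linear_between GG (idx M) (\<lambda>a. act M a v)"
  by (rule linear_betweenI) (simp_all add: dg_modulesD)

text \<open>The element \<open>1 \<times> y\<close> of \<open>DG\<close>, where \<open>1\<close> is the constant function on \<open>G\<close>.\<close>

definition grp_elt :: "'g \<Rightarrow> 'g \<times> 'g \<Rightarrow> 'k::field" where
  "grp_elt y = (\<lambda>(x, z). if x \<in> carrier G \<and> z = y then 1 else 0)"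

lemma grp_elt_sum: "grp_elt y = (\<Sum>x\<in>carrier G. ket (x, y))"
  using fin by (auto simp: grp_elt_def fun_eq_iff sum_fun_app ket_app intro!: sum.neutral)

lemma unitc_grp_elt: "unitc (drinfeld G) = grp_elt \<one>"
  by (auto simp: fun_eq_iff drinfeld_struct grp_elt_def)

lemma grp_elt_vecs: "y \<in> carrier G \<Longrightarrow> grp_elt y \<in> DV"
  by (auto simp: grp_elt_def vecs_def)

text \<open>The action of \<open>y \<in> G\<close> on a module, through \<open>1 \<times> y\<close>.\<close>

definition gact :: "('g, 'k::field) dg_mod \<Rightarrow> 'g \<Rightarrow> 'k lmap" where
  "gact M y = act M (grp_elt y)"

text \<open>Homogeneous vectors for the grading of a module by \<open>G\<close>; \<open>e\<^sub>g \<times> 1\<close> is the projection to degree \<open>g\<close>. The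
  zero vector is homogeneous of every degree.\<close>

definition homog :: "('g, 'k::field) dg_mod \<Rightarrow> 'g \<Rightarrow> (nat \<Rightarrow> 'k) \<Rightarrow> bool" where
  "homog M g v \<longleftrightarrow> g \<in> carrier G \<and> v \<in> vecs (idx M) \<and> act M (ket (g, \<one>)) v = v"

lemma homogD: "homog M g v \<Longrightarrow> g \<in> carrier G" "homog M g v \<Longrightarrow> v \<in> vecs (idx M)"
  by (auto simp: homog_def)

lemma conj_closed: "x \<in> carrier G \<Longrightarrow> y \<in> carrier G \<Longrightarrow> x \<otimes> y \<otimes> inv x \<in> carrier G"
  by simp

lemma bmul_drinfeld_ket:
  "x \<in> carrier G \<Longrightarrow> y \<in> carrier G \<Longrightarrow> x' \<in> carrier G \<Longrightarrow> y' \<in> carrier G \<Longrightarrow>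
   bmul (drinfeld G) (ket (x, y)) (ket (x', y')) = (if x = y \<otimes> x' \<otimes> inv y then ket (x, y \<otimes> y') else 0)"
  by (simp add: bmul_ket finGG drinfeld_struct)

lemma act_zero: "M \<in> dg_modules G \<Longrightarrow> v \<in> vecs (idx M) \<Longrightarrow> act M 0 v = 0"
  by (rule linear_between_zero[OF act_linear])

lemma act_ket_comp:
  assumes "M \<in> dg_modules G" "v \<in> vecs (idx M)"
    and "x \<in> carrier G" "y \<in> carrier G" "x' \<in> carrier G" "y' \<in> carrier G"
  shows "act M (ket (x, y)) (act M (ket (x', y')) v) =
    (if x = y \<otimes> x' \<otimes> inv y then act M (ket (x, y \<otimes> y')) v else 0)"
  using dg_modulesD(4)[OF assms(1) vecs_ket vecs_ket assms(2), of "(x, y)" "(x', y')"] assms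
  by (auto simp: bmul_drinfeld_ket act_zero split: if_splits)

context
  fixes M :: "('g, 'k::field) dg_mod"
  assumes M: "M \<in> dg_modules G"
begin

lemma gact_linear: "y \<in> carrier G \<Longrightarrow> linear_between (idx M) (idx M) (gact M y)"
  unfolding gact_def by (intro dg_modulesD(2)[OF M] grp_elt_vecs)

lemma gact_vecs: "y \<in> carrier G \<Longrightarrow> v \<in> vecs (idx M) \<Longrightarrow> gact M y v \<in> vecs (idx M)"
  by (rule linear_betweenD(1)[OF gact_linear])

lemma act_ket_homog_aux:
  assumes "homog M g v" "x \<in> carrier G" "y \<in> carrier G" "x \<noteq> y \<otimes> g \<otimes> inv y"
  shows "act M (ket (x, y)) v = 0"
  using act_ket_comp[OF M, of v x y g \<one>] assms by (simp add: homog_def)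

text \<open>The action of \<open>e\<^sub>x \<times> y\<close> on a vector of degree \<open>g\<close>: after \<open>y\<close> has acted the degree is \<open>ygy\<^sup>-\<^sup>1\<close>.\<close>

lemma act_ket_homog:
  assumes v: "homog M g v" and x: "x \<in> carrier G" and y: "y \<in> carrier G"
  shows "act M (ket (x, y)) v = (if x = y \<otimes> g \<otimes> inv y then gact M y v else 0)"
proof -
  have g: "g \<in> carrier G" "v \<in> vecs (idx M)" using v by (auto simp: homog_def)
  have "gact M y v = (\<Sum>x\<in>carrier G. act M (ket (x, y)) v)"
    unfolding gact_def grp_elt_sum
    using y g by (intro linear_between_sum[OF act_linear[OF M]]) (auto intro: vecs_ket)
  also have "\<dots> = (\<Sum>x\<in>carrier G. if x = y \<otimes> g \<otimes> inv y then act M (ket (x, y)) v else 0)"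
    using act_ket_homog_aux[OF v _ y] by (intro sum.cong) auto
  also have "\<dots> = act M (ket (y \<otimes> g \<otimes> inv y, y)) v"
    using fin g y by simp
  finally show ?thesis
    using act_ket_homog_aux[OF v x y] by auto
qed

lemma gact_homog:
  assumes v: "homog M g v" and y: "y \<in> carrier G"
  shows "homog M (y \<otimes> g \<otimes> inv y) (gact M y v)"
proof -
  have g: "g \<in> carrier G" "v \<in> vecs (idx M)" using v by (auto simp: homog_def)
  have "gact M y v = act M (ket (y \<otimes> g \<otimes> inv y, y)) v"
    using act_ket_homog[OF v _ y] g y by simp
  then show ?thesis
    using g y act_ket_comp[OF M g(2), of "y \<otimes> g \<otimes> inv y" \<one> "y \<otimes> g \<otimes> inv y" y] gact_vecs[OF y g(2)]
    by (simp add: homog_def)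
qed

lemma gact_comp_homog:
  assumes v: "homog M g v" and y: "y \<in> carrier G" "y' \<in> carrier G"
  shows "gact M y (gact M y' v) = gact M (y \<otimes> y') v"
proof -
  have g: "g \<in> carrier G" "v \<in> vecs (idx M)" using v by (auto simp: homog_def)
  have eq: "y \<otimes> y' \<otimes> g \<otimes> inv (y \<otimes> y') = y \<otimes> (y' \<otimes> g \<otimes> inv y') \<otimes> inv y"
    using y g by (simp add: inv_mult_group m_assoc)
  let ?g = "y' \<otimes> g \<otimes> inv y'"
  have "gact M y (gact M y' v) = act M (ket (y \<otimes> ?g \<otimes> inv y, y)) (act M (ket (?g, y')) v)"
    using act_ket_homog[OF v, of ?g y'] act_ket_homog[OF gact_homog[OF v y(2)], of "y \<otimes> ?g \<otimes> inv y" y] g y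
    by simp
  also have "\<dots> = act M (ket (y \<otimes> ?g \<otimes> inv y, y \<otimes> y')) v"
    using g y by (simp add: act_ket_comp[OF M])
  also have "\<dots> = gact M (y \<otimes> y') v"
    using act_ket_homog[OF v, of "y \<otimes> ?g \<otimes> inv y" "y \<otimes> y'"] g y eq by simp
  finally show ?thesis .
qed

lemma homog_component: "v \<in> vecs (idx M) \<Longrightarrow> g \<in> carrier G \<Longrightarrow> homog M g (act M (ket (g, \<one>)) v)"
  using act_ket_comp[OF M, of v g \<one> g \<one>] by (simp add: homog_def dg_modulesD(7)[OF M] vecs_ket)

lemma homog_decomp: "v \<in> vecs (idx M) \<Longrightarrow> v = (\<Sum>g\<in>carrier G. act M (ket (g, \<one>)) v)"
proof -
  assume v: "v \<in> vecs (idx M)"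
  have "v = act M (\<Sum>g\<in>carrier G. ket (g, \<one>)) v"
    using dg_modulesD(6)[OF M v] by (simp add: unitc_grp_elt grp_elt_sum)
  also have "\<dots> = (\<Sum>g\<in>carrier G. act M (ket (g, \<one>)) v)"
    by (intro linear_between_sum[OF act_linear[OF M v]]) (auto intro: vecs_ket)
  finally show ?thesis .
qed

lemma homog_eqI:
  assumes f: "linear_between (idx M) V f" and f': "linear_between (idx M) V' f'"
    and eq: "\<And>g v. homog M g v \<Longrightarrow> f v = f' v" and v: "v \<in> vecs (idx M)"
  shows "f v = f' v"
proof -
  have "f (\<Sum>g\<in>carrier G. act M (ket (g, \<one>)) v) = f' (\<Sum>g\<in>carrier G. act M (ket (g, \<one>)) v)"
    using v by (simp add: linear_between_sum[OF f] linear_between_sum[OF f'] dg_modulesD(7)[OF M] vecs_ket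
        eq[OF homog_component])
  then show ?thesis
    using homog_decomp[OF v] by simp
qed

lemma gact_comp:
  assumes "v \<in> vecs (idx M)" "y \<in> carrier G" "y' \<in> carrier G"
  shows "gact M y (gact M y' v) = gact M (y \<otimes> y') v"
  by (rule homog_eqI[OF linear_between_comp[OF gact_linear gact_linear] gact_linear _ assms(1)])
     (use assms gact_comp_homog in auto)

lemma gact_one: "v \<in> vecs (idx M) \<Longrightarrow> gact M \<one> v = v"
  using dg_modulesD(6)[OF M] by (simp add: gact_def unitc_grp_elt)

end

section \<open>Tensor products of modules\<close>

lemma act2_linear:
  assumes M: "M \<in> dg_modules G" and N: "N \<in> dg_modules G"
  shows "linear_between (tens_idx (idx M) (idx N)) (tens_idx (idx M) (idx N)) (act2 G M N S)"
proof -
  have "linear_between (tens_idx (idx M) (idx N)) (tens_idx (idx M) (idx N))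
    (\<lambda>t. \<Sum>p\<in>GG. \<Sum>q\<in>GG.
      S (p, q) \<cdot>\<^sub>v tens_lin (idx M) (idx N) (act M (ket p)) (act N (ket q)) t)"
    by (rule linear_between_sum_fun, rule linear_between_sum_fun, rule linear_between_scl_fun,
        rule linear_between_tens_lin)
       (auto intro!: dg_modulesD(2)[OF M] dg_modulesD(2)[OF N] vecs_ket)
  then show ?thesis by (simp add: act2_def[abs_def])
qed

lemma act2_linear_left:
  assumes M: "M \<in> dg_modules G" and N: "N \<in> dg_modules G" and t: "t \<in> vecs (tens_idx (idx M) (idx N))"
  shows "linear_between (GG \<times> GG) (tens_idx (idx M) (idx N))
    (\<lambda>S. act2 G M N S t)"
  by (rule linear_betweenI)
     (use linear_betweenD(1)[OF act2_linear[OF M N] t] in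
       \<open>auto simp: act2_def fun_eq_iff sum_fun_app scl_app algebra_simps sum.distrib sum_distrib_left\<close>)

lemma act2_sum: "act2 G M N (\<Sum>i\<in>I. S i) t = (\<Sum>i\<in>I. act2 G M N (S i) t)"
proof (induction I rule: infinite_finite_induct)
  case (insert x F)
  then show ?case
    by (simp add: act2_def fun_eq_iff sum_fun_app scl_app algebra_simps sum.distrib)
qed (simp_all add: act2_def)

lemma act2_pure:
  assumes M: "M \<in> dg_modules G" and N: "N \<in> dg_modules G" and a: "a \<in> DV" and b: "b \<in> DV"
    and v: "v \<in> vecs (idx M)" and w: "w \<in> vecs (idx N)"
  shows "act2 G M N (pure a b) (v \<otimes>\<^sub>v w) = act M a v \<otimes>\<^sub>v act N b w"
proof -
  have "act2 G M N (pure a b) (v \<otimes>\<^sub>v w) = (\<Sum>p\<in>GG. \<Sum>q\<in>GG.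
      (a p \<cdot>\<^sub>v act M (ket p) v) \<otimes>\<^sub>v (b q \<cdot>\<^sub>v act N (ket q) w))"
    unfolding act2_def
  proof (intro sum.cong refl)
    fix p q assume pq: "p \<in> GG" "q \<in> GG"
    have "tens_lin (idx M) (idx N) (act M (ket p)) (act N (ket q)) (v \<otimes>\<^sub>v w) = act M (ket p) v \<otimes>\<^sub>v act N (ket q) w"
      by (rule tens_lin_vtens[OF dg_modulesD(1)[OF M] dg_modulesD(1)[OF N] dg_modulesD(2)[OF M vecs_ket[OF pq(1)]]
          dg_modulesD(2)[OF N vecs_ket[OF pq(2)]] v w])
    then show "pure a b (p, q) \<cdot>\<^sub>v tens_lin (idx M) (idx N) (act M (ket p)) (act N (ket q)) (v \<otimes>\<^sub>v w)
       = (a p \<cdot>\<^sub>v act M (ket p) v) \<otimes>\<^sub>v (b q \<cdot>\<^sub>v act N (ket q) w)"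
      by (simp add: pure_app vtens_lin mult.commute)
  qed
  also have "\<dots> = (\<Sum>p\<in>GG. a p \<cdot>\<^sub>v act M (ket p) v) \<otimes>\<^sub>v
      (\<Sum>q\<in>GG. b q \<cdot>\<^sub>v act N (ket q) w)"
    by (subst sum.swap) (simp only: vtens_lin(7,8))
  also have "\<dots> = act M a v \<otimes>\<^sub>v act N b w"
    using linear_between_expand[OF act_linear[OF M v] finGG a] linear_between_expand[OF act_linear[OF N w] finGG b]
    by simp
  finally show ?thesis .
qed

lemma tens_homog_eqI:
  assumes M: "M \<in> dg_modules G" and N: "N \<in> dg_modules G"
    and f: "linear_between (tens_idx (idx M) (idx N)) V f" and f': "linear_between (tens_idx (idx M) (idx N)) V' f'"
    and eq: "\<And>g h v w. homog M g v \<Longrightarrow> homog N h w \<Longrightarrow> f (v \<otimes>\<^sub>v w) = f' (v \<otimes>\<^sub>v w)"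
    and t: "t \<in> vecs (tens_idx (idx M) (idx N))"
  shows "f t = f' t"
proof (rule tens_ket_eqI[OF f f' dg_modulesD(1)[OF M] dg_modulesD(1)[OF N] _ t])
  fix i j assume ij: "i \<in> idx M" "j \<in> idx N"
  have 1: "f (v \<otimes>\<^sub>v w) = f' (v \<otimes>\<^sub>v w)" if v: "homog M g v" and w: "w \<in> vecs (idx N)" for g v w
    by (rule homog_eqI[OF N linear_between_comp[OF linear_between_vtens(2)[OF homogD(2)[OF v]] f]
          linear_between_comp[OF linear_between_vtens(2)[OF homogD(2)[OF v]] f'] eq[OF v] w])
  show "f (ket i \<otimes>\<^sub>v ket j) = f' (ket i \<otimes>\<^sub>v ket j)"
    by (rule homog_eqI[OF M linear_between_comp[OF linear_between_vtens(1) f]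
          linear_between_comp[OF linear_between_vtens(1) f'] 1]) (use ij in \<open>auto intro: vecs_ket\<close>)
qed

lemma idx_tens_mod [simp]: "idx (tens_mod G M N) = tens_idx (idx M) (idx N)"
  by (simp add: tens_mod_def)

lemma act_tens_ket:
  assumes M: "M \<in> dg_modules G" and N: "N \<in> dg_modules G" and v: "homog M g v" and w: "homog N h w"
    and xy: "x \<in> carrier G" "y \<in> carrier G"
  shows "act (tens_mod G M N) (ket (x, y)) (v \<otimes>\<^sub>v w) =
    (if x = y \<otimes> (g \<otimes> h) \<otimes> inv y then gact M y v \<otimes>\<^sub>v gact N y w else 0)"
proof -
  note g = homogD[OF v] and h = homogD[OF w]
  have bc: "bcomul (drinfeld G) (ket (x, y)) = (\<Sum>x1\<in>carrier G. pure (ket (x1, y)) (ket (inv x1 \<otimes> x, y)))"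
  proof
    fix q :: "('g \<times> 'g) \<times> ('g \<times> 'g)"
    obtain a y1 b y2 where q: "q = ((a, y1), (b, y2))" by (metis surj_pair)
    have e: "b = inv a \<otimes> x \<longleftrightarrow> b \<in> carrier G \<and> a \<otimes> b = x" if "a \<in> carrier G"
      using that xy by (metis inv_solve_left inv_closed m_closed)
    have "(\<Sum>x1\<in>carrier G. pure (ket (x1, y)) (ket (inv x1 \<otimes> x, y))) q =
       (\<Sum>x1\<in>carrier G. if x1 = a then (if y1 = y \<and> y2 = y \<and> b = inv a \<otimes> x then 1 else 0) else 0)"
      unfolding sum_fun_app q by (intro sum.cong) (auto simp: pure_app ket_app)
    then show "bcomul (drinfeld G) (ket (x, y)) q = (\<Sum>x1\<in>carrier G. pure (ket (x1, y)) (ket (inv x1 \<otimes> x, y))) q"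
      using fin xy e by (cases "a \<in> carrier G") (auto simp: q drinfeld_simps ket_app)
  qed
  have iff: "inv (y \<otimes> g \<otimes> inv y) \<otimes> x = y \<otimes> h \<otimes> inv y \<longleftrightarrow> x = y \<otimes> (g \<otimes> h) \<otimes> inv y"
  proof -
    have "inv (y \<otimes> g \<otimes> inv y) \<otimes> x = y \<otimes> h \<otimes> inv y \<longleftrightarrow> x = (y \<otimes> g \<otimes> inv y) \<otimes> (y \<otimes> h \<otimes> inv y)"
      using xy g h by (metis inv_solve_left conj_closed)
    also have "(y \<otimes> g \<otimes> inv y) \<otimes> (y \<otimes> h \<otimes> inv y) = y \<otimes> (g \<otimes> (inv y \<otimes> y) \<otimes> h) \<otimes> inv y"
      using xy g h by (simp only: m_assoc m_closed inv_closed)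
    finally show ?thesis using xy g h by simp
  qed
  have "act (tens_mod G M N) (ket (x, y)) (v \<otimes>\<^sub>v w)
     = (\<Sum>x1\<in>carrier G. act M (ket (x1, y)) v \<otimes>\<^sub>v act N (ket (inv x1 \<otimes> x, y)) w)"
    unfolding tens_mod_def using xy g h
    by (simp add: bc act2_sum act2_pure[OF M N] vecs_ket)
  also have "\<dots> = (\<Sum>x1\<in>carrier G. if x1 = y \<otimes> g \<otimes> inv y then
      (if x = y \<otimes> (g \<otimes> h) \<otimes> inv y then gact M y v \<otimes>\<^sub>v gact N y w else 0) else 0)"
    using xy iff by (intro sum.cong refl) (auto simp: act_ket_homog[OF M v] act_ket_homog[OF N w] vtens_lin)
  also have "\<dots> = (if x = y \<otimes> (g \<otimes> h) \<otimes> inv y then gact M y v \<otimes>\<^sub>v gact N y w else 0)"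
    using fin xy g by simp
  finally show ?thesis .
qed

lemma act_tens_linear:
  assumes M: "M \<in> dg_modules G" and N: "N \<in> dg_modules G"
  shows "linear_between (tens_idx (idx M) (idx N)) (tens_idx (idx M) (idx N)) (act (tens_mod G M N) a)"
    and "t \<in> vecs (tens_idx (idx M) (idx N)) \<Longrightarrow>
      linear_between GG (tens_idx (idx M) (idx N)) (\<lambda>a. act (tens_mod G M N) a t)"
  using act2_linear[OF M N]
    linear_between_comp[OF linear_between_bcomul[OF closed_drinfeld, simplified] act2_linear_left[OF M N]]
  by (simp_all add: tens_mod_def)

lemma tens_mod_module:
  fixes M N :: "('g, 'k::field) dg_mod"
  assumes M: "M \<in> dg_modules G" and N: "N \<in> dg_modules G"
  shows "tens_mod G M N \<in> dg_modules G"
proof -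
  let ?T = "tens_mod G M N" and ?I = "tens_idx (idx M) (idx N)"
  note lin = act_tens_linear[OF M N]
  note av = linear_betweenD(1)[OF lin(1)]
  have homog_case: "act ?T (bmul (drinfeld G) (ket (x, y)) (ket (x', y'))) (v \<otimes>\<^sub>v w)
      = act ?T (ket (x, y)) (act ?T (ket (x', y')) (v \<otimes>\<^sub>v w))"
    if xy: "x \<in> carrier G" "y \<in> carrier G" "x' \<in> carrier G" "y' \<in> carrier G"
      and v: "homog M g v" and w: "homog N h w" for x y x' y' g h v w
  proof -
    note g = homogD[OF v] and h = homogD[OF w]
    let ?g = "y' \<otimes> (g \<otimes> h) \<otimes> inv y'"
    have e1: "(y' \<otimes> g \<otimes> inv y') \<otimes> (y' \<otimes> h \<otimes> inv y') = ?g"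
    proof -
      have "(y' \<otimes> g \<otimes> inv y') \<otimes> (y' \<otimes> h \<otimes> inv y') = y' \<otimes> (g \<otimes> (inv y' \<otimes> y') \<otimes> h) \<otimes> inv y'"
        using xy g h by (simp only: m_assoc m_closed inv_closed)
      then show ?thesis using xy g h by simp
    qed
    have e2: "y \<otimes> y' \<otimes> (g \<otimes> h) \<otimes> inv (y \<otimes> y') = y \<otimes> ?g \<otimes> inv y"
      using xy g h by (simp add: inv_mult_group m_assoc)
    have L: "act ?T (bmul (drinfeld G) (ket (x, y)) (ket (x', y'))) (v \<otimes>\<^sub>v w) =
       (if x = y \<otimes> x' \<otimes> inv y \<and> x = y \<otimes> ?g \<otimes> inv y then gact M (y \<otimes> y') v \<otimes>\<^sub>v gact N (y \<otimes> y') w else 0)"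
      using xy g h linear_between_zero[OF lin(2)[OF vtens_vecs], of v w]
      by (simp add: bmul_drinfeld_ket act_tens_ket[OF M N v w] e2)
    have c: "y \<otimes> x' \<otimes> inv y = y \<otimes> ?g \<otimes> inv y \<longleftrightarrow> x' = ?g"
      using xy g h by simp
    show ?thesis
    proof (cases "x' = ?g")
      case True
      then show ?thesis
        using xy g h L
        by (simp add: act_tens_ket[OF M N v w] act_tens_ket[OF M N gact_homog[OF M v xy(4)] gact_homog[OF N w xy(4)]]
            e1 gact_comp[OF M] gact_comp[OF N])
    next
      case False
      then show ?thesis
        using xy g h L c linear_between_zero[OF lin(1)] by (auto simp: act_tens_ket[OF M N v w])
    qed
  qed
  have ket_case: "act ?T (bmul (drinfeld G) (ket p) (ket q)) t = act ?T (ket p) (act ?T (ket q) t)"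
    if "p \<in> GG" "q \<in> GG" "t \<in> vecs ?I" for p q t
    by (rule tens_homog_eqI[OF M N lin(1) linear_between_comp[OF lin(1) lin(1)] _ that(3)])
       (use that homog_case in auto)
  have half: "act ?T (bmul (drinfeld G) a (ket q)) t = act ?T a (act ?T (ket q) t)"
    if "a \<in> DV" "q \<in> GG" "t \<in> vecs ?I" for a q t
    by (rule linear_between_eqI[OF _ lin(2)[OF av[OF that(3)]] finGG ket_case[OF _ that(2,3)] that(1)])
       (use linear_between_comp[OF linear_between_bmul(1)[OF closed_drinfeld, simplified] lin(2)[OF that(3)]] in auto)
  have mult: "act ?T (bmul (drinfeld G) a b) t = act ?T a (act ?T b t)"
    if "a \<in> DV" "b \<in> DV" "t \<in> vecs ?I" for a b t
    by (rule linear_between_eqI[OF _ linear_between_comp[OF lin(2)[OF that(3)] lin(1)] finGG half[OF that(1) _ that(3)] that(2)])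
       (use linear_between_comp[OF linear_between_bmul(2)[OF closed_drinfeld, simplified] lin(2)[OF that(3)]] in auto)
  have unit: "act ?T (unitc (drinfeld G)) t = t" if "t \<in> vecs ?I" for t
  proof (rule tens_homog_eqI[OF M N lin(1) linear_between_id _ that])
    fix g h v w assume v: "homog M g v" and w: "homog N h w"
    note g = homogD[OF v] and h = homogD[OF w]
    have "act ?T (unitc (drinfeld G)) (v \<otimes>\<^sub>v w) = (\<Sum>x\<in>carrier G. act ?T (ket (x, \<one>)) (v \<otimes>\<^sub>v w))"
      using g h by (simp add: unitc_grp_elt grp_elt_sum linear_between_sum[OF lin(2)[OF vtens_vecs]] vecs_ket)
    also have "\<dots> = v \<otimes>\<^sub>v w"
      using fin g h by (simp add: act_tens_ket[OF M N v w] gact_one[OF M] gact_one[OF N])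
    finally show "act ?T (unitc (drinfeld G)) (v \<otimes>\<^sub>v w) = v \<otimes>\<^sub>v w" .
  qed
  show ?thesis
    unfolding dg_modules_def
    using mult unit lin(1) finite_tens_idx[OF dg_modulesD(1)[OF M] dg_modulesD(1)[OF N]]
      linear_betweenD(2)[OF lin(2)] linear_betweenD(3)[OF lin(2)] by simp
qed

lemma tens_homog:
  assumes M: "M \<in> dg_modules G" and N: "N \<in> dg_modules G" and v: "homog M g v" and w: "homog N h w"
  shows "homog (tens_mod G M N) (g \<otimes> h) (v \<otimes>\<^sub>v w)"
    and "y \<in> carrier G \<Longrightarrow> gact (tens_mod G M N) y (v \<otimes>\<^sub>v w) = gact M y v \<otimes>\<^sub>v gact N y w"
proof -
  note g = homogD[OF v] and h = homogD[OF w]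
  show 1: "homog (tens_mod G M N) (g \<otimes> h) (v \<otimes>\<^sub>v w)"
    using g h by (simp add: homog_def vtens_vecs act_tens_ket[OF M N v w] gact_one[OF M] gact_one[OF N])
  assume y: "y \<in> carrier G"
  show "gact (tens_mod G M N) y (v \<otimes>\<^sub>v w) = gact M y v \<otimes>\<^sub>v gact N y w"
    using act_ket_homog[OF tens_mod_module[OF M N] 1, of "y \<otimes> (g \<otimes> h) \<otimes> inv y" y]
      act_tens_ket[OF M N v w, of "y \<otimes> (g \<otimes> h) \<otimes> inv y" y] g h y by simp
qed

section \<open>Morphisms and twisted modules\<close>

lemma dg_homD:
  assumes "f \<in> dg_hom G M N"
  shows "linear_between (idx M) (idx N) f"
    and "a \<in> DV \<Longrightarrow> v \<in> vecs (idx M) \<Longrightarrow> f (act M a v) = act N a (f v)"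
    and "f \<in> extensional (vecs (idx M))"
  using assms by (auto simp: dg_hom_def lmaps_def)

lemma dg_homI_ket:
  assumes M: "M \<in> dg_modules G" and N: "N \<in> dg_modules G" and f: "f \<in> lmaps (idx M) (idx N)"
    and eq: "\<And>p v. p \<in> GG \<Longrightarrow> v \<in> vecs (idx M) \<Longrightarrow> f (act M (ket p) v) = act N (ket p) (f v)"
  shows "f \<in> dg_hom G M N"
proof -
  have lin: "linear_between (idx M) (idx N) f" using f by (simp add: lmaps_def)
  have "f (act M a v) = act N a (f v)" if "a \<in> DV" "v \<in> vecs (idx M)" for a v
    by (rule linear_between_eqI[OF linear_between_comp[OF act_linear[OF M that(2)] lin]
          act_linear[OF N linear_betweenD(1)[OF lin that(2)]] finGG eq[OF _ that(2)] that(1)])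
  then show ?thesis using f by (simp add: dg_hom_def)
qed

lemma dg_hom_cong:
  assumes "idx M = idx M'" "idx N = idx N'"
    and "\<And>a v. a \<in> DV \<Longrightarrow> v \<in> vecs (idx M) \<Longrightarrow> act M a v = act M' a v"
    and "\<And>a v. a \<in> DV \<Longrightarrow> v \<in> vecs (idx N) \<Longrightarrow> act N a v = act N' a v"
  shows "dg_hom G M N = dg_hom G M' N'"
  using assms linear_betweenD(1) by (fastforce simp: dg_hom_def lmaps_def)

lemma dg_hom_homog:
  assumes "f \<in> dg_hom G M N" "homog M g v"
  shows "homog N g (f v)" "y \<in> carrier G \<Longrightarrow> f (gact M y v) = gact N y (f v)"
  using dg_homD(2)[OF assms(1), of "ket (g, \<one>)" v] dg_homD(2)[OF assms(1) grp_elt_vecs, of y v]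
    linear_betweenD(1)[OF dg_homD(1)[OF assms(1)]] assms(2)
  by (auto simp: homog_def vecs_ket gact_def)

lemma linear_between_restrict:
  "linear_between A B (restrict f (vecs A)) \<longleftrightarrow> linear_between A B f"
  by (rule linear_between_cong) simp

lemma dg_isoI:
  assumes "f \<in> dg_hom G M N" "f' \<in> dg_hom G N M"
    and "\<And>v. v \<in> vecs (idx M) \<Longrightarrow> f' (f v) = v" "\<And>v. v \<in> vecs (idx N) \<Longrightarrow> f (f' v) = v"
  shows "f \<in> dg_iso G M N"
  using assms by (auto simp: dg_iso_def compose_def id_mor_def intro!: bexI[of _ f'] restrict_ext)

lemma id_mor_hom:
  assumes "idx M = idx N" "\<And>a v. a \<in> DV \<Longrightarrow> v \<in> vecs (idx M) \<Longrightarrow> act M a v = act N a v" "M \<in> dg_modules G"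
  shows "id_mor M \<in> dg_hom G M N" "id_mor M \<in> dg_hom G N M"
  using assms dg_modulesD(7)[OF assms(3)]
  by (auto simp: dg_hom_def lmaps_def id_mor_def linear_between_restrict linear_between_id)

text \<open>The module on which \<open>a\<close> acts as \<open>\<psi>(a)\<close> does on \<open>M\<close>.\<close>

definition twist :: "(('g \<times> 'g \<Rightarrow> 'k::field) \<Rightarrow> 'g \<times> 'g \<Rightarrow> 'k) \<Rightarrow> ('g, 'k) dg_mod \<Rightarrow> ('g, 'k) dg_mod" where
  "twist \<psi> M = \<lparr>idx = idx M, act = (\<lambda>a. act M (\<psi> a))\<rparr>"

lemma twist_simps [simp]: "idx (twist \<psi> M) = idx M" "act (twist \<psi> M) a = act M (\<psi> a)"
  by (simp_all add: twist_def)

lemma twist_functor_simps: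
  "obj (twist_functor G \<phi>) M = twist (dagger G \<phi>) M" "mor (twist_functor G \<phi>) M N f = f"
  by (simp_all add: twist_functor_def twist_def)

context
  fixes \<psi> :: "('g \<times> 'g \<Rightarrow> 'k::field) \<Rightarrow> 'g \<times> 'g \<Rightarrow> 'k"
  assumes \<psi>: "\<psi> \<in> hopf_hom (drinfeld G) (drinfeld G)"
begin

lemma \<psi>_linear: "linear_between GG GG \<psi>"
  using hopf_homD(1)[OF \<psi>] by simp

lemma \<psi>_DV: "a \<in> DV \<Longrightarrow> \<psi> a \<in> DV"
  by (rule linear_betweenD(1)[OF \<psi>_linear])

lemma twist_module:
  assumes M: "M \<in> dg_modules G" shows "twist \<psi> M \<in> dg_modules G"
  unfolding dg_modules_def
  by (simp add: dg_modulesD[OF M] \<psi>_DV linear_betweenD(2)[OF \<psi>_linear] linear_betweenD(3)[OF \<psi>_linear]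
      hopf_homD(2)[OF \<psi>, simplified] hopf_homD(3)[OF \<psi>])

lemma twist_hom: "f \<in> dg_hom G M N \<Longrightarrow> f \<in> dg_hom G (twist \<psi> M) (twist \<psi> N)"
  by (simp add: dg_hom_def \<psi>_DV)

text \<open>The modules \<open>F M \<otimes> F N\<close> and \<open>F (M \<otimes> N)\<close> coincide, since \<open>\<psi>\<close> is a coalgebra map.\<close>

lemma act_tens_twist:
  assumes M: "M \<in> dg_modules G" and N: "N \<in> dg_modules G"
    and a: "a \<in> DV" and t: "t \<in> vecs (tens_idx (idx M) (idx N))"
  shows "act (tens_mod G (twist \<psi> M) (twist \<psi> N)) a t = act (twist \<psi> (tens_mod G M N)) a t"
proof -
  note M' = twist_module[OF M] and N' = twist_module[OF N]
  have "act2 G (twist \<psi> M) (twist \<psi> N) S t = act2 G M N (map_pure GG GG \<psi> \<psi> S) t"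
    if S: "S \<in> vecs (GG \<times> GG)" for S
  proof (rule linear_between_eqI[OF _ _ _ _ S])
    show "linear_between (GG \<times> GG) (tens_idx (idx M) (idx N)) (\<lambda>S. act2 G (twist \<psi> M) (twist \<psi> N) S t)"
      using act2_linear_left[OF M' N'] t by simp
    show "linear_between (GG \<times> GG) (tens_idx (idx M) (idx N)) (\<lambda>S. act2 G M N (map_pure GG GG \<psi> \<psi> S) t)"
      by (rule linear_between_comp[OF linear_between_map_pure[OF \<psi>_linear \<psi>_linear] act2_linear_left[OF M N t]])
    fix r assume "r \<in> GG \<times> GG"
    then obtain p q where r: "r = (p, q)" "p \<in> GG" "q \<in> GG" by (metis mem_Sigma_iff surj_pair)
    have "act2 G (twist \<psi> M) (twist \<psi> N) (pure (ket p) (ket q)) t = act2 G M N (pure (\<psi> (ket p)) (\<psi> (ket q))) t"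
    proof (rule tens_homog_eqI[OF M N _ act2_linear[OF M N] _ t])
      show "linear_between (tens_idx (idx M) (idx N)) (tens_idx (idx M) (idx N))
          (act2 G (twist \<psi> M) (twist \<psi> N) (pure (ket p) (ket q)))"
        using act2_linear[OF M' N'] by simp
      fix g h v w assume v: "homog M g v" and w: "homog N h w"
      show "act2 G (twist \<psi> M) (twist \<psi> N) (pure (ket p) (ket q)) (v \<otimes>\<^sub>v w) =
          act2 G M N (pure (\<psi> (ket p)) (\<psi> (ket q))) (v \<otimes>\<^sub>v w)"
        using act2_pure[OF M' N', of "ket p" "ket q" v w] r homogD[OF v] homogD[OF w]
        by (simp add: act2_pure[OF M N] \<psi>_DV vecs_ket)
    qed
    then show "act2 G (twist \<psi> M) (twist \<psi> N) (ket r) t = act2 G M N (map_pure GG GG \<psi> \<psi> (ket r)) t"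
      using map_pure_pure[OF finGG finGG \<psi>_linear \<psi>_linear, of "ket p" "ket q"] r by (simp add: pure_ket vecs_ket)
  qed (use finGG in simp)
  then show ?thesis
    using hopf_homD(4)[OF \<psi>, of a] linear_betweenD(1)[OF linear_between_bcomul[OF closed_drinfeld], of a] a
    by (simp add: tens_mod_def)
qed

lemma tens_twist_hom:
  assumes M: "M \<in> dg_modules G" and N: "N \<in> dg_modules G"
  shows "f \<in> dg_hom G (tens_mod G M N) L \<Longrightarrow> f \<in> dg_hom G (tens_mod G (twist \<psi> M) (twist \<psi> N)) (twist \<psi> L)"
    and "f \<in> dg_hom G L (tens_mod G M N) \<Longrightarrow> f \<in> dg_hom G (twist \<psi> L) (tens_mod G (twist \<psi> M) (twist \<psi> N))"
  using twist_hom[of f "tens_mod G M N" L] twist_hom[of f L "tens_mod G M N"] act_tens_twist[OF M N]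
    dg_hom_cong[of "tens_mod G (twist \<psi> M) (twist \<psi> N)" "twist \<psi> (tens_mod G M N)" "twist \<psi> L" "twist \<psi> L"]
    dg_hom_cong[of "twist \<psi> L" "twist \<psi> L" "tens_mod G (twist \<psi> M) (twist \<psi> N)" "twist \<psi> (tens_mod G M N)"]
  by simp_all

lemma twist_is_functor:
  assumes "dagger G \<phi> = \<psi>" shows "is_functor G (twist_functor G \<phi>)"
  unfolding is_functor_def twist_functor_simps assms
  by (simp add: twist_module twist_hom id_mor_def)

end

text \<open>If \<open>\<phi>\<^sup>\<dagger>\<close> is an involution, the functor is its own quasi-inverse.\<close>

lemma twist_autoequivalence:
  fixes \<phi> :: "('g \<times> 'g \<Rightarrow> 'k::field) \<Rightarrow> 'g \<times> 'g \<Rightarrow> 'k"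
  assumes \<psi>: "dagger G \<phi> \<in> hopf_hom (drinfeld G) (drinfeld G)"
    and inv: "\<And>a. a \<in> DV \<Longrightarrow> dagger G \<phi> (dagger G \<phi> a) = a"
  shows "is_autoequivalence G (twist_functor G \<phi>)"
proof -
  let ?F = "twist_functor G \<phi>"
  have id_iso: "id_mor M \<in> dg_iso G M (twist (dagger G \<phi>) (twist (dagger G \<phi>) M))"
    "id_mor M \<in> dg_iso G (twist (dagger G \<phi>) (twist (dagger G \<phi>) M)) M" if M: "M \<in> dg_modules G" for M
    using id_mor_hom[of M "twist (dagger G \<phi>) (twist (dagger G \<phi>) M)"] M inv
    by (auto intro!: dg_isoI[where f' = "id_mor M"] simp: id_mor_def)
  have nat: "compose (vecs (idx M)) (id_mor N) f = compose (vecs (idx M)) f (id_mor M)"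
    if "f \<in> dg_hom G M N" for M N and f :: "'k lmap"
    using linear_betweenD(1)[OF dg_homD(1)[OF that]] by (auto simp: compose_def id_mor_def intro!: restrict_ext)
  have "nat_iso G id_functor (comp_functor ?F ?F) id_mor" "nat_iso G (comp_functor ?F ?F) id_functor id_mor"
    by (auto simp: nat_iso_def id_functor_def comp_functor_def twist_functor_simps id_iso nat)
  then show ?thesis
    unfolding is_autoequivalence_def using twist_is_functor[OF \<psi> refl] by blast
qed

end

section \<open>The monoidal structure of a central pairing\<close>

context fin_group
begin

lemma assoc_mor_vtens:
  "u \<in> vecs (idx M) \<Longrightarrow> v \<in> vecs (idx N) \<Longrightarrow> w \<in> vecs (idx L) \<Longrightarrow>
    assoc_mor G M N L ((u \<otimes>\<^sub>v v) \<otimes>\<^sub>v w) = u \<otimes>\<^sub>v (v \<otimes>\<^sub>v w)"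
  by (simp add: assoc_mor_def vtens_vecs) (auto simp: vtens_def pure_def fun_eq_iff split: prod.split)

lemma tens_idx_iff: "prod_encode (i, j) \<in> tens_idx A B \<longleftrightarrow> i \<in> A \<and> j \<in> B"
  by (auto simp: tens_idx_def prod_encode_eq image_iff)

lemma assoc_mor_linear:
  fixes M N L :: "('g, 'k::field) dg_mod"
  shows "linear_between (tens_idx (tens_idx (idx M) (idx N)) (idx L)) (tens_idx (idx M) (tens_idx (idx N) (idx L)))
     (assoc_mor G M N L)"
  unfolding assoc_mor_def idx_tens_mod linear_between_restrict
proof (rule linear_betweenI)
  fix t :: "nat \<Rightarrow> 'k" assume t: "t \<in> vecs (tens_idx (tens_idx (idx M) (idx N)) (idx L))"
  have "(let (i, m) = prod_decode n; (j, l) = prod_decode m in t (prod_encode (prod_encode (i, j), l))) = 0"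
    if n: "n \<notin> tens_idx (idx M) (tens_idx (idx N) (idx L))" for n
  proof -
    obtain i m j l where d: "prod_decode n = (i, m)" "prod_decode m = (j, l)" by (metis surj_pair)
    then have nm: "n = prod_encode (i, m)" "m = prod_encode (j, l)" by (metis prod_decode_inverse)+
    have "prod_encode (prod_encode (i, j), l) \<notin> tens_idx (tens_idx (idx M) (idx N)) (idx L)"
      using n by (auto simp: nm tens_idx_iff)
    then show ?thesis using t by (simp add: d vecs_out)
  qed
  then show "(\<lambda>n. let (i, m) = prod_decode n; (j, l) = prod_decode m in t (prod_encode (prod_encode (i, j), l)))
      \<in> vecs (tens_idx (idx M) (tens_idx (idx N) (idx L)))"
    unfolding vecs_def by blast
qed (auto simp: fun_eq_iff scl_app split: prod.split)

lemma tens_mor_vtens: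
  assumes "finite (idx M)" "finite (idx N)" "linear_between (idx M) A f" "linear_between (idx N) B g"
    and "v \<in> vecs (idx M)" "w \<in> vecs (idx N)"
  shows "tens_mor M N f g (v \<otimes>\<^sub>v w) = f v \<otimes>\<^sub>v g w"
  using tens_lin_vtens[OF assms] assms(5,6) by (simp add: tens_mor_def vtens_vecs)

lemma tens_mor_linear:
  "linear_between (idx M) A f \<Longrightarrow> linear_between (idx N) B g \<Longrightarrow>
   linear_between (tens_idx (idx M) (idx N)) (tens_idx A B) (tens_mor M N f g)"
  unfolding tens_mor_def linear_between_restrict by (rule linear_between_tens_lin)

lemma id_mor_linear: "linear_between (idx M) (idx M) (id_mor M)"
  unfolding id_mor_def linear_between_restrict by (rule linear_between_id)

lemma id_mor_app: "v \<in> vecs (idx M) \<Longrightarrow> id_mor M v = v"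
  by (simp add: id_mor_def)

lemma unit_mod_simps [simp]: "idx (unit_mod G) = {0}" "act (unit_mod G) a v = bcounit (drinfeld G) a \<cdot>\<^sub>v v"
  by (simp_all add: unit_mod_def)

lemma unit_mod_module: "(unit_mod G :: ('g, 'k::field) dg_mod) \<in> dg_modules G"
proof -
  have add: "bcounit (drinfeld G) (a + b) = bcounit (drinfeld G) a + bcounit (drinfeld G) (b :: _ \<Rightarrow> 'k)" for a b
    by (simp add: drinfeld_simps sum.distrib)
  have scl: "bcounit (drinfeld G) (c \<cdot>\<^sub>v a) = c * bcounit (drinfeld G) (a :: _ \<Rightarrow> 'k)" for a c
    by (simp add: drinfeld_simps scl_app sum_distrib_left)
  have unit: "bcounit (drinfeld G) (unitc (drinfeld G)) = (1 :: 'k)"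
    using fin by (simp add: drinfeld_simps drinfeld_struct)
  have fn: "functional GG (bcounit (drinfeld G) :: _ \<Rightarrow> 'k)"
    using functional_bcounit[of "drinfeld G"] finGG by simp
  have lin: "linear_between GG GG (\<lambda>v. bmul (drinfeld G) v (w :: _ \<Rightarrow> 'k))"
    "linear_between GG GG (\<lambda>w. bmul (drinfeld G) (v :: _ \<Rightarrow> 'k) w)" for v w
    using linear_between_bmul[OF closed_drinfeld, simplified] .
  have ctk: "bcounit (drinfeld G) (ket (x, y)) = (if x = \<one> then 1 else 0 :: 'k)" if "y \<in> carrier G" for x y
    using that fin by (auto simp: drinfeld_simps ket_app)
  have c0: "bcounit (drinfeld G) 0 = (0 :: 'k)"
    by (simp add: drinfeld_simps)
  have k: "bcounit (drinfeld G) (bmul (drinfeld G) (ket p) (ket q))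
      = bcounit (drinfeld G) (ket p) * (bcounit (drinfeld G) (ket q) :: 'k)"
    if pq: "p \<in> GG" "q \<in> GG" for p q
  proof -
    obtain x y x' y' where e: "p = (x, y)" "q = (x', y')" "x \<in> carrier G" "y \<in> carrier G" "x' \<in> carrier G" "y' \<in> carrier G"
      using pq by auto
    have "\<one> = y \<otimes> x' \<otimes> inv y \<longleftrightarrow> x' = \<one>"
      using e by (metis inv_solve_right l_cancel_one' one_closed l_one m_closed)
    then show ?thesis
      using e by (auto simp: bmul_drinfeld_ket ctk c0)
  qed
  have k2: "bcounit (drinfeld G) (bmul (drinfeld G) a (ket q))
      = bcounit (drinfeld G) a * (bcounit (drinfeld G) (ket q) :: 'k)"
    if "a \<in> DV" "q \<in> GG" for a q
    by (rule functional_eqI[OF functional_comp[OF fn lin(1) finGG] functional_mult(2)[OF fn] k[OF _ that(2)] that(1)])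
  have mult: "bcounit (drinfeld G) (bmul (drinfeld G) a b) = bcounit (drinfeld G) a * (bcounit (drinfeld G) b :: 'k)"
    if "a \<in> DV" "b \<in> DV" for a b
    by (rule functional_eqI[OF functional_comp[OF fn lin(2) finGG] functional_mult(1)[OF fn] k2[OF that(1)] that(2)])
  show ?thesis
    unfolding dg_modules_def
    by (auto simp: add scl unit mult unit_mod_def intro!: linear_between_scl_fun linear_between_id)
       (auto simp: fun_eq_iff scl_app algebra_simps)
qed

lemma bcounit_grp_elt: "bcounit (drinfeld G) (grp_elt y) = (if y \<in> carrier G then 1 else 0)"
  using fin by (auto simp: drinfeld_simps grp_elt_def)

lemma unit_mor_linear:
  "linear_between (tens_idx {0} (idx M)) (idx M) (lunit_mor G M)"
  "linear_between (tens_idx (idx M) {0}) (idx M) (runit_mor G M)"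
  unfolding lunit_mor_def runit_mor_def idx_tens_mod unit_mod_simps linear_between_restrict
  by (rule linear_betweenI; auto simp: vecs_def tens_idx_iff scl_app fun_eq_iff)+

end

context central_hom
begin

lemma sigma_sum: "sigma = (\<Sum>h\<in>carrier G. pure (grp_elt (p h)) (ket (h, \<one>)))"
proof
  fix q :: "('g \<times> 'g) \<times> ('g \<times> 'g)"
  obtain g x h y where q: "q = ((g, x), (h, y))" by (metis surj_pair)
  have "(\<Sum>h\<in>carrier G. pure (grp_elt (p h)) (ket (h, \<one>))) q =
     (\<Sum>h'\<in>carrier G. if h' = h then (if g \<in> carrier G \<and> x = p h \<and> y = \<one> then 1 else 0) else 0)"
    unfolding sum_fun_app q by (intro sum.cong) (auto simp: pure_app ket_app grp_elt_def)
  then show "sigma q = (\<Sum>h\<in>carrier G. pure (grp_elt (p h)) (ket (h, \<one>))) q"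
    using fin by (auto simp: q sigma_app)
qed

text \<open>The monoidal structure defined by the pairing.\<close>

abbreviation J :: "('g, 'k::field) dg_mod \<Rightarrow> ('g, 'k) dg_mod \<Rightarrow> 'k lmap" where
  "J \<equiv> cocycle_str G sigma"

text \<open>\<open>J\<close> sends \<open>v \<otimes> w\<close> to \<open>p(h).v \<otimes> w\<close> if \<open>w\<close> has degree \<open>h\<close>.\<close>

lemma J_vtens:
  assumes M: "M \<in> dg_modules G" and N: "N \<in> dg_modules G" and v: "v \<in> vecs (idx M)" and w: "homog N h w"
  shows "J M N (v \<otimes>\<^sub>v w) = gact M (p h) v \<otimes>\<^sub>v w"
proof -
  note h = homogD[OF w]
  have "J M N (v \<otimes>\<^sub>v w) = (\<Sum>h'\<in>carrier G. gact M (p h') v \<otimes>\<^sub>v act N (ket (h', \<one>)) w)"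
    using v h by (simp add: cocycle_str_def vtens_vecs sigma_sum act2_sum act2_pure[OF M N] grp_elt_vecs vecs_ket gact_def)
  also have "\<dots> = (\<Sum>h'\<in>carrier G. if h' = h then gact M (p h) v \<otimes>\<^sub>v w else 0)"
    using h by (intro sum.cong refl) (auto simp: act_ket_homog[OF N w] gact_one[OF N] vtens_lin)
  finally show ?thesis
    using fin h by simp
qed

lemma J_linear:
  assumes "M \<in> dg_modules G" and "N \<in> dg_modules G"
  shows "linear_between (tens_idx (idx M) (idx N)) (tens_idx (idx M) (idx N)) (J M N)"
  using act2_linear[OF assms] by (simp add: cocycle_str_def linear_between_restrict)

lemma J_hom:
  fixes M N :: "('g, 'k::field) dg_mod"
  assumes M: "M \<in> dg_modules G" and N: "N \<in> dg_modules G"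
  shows "J M N \<in> dg_hom G (tens_mod G M N) (tens_mod G M N)"
proof (rule dg_homI_ket[OF tens_mod_module[OF M N] tens_mod_module[OF M N]])
  note lin = J_linear[OF M N]
  show "J M N \<in> lmaps (idx (tens_mod G M N)) (idx (tens_mod G M N))"
    using lin by (simp add: lmaps_def) (simp add: cocycle_str_def)
  fix q and t :: "nat \<Rightarrow> 'k" assume q: "q \<in> GG" and t: "t \<in> vecs (idx (tens_mod G M N))"
  obtain x y where xy: "q = (x, y)" "x \<in> carrier G" "y \<in> carrier G" using q by auto
  have aq: "linear_between (tens_idx (idx M) (idx N)) (tens_idx (idx M) (idx N)) (act (tens_mod G M N) (ket q))"
    by (rule act_tens_linear(1)[OF M N])
  show "J M N (act (tens_mod G M N) (ket q) t) = act (tens_mod G M N) (ket q) (J M N t)"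
  proof (rule tens_homog_eqI[OF M N linear_between_comp[OF aq lin] linear_between_comp[OF lin aq] _ t[unfolded idx_tens_mod]])
    fix g h v w assume v: "homog M g v" and w: "homog N h w"
    note g = homogD[OF v] and h = homogD[OF w]
    have pc: "p h \<otimes> g \<otimes> inv (p h) = g"
      using g h by (simp add: p_central m_assoc)
    have pv: "homog M g (gact M (p h) v)"
      using gact_homog[OF M v, of "p h"] g h pc by simp
    have ph: "p (y \<otimes> h \<otimes> inv y) = p h"
      using p_conj_arg[of h "inv y"] xy h by simp
    have "gact M (p h) (gact M y v) = gact M y (gact M (p h) v)"
      using xy g h by (simp add: gact_comp[OF M] p_central)
    then show "J M N (act (tens_mod G M N) (ket q) (v \<otimes>\<^sub>v w)) = act (tens_mod G M N) (ket q) (J M N (v \<otimes>\<^sub>v w))"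
      using xy g h linear_between_zero[OF lin] J_vtens[OF M N gact_vecs[OF M xy(3) g(2)] gact_homog[OF N w xy(3)]]
      by (simp add: act_tens_ket[OF M N v w] J_vtens[OF M N g(2) w] act_tens_ket[OF M N pv w] ph)
  qed
qed

lemma J_inverse:
  fixes M N :: "('g, 'k::field) dg_mod"
  assumes M: "M \<in> dg_modules G" and N: "N \<in> dg_modules G" and t: "t \<in> vecs (tens_idx (idx M) (idx N))"
  shows "cocycle_str G (central_hom.sigma G (\<lambda>g. inv (p g))) M N (J M N t) = t"
    and "J M N (cocycle_str G (central_hom.sigma G (\<lambda>g. inv (p g))) M N t) = t"
proof -
  interpret I: central_hom G "\<lambda>g. inv (p g)" by (rule central_hom_inverse)
  have eq: "I.J M N (J M N (v \<otimes>\<^sub>v w)) = v \<otimes>\<^sub>v w" "J M N (I.J M N (v \<otimes>\<^sub>v w)) = v \<otimes>\<^sub>v w"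
    if v: "homog M g v" and w: "homog N h w" for g h v w
    using homogD[OF v] homogD[OF w]
    by (simp_all add: J_vtens[OF M N _ w] I.J_vtens[OF M N _ w] gact_vecs[OF M] gact_comp[OF M] gact_one[OF M])
  show "I.J M N (J M N t) = t"
    by (rule tens_homog_eqI[OF M N linear_between_comp[OF J_linear[OF M N] I.J_linear[OF M N]] linear_between_id eq(1) t])
  show "J M N (I.J M N t) = t"
    by (rule tens_homog_eqI[OF M N linear_between_comp[OF I.J_linear[OF M N] J_linear[OF M N]] linear_between_id eq(2) t])
qed

lemma J_natural:
  fixes M N M' N' :: "('g, 'k::field) dg_mod"
  assumes M: "M \<in> dg_modules G" and N: "N \<in> dg_modules G" and M': "M' \<in> dg_modules G" and N': "N' \<in> dg_modules G"
    and f: "f \<in> dg_hom G M M'" and g: "g \<in> dg_hom G N N'" and t: "t \<in> vecs (tens_idx (idx M) (idx N))"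
  shows "J M' N' (tens_mor M N f g t) = tens_mor M N f g (J M N t)"
proof (rule tens_homog_eqI[OF M N _ _ _ t])
  note lt = tens_mor_linear[OF dg_homD(1)[OF f] dg_homD(1)[OF g]]
  show "linear_between (tens_idx (idx M) (idx N)) (tens_idx (idx M') (idx N')) (\<lambda>t. J M' N' (tens_mor M N f g t))"
    by (rule linear_between_comp[OF lt J_linear[OF M' N']])
  show "linear_between (tens_idx (idx M) (idx N)) (tens_idx (idx M') (idx N')) (\<lambda>t. tens_mor M N f g (J M N t))"
    by (rule linear_between_comp[OF J_linear[OF M N] lt])
  fix a b v w assume v: "homog M a v" and w: "homog N b w"
  note vw = homogD[OF v] homogD[OF w]
  note tm = tens_mor_vtens[OF dg_modulesD(1)[OF M] dg_modulesD(1)[OF N] dg_homD(1)[OF f] dg_homD(1)[OF g]]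
  show "J M' N' (tens_mor M N f g (v \<otimes>\<^sub>v w)) = tens_mor M N f g (J M N (v \<otimes>\<^sub>v w))"
    using vw J_vtens[OF M' N' linear_betweenD(1)[OF dg_homD(1)[OF f] vw(2)] dg_hom_homog(1)[OF g w]]
    by (simp add: tm J_vtens[OF M N _ w] gact_vecs[OF M] dg_hom_homog(2)[OF f v])
qed

lemma J_assoc:
  fixes M N L :: "('g, 'k::field) dg_mod"
  assumes M: "M \<in> dg_modules G" and N: "N \<in> dg_modules G" and L: "L \<in> dg_modules G"
    and t: "t \<in> vecs (tens_idx (tens_idx (idx M) (idx N)) (idx L))"
  shows "assoc_mor G M N L (J (tens_mod G M N) L (tens_mor (tens_mod G M N) L (J M N) (id_mor L) t))
    = J M (tens_mod G N L) (tens_mor M (tens_mod G N L) (id_mor M) (J N L) (assoc_mor G M N L t))"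
proof -
  let ?MN = "tens_mod G M N" and ?NL = "tens_mod G N L"
  note MN = tens_mod_module[OF M N] and NL = tens_mod_module[OF N L]
  note fins = dg_modulesD(1)[OF M] dg_modulesD(1)[OF N] dg_modulesD(1)[OF L] dg_modulesD(1)[OF MN] dg_modulesD(1)[OF NL]
  have lMN: "linear_between (idx ?MN) (idx ?MN) (J M N)" and lNL: "linear_between (idx ?NL) (idx ?NL) (J N L)"
    using J_linear[OF M N] J_linear[OF N L] by simp_all
  define l where "l = (\<lambda>t. assoc_mor G M N L (J ?MN L (tens_mor ?MN L (J M N) (id_mor L) t)))"
  define r where "r = (\<lambda>t. J M ?NL (tens_mor M ?NL (id_mor M) (J N L) (assoc_mor G M N L t)))"
  have ll: "linear_between (tens_idx (idx ?MN) (idx L)) (tens_idx (idx M) (idx ?NL)) l"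
    unfolding l_def using linear_between_comp[OF linear_between_comp[OF tens_mor_linear[OF lMN id_mor_linear] J_linear[OF MN L]],
        of "tens_idx (idx M) (idx ?NL)" "assoc_mor G M N L"] assoc_mor_linear[of M N L] by simp
  have lr: "linear_between (tens_idx (idx ?MN) (idx L)) (tens_idx (idx M) (idx ?NL)) r"
    unfolding r_def
    using linear_between_comp[OF linear_between_comp[OF _ tens_mor_linear[OF id_mor_linear lNL]] J_linear[OF M NL],
        of "tens_idx (idx ?MN) (idx L)" "assoc_mor G M N L"] assoc_mor_linear[of M N L] by simp
  have eq: "l ((u \<otimes>\<^sub>v v) \<otimes>\<^sub>v w) = r ((u \<otimes>\<^sub>v v) \<otimes>\<^sub>v w)"
    if u: "homog M a u" and v: "homog N b v" and w: "homog L c w" for a b c u v w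
  proof -
    note uvw = homogD[OF u] homogD[OF v] homogD[OF w]
    have u': "homog M (p b \<otimes> a \<otimes> inv (p b)) (gact M (p b) u)"
      using uvw by (intro gact_homog[OF M u]) auto
    have v': "homog N (p c \<otimes> b \<otimes> inv (p c)) (gact N (p c) v)"
      using uvw by (intro gact_homog[OF N v]) auto
    have pc: "p c \<otimes> b \<otimes> inv (p c) = b"
      using uvw by (simp add: p_central m_assoc)
    have 1: "tens_mor ?MN L (J M N) (id_mor L) ((u \<otimes>\<^sub>v v) \<otimes>\<^sub>v w) = (gact M (p b) u \<otimes>\<^sub>v v) \<otimes>\<^sub>v w"
      using uvw by (subst tens_mor_vtens[OF fins(4) fins(3) lMN id_mor_linear])
        (simp_all add: vtens_vecs J_vtens[OF M N _ v] id_mor_app)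
    have 2: "J ?MN L ((gact M (p b) u \<otimes>\<^sub>v v) \<otimes>\<^sub>v w) = (gact M (p c) (gact M (p b) u) \<otimes>\<^sub>v gact N (p c) v) \<otimes>\<^sub>v w"
      using uvw by (subst J_vtens[OF MN L _ w])
        (simp_all add: vtens_vecs gact_vecs[OF M] tens_homog(2)[OF M N u' v])
    have lhs: "l ((u \<otimes>\<^sub>v v) \<otimes>\<^sub>v w) = gact M (p c \<otimes> p b) u \<otimes>\<^sub>v (gact N (p c) v \<otimes>\<^sub>v w)"
      using uvw by (simp add: l_def 1 2 gact_comp[OF M] assoc_mor_vtens gact_vecs[OF M] gact_vecs[OF N])
    have 3: "assoc_mor G M N L ((u \<otimes>\<^sub>v v) \<otimes>\<^sub>v w) = u \<otimes>\<^sub>v (v \<otimes>\<^sub>v w)"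
      using uvw by (simp add: assoc_mor_vtens)
    have 4: "tens_mor M ?NL (id_mor M) (J N L) (u \<otimes>\<^sub>v (v \<otimes>\<^sub>v w)) = u \<otimes>\<^sub>v (gact N (p c) v \<otimes>\<^sub>v w)"
      using uvw by (subst tens_mor_vtens[OF fins(1) fins(5) id_mor_linear lNL])
        (simp_all add: vtens_vecs J_vtens[OF N L _ w] id_mor_app)
    have "homog ?NL (b \<otimes> c) (gact N (p c) v \<otimes>\<^sub>v w)"
      using tens_homog(1)[OF N L v' w] pc by simp
    then have "r ((u \<otimes>\<^sub>v v) \<otimes>\<^sub>v w) = gact M (p (b \<otimes> c)) u \<otimes>\<^sub>v (gact N (p c) v \<otimes>\<^sub>v w)"
      using uvw by (simp add: r_def 3 4 J_vtens[OF M NL])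
    then show ?thesis
      using uvw lhs p_mult[of b c] p_central[of b "p c"] by simp
  qed
  have eq2: "l (x \<otimes>\<^sub>v w) = r (x \<otimes>\<^sub>v w)" if x: "x \<in> vecs (tens_idx (idx M) (idx N))" and w: "homog L c w" for x c w
  proof (rule tens_homog_eqI[OF M N, where f = "\<lambda>x. l (x \<otimes>\<^sub>v w)" and f' = "\<lambda>x. r (x \<otimes>\<^sub>v w)"])
    note lw = linear_between_vtens(1)[OF homogD(2)[OF w], of "tens_idx (idx M) (idx N)"]
    show "linear_between (tens_idx (idx M) (idx N)) (tens_idx (idx M) (idx ?NL)) (\<lambda>x. l (x \<otimes>\<^sub>v w))"
      using linear_between_comp[OF lw ll[unfolded idx_tens_mod]] by simp
    show "linear_between (tens_idx (idx M) (idx N)) (tens_idx (idx M) (idx ?NL)) (\<lambda>x. r (x \<otimes>\<^sub>v w))"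
      using linear_between_comp[OF lw lr[unfolded idx_tens_mod]] by simp
  qed (use eq[OF _ _ w] x in auto)
  have "l t = r t"
  proof (rule tens_homog_eqI[OF MN L ll lr])
    fix g c x w assume x: "homog ?MN g x" and w: "homog L c w"
    show "l (x \<otimes>\<^sub>v w) = r (x \<otimes>\<^sub>v w)"
      using eq2[OF _ w, of x] homogD(2)[OF x] by simp
  qed (use t in simp)
  then show ?thesis by (simp add: l_def r_def)
qed

lemma J_unit:
  fixes M :: "('g, 'k::field) dg_mod"
  assumes M: "M \<in> dg_modules G"
  shows "t \<in> vecs (tens_idx {0} (idx M)) \<Longrightarrow>
      lunit_mor G M (J (unit_mod G) M (tens_mor (unit_mod G) M (id_mor (unit_mod G)) (id_mor M) t)) = lunit_mor G M t"
    and "t \<in> vecs (tens_idx (idx M) {0}) \<Longrightarrow>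
      runit_mor G M (J M (unit_mod G) (tens_mor M (unit_mod G) (id_mor M) (id_mor (unit_mod G)) t)) = runit_mor G M t"
proof -
  note U = unit_mod_module and fins = dg_modulesD(1)[OF M]
  note tm = tens_mor_vtens[OF _ _ id_mor_linear id_mor_linear]
  note lin = linear_between_comp[OF tens_mor_linear[OF id_mor_linear id_mor_linear] J_linear]
  {
    assume t: "t \<in> vecs (tens_idx {0} (idx M))"
    show "lunit_mor G M (J (unit_mod G) M (tens_mor (unit_mod G) M (id_mor (unit_mod G)) (id_mor M) t)) = lunit_mor G M t"
    proof (rule tens_homog_eqI[OF U M, where t = t and f' = "lunit_mor G M" and
          f = "\<lambda>t. lunit_mor G M (J (unit_mod G) M (tens_mor (unit_mod G) M (id_mor (unit_mod G)) (id_mor M) t))"])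
      show "linear_between (tens_idx (idx (unit_mod G :: ('g, 'k) dg_mod)) (idx M)) (idx M)
          (\<lambda>t. lunit_mor G M (J (unit_mod G) M (tens_mor (unit_mod G) M (id_mor (unit_mod G)) (id_mor M) t)))"
        using linear_between_comp[OF lin[OF U M]] unit_mor_linear(1)[of M] by simp
      fix g h and v w :: "nat \<Rightarrow> 'k" assume v: "homog (unit_mod G) g v" and w: "homog M h w"
      note vw = homogD[OF v] homogD[OF w]
      have "gact (unit_mod G) (p h) v = v"
        using vw by (simp add: gact_def bcounit_grp_elt)
      then show "lunit_mor G M (J (unit_mod G) M (tens_mor (unit_mod G) M (id_mor (unit_mod G)) (id_mor M) (v \<otimes>\<^sub>v w)))
          = lunit_mor G M (v \<otimes>\<^sub>v w)"
        using vw by (simp add: tm[OF _ fins] id_mor_app J_vtens[OF U M _ w])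
    qed (use t unit_mor_linear in auto)
  }
  assume t: "t \<in> vecs (tens_idx (idx M) {0})"
  show "runit_mor G M (J M (unit_mod G) (tens_mor M (unit_mod G) (id_mor M) (id_mor (unit_mod G)) t)) = runit_mor G M t"
  proof (rule tens_homog_eqI[OF M U, where t = t and f' = "runit_mor G M" and
        f = "\<lambda>t. runit_mor G M (J M (unit_mod G) (tens_mor M (unit_mod G) (id_mor M) (id_mor (unit_mod G)) t))"])
    show "linear_between (tens_idx (idx M) (idx (unit_mod G :: ('g, 'k) dg_mod))) (idx M)
        (\<lambda>t. runit_mor G M (J M (unit_mod G) (tens_mor M (unit_mod G) (id_mor M) (id_mor (unit_mod G)) t)))"
      using linear_between_comp[OF lin[OF M U]] unit_mor_linear(2)[of M] by simp
    fix g h and v w :: "nat \<Rightarrow> 'k" assume v: "homog M g v" and w: "homog (unit_mod G) h w"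
    note vw = homogD[OF v] homogD[OF w]
    \<comment> \<open>the unit object is concentrated in degree \<open>\<one>\<close>, so the given \<open>h\<close> may be replaced by \<open>\<one>\<close>\<close>
    have "homog (unit_mod G) \<one> w"
      using vw fin by (simp add: homog_def drinfeld_simps ket_app)
    from J_vtens[OF M U vw(2) this]
    show "runit_mor G M (J M (unit_mod G) (tens_mor M (unit_mod G) (id_mor M) (id_mor (unit_mod G)) (v \<otimes>\<^sub>v w)))
        = runit_mor G M (v \<otimes>\<^sub>v w)"
      using vw by (simp add: tm[OF fins] id_mor_app p_one gact_one[OF M])
  qed (use t unit_mor_linear in auto)
qed

lemma unit_mor_twist:
  "lunit_mor G (twist \<psi> M) = lunit_mor G M" "runit_mor G (twist \<psi> M) = runit_mor G M"
  "assoc_mor G (twist \<psi> M) (twist \<psi> N) (twist \<psi> L) = assoc_mor G M N L"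
  "tens_mor (twist \<psi> M) N' = tens_mor M N'" "tens_mor M' (twist \<psi> N) = tens_mor M' N"
  "id_mor (twist \<psi> M) = id_mor M"
  by (auto simp: lunit_mor_def runit_mor_def assoc_mor_def tens_mor_def id_mor_def fun_eq_iff)

lemma tens_mor_tens_twist:
  "tens_mor (tens_mod G (twist \<psi> M) (twist \<psi> N)) L = tens_mor (tens_mod G M N) L"
  "tens_mor L (tens_mod G (twist \<psi> M) (twist \<psi> N)) = tens_mor L (tens_mod G M N)"
  by (auto simp: tens_mor_def fun_eq_iff)

lemma twist_monoidal:
  fixes \<phi> :: "('g \<times> 'g \<Rightarrow> 'k::field) \<Rightarrow> 'g \<times> 'g \<Rightarrow> 'k"
  assumes \<psi>: "dagger G \<phi> \<in> hopf_hom (drinfeld G) (drinfeld G)"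
  shows "is_monoidal_functor G (twist_functor G \<phi>, cocycle_str G sigma)"
  unfolding is_monoidal_functor_def prod.case twist_functor_simps
proof (intro conjI ballI)
  let ?t = "twist (dagger G \<phi>)"
  interpret I: central_hom G "\<lambda>g. inv (p g)" by (rule central_hom_inverse)
  show "is_functor G (twist_functor G \<phi>)"
    by (rule twist_is_functor[OF \<psi> refl])
  {
    fix M N :: "('g, 'k) dg_mod" assume M: "M \<in> dg_modules G" and N: "N \<in> dg_modules G"
    show "J M N \<in> dg_iso G (tens_mod G (?t M) (?t N)) (?t (tens_mod G M N))"
    proof (rule dg_isoI)
      show "J M N \<in> dg_hom G (tens_mod G (?t M) (?t N)) (?t (tens_mod G M N))"
        by (rule tens_twist_hom(1)[OF \<psi> M N J_hom[OF M N]])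
      show "I.J M N \<in> dg_hom G (?t (tens_mod G M N)) (tens_mod G (?t M) (?t N))"
        by (rule tens_twist_hom(2)[OF \<psi> M N I.J_hom[OF M N]])
    qed (use J_inverse[OF M N] in auto)
  }
  {
    fix M N M' N' :: "('g, 'k) dg_mod" and f g
    assume *: "M \<in> dg_modules G" "N \<in> dg_modules G" "M' \<in> dg_modules G" "N' \<in> dg_modules G"
      "f \<in> dg_hom G M M'" "g \<in> dg_hom G N N'"
    show "compose (vecs (idx (tens_mod G (?t M) (?t N)))) (J M' N') (tens_mor (?t M) (?t N) f g)
      = compose (vecs (idx (tens_mod G (?t M) (?t N)))) (tens_mor M N f g) (J M N)"
      using J_natural[OF *] by (auto simp: compose_def unit_mor_twist intro!: restrict_ext)
  }
  {
    fix M N L :: "('g, 'k) dg_mod"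
    assume *: "M \<in> dg_modules G" "N \<in> dg_modules G" "L \<in> dg_modules G"
    show "let V = tens_mod G (tens_mod G (?t M) (?t N)) (?t L) in
        comp_mor V (assoc_mor G M N L) (comp_mor V (J (tens_mod G M N) L)
           (tens_mor (tens_mod G (?t M) (?t N)) (?t L) (J M N) (id_mor (?t L))))
      = comp_mor V (J M (tens_mod G N L))
          (comp_mor V (tens_mor (?t M) (tens_mod G (?t N) (?t L)) (id_mor (?t M)) (J N L))
            (assoc_mor G (?t M) (?t N) (?t L)))"
      using J_assoc[OF *]
      by (auto simp: Let_def compose_def unit_mor_twist tens_mor_tens_twist intro!: restrict_ext)
  }
  have u: "id_mor (unit_mod G) \<in> dg_iso G (unit_mod G) (?t (unit_mod G))"
    by (rule dg_isoI[where f' = "id_mor (unit_mod G)"])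
       (use id_mor_hom[of "unit_mod G" "?t (unit_mod G)"] unit_mod_module hopf_homD(5)[OF \<psi>] in
         \<open>auto simp: id_mor_app\<close>)
  show "\<exists>u\<in>dg_iso G (unit_mod G) (?t (unit_mod G)). \<forall>M\<in>dg_modules G.
        comp_mor (tens_mod G (unit_mod G) (?t M)) (lunit_mor G M)
          (comp_mor (tens_mod G (unit_mod G) (?t M)) (J (unit_mod G) M) (tens_mor (unit_mod G) (?t M) u (id_mor (?t M))))
        = lunit_mor G (?t M) \<and>
        comp_mor (tens_mod G (?t M) (unit_mod G)) (runit_mor G M)
          (comp_mor (tens_mod G (?t M) (unit_mod G)) (J M (unit_mod G)) (tens_mor (?t M) (unit_mod G) (id_mor (?t M)) u))
        = runit_mor G (?t M)"
  proof (rule bexI[OF _ u], intro ballI conjI)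
    fix M :: "('g, 'k) dg_mod" assume M: "M \<in> dg_modules G"
    have ext: "f = restrict g A" if "f \<in> extensional A" "\<And>x. x \<in> A \<Longrightarrow> f x = g x" for f g :: "'k lmap" and A
      using that by (auto simp: fun_eq_iff extensional_def)
    have l: "lunit_mor G M \<in> extensional (vecs (tens_idx {0} (idx M)))"
      and r: "runit_mor G M \<in> extensional (vecs (tens_idx (idx M) {0}))"
      by (simp_all add: lunit_mor_def runit_mor_def)
    show "comp_mor (tens_mod G (unit_mod G) (?t M)) (lunit_mor G M)
          (comp_mor (tens_mod G (unit_mod G) (?t M)) (J (unit_mod G) M) (tens_mor (unit_mod G) (?t M) (id_mor (unit_mod G)) (id_mor (?t M))))
        = lunit_mor G (?t M)"
      unfolding unit_mor_twist compose_def idx_tens_mod twist_simps unit_mod_simps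
      by (rule ext[OF l, symmetric]) (simp add: J_unit(1)[OF M])
    show "comp_mor (tens_mod G (?t M) (unit_mod G)) (runit_mor G M)
          (comp_mor (tens_mod G (?t M) (unit_mod G)) (J M (unit_mod G)) (tens_mor (?t M) (unit_mod G) (id_mor (?t M)) (id_mor (unit_mod G))))
        = runit_mor G (?t M)"
      unfolding unit_mor_twist compose_def idx_tens_mod twist_simps unit_mod_simps
      by (rule ext[OF r, symmetric]) (simp add: J_unit(2)[OF M])
  qed
qed

end

section \<open>The twisted action on homogeneous vectors\<close>

context fin_group
begin

text \<open>The action of \<open>f \<times> w\<close>, for a function \<open>f\<close> and an element \<open>w\<close> of \<open>kG\<close>.\<close>

lemma act_pure_homog:
  assumes M: "M \<in> dg_modules G" and v: "homog M a v" and f: "f \<in> vecs (carrier G)" and w: "w \<in> vecs (carrier G)"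
  shows "act M (pure f w) v = (\<Sum>s\<in>carrier G. (w s * f (s \<otimes> a \<otimes> inv s)) \<cdot>\<^sub>v gact M s v)"
proof -
  note a = homogD[OF v]
  have "act M (pure f w) v = (\<Sum>q\<in>GG. pure f w q \<cdot>\<^sub>v act M (ket q) v)"
    by (rule linear_between_expand[OF act_linear[OF M a(2)] finGG pure_vecs[OF f w]])
  also have "\<dots> = (\<Sum>z\<in>carrier G. \<Sum>s\<in>carrier G. (f z * w s) \<cdot>\<^sub>v act M (ket (z, s)) v)"
    by (simp add: sum.cartesian_product pure_app case_prod_beta' pure_def)
  also have "\<dots> = (\<Sum>s\<in>carrier G. \<Sum>z\<in>carrier G. (f z * w s) \<cdot>\<^sub>v act M (ket (z, s)) v)"
    by (rule sum.swap)
  also have "\<dots> = (\<Sum>s\<in>carrier G. (w s * f (s \<otimes> a \<otimes> inv s)) \<cdot>\<^sub>v gact M s v)"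
  proof (rule sum.cong[OF refl])
    fix s assume s: "s \<in> carrier G"
    have "(\<Sum>z\<in>carrier G. (f z * w s) \<cdot>\<^sub>v act M (ket (z, s)) v)
      = (\<Sum>z\<in>carrier G. if z = s \<otimes> a \<otimes> inv s then (f z * w s) \<cdot>\<^sub>v gact M s v else 0)"
      using s by (intro sum.cong) (auto simp: act_ket_homog[OF M v])
    then show "(\<Sum>z\<in>carrier G. (f z * w s) \<cdot>\<^sub>v act M (ket (z, s)) v) = (w s * f (s \<otimes> a \<otimes> inv s)) \<cdot>\<^sub>v gact M s v"
      using fin s a by (simp add: mult.commute)
  qed
  finally show ?thesis .
qed

end

context refl_datum
begin

lemma sum_parts: "(\<Sum>x\<in>carrier G. F x) = (\<Sum>h\<in>H. \<Sum>c\<in>C. F (h \<otimes> c))"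
  using sum.reindex_bij_betw[OF bij_HC, of F] by (simp add: sum.cartesian_product case_prod_beta')

lemma parts_conj:
  assumes "s \<in> carrier G" "a \<in> carrier G"
  shows "hp (s \<otimes> a \<otimes> inv s) = hp s \<otimes> hp a \<otimes> inv (hp s)" "cp (s \<otimes> a \<otimes> inv s) = cp a"
proof -
  show "hp (s \<otimes> a \<otimes> inv s) = hp s \<otimes> hp a \<otimes> inv (hp s)"
    using assms by (simp add: parts_hom parts_inv)
  have "cp (s \<otimes> a \<otimes> inv s) = cp a \<otimes> cp s \<otimes> inv (cp s)"
    using assms by (simp add: parts_hom parts_inv commute_CC[of "cp s" "cp a"])
  then show "cp (s \<otimes> a \<otimes> inv s) = cp a"
    using assms by (simp add: m_assoc)
qed

lemma act_reflection:
  fixes M :: "('g, 'k) dg_mod"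
  assumes M: "M \<in> dg_modules G" and v: "homog M a v" and xy: "x \<in> carrier G" "y \<in> carrier G"
  shows "act M (reflection G H C \<delta> (ket (x, y))) v =
    (if hp x = hp y \<otimes> hp a \<otimes> inv (hp y)
     then \<delta> (ket (cp y)) (cp a) \<cdot>\<^sub>v gact M (hp y) (\<Sum>d\<in>C. \<delta>i (ket (cp x)) d \<cdot>\<^sub>v gact M d v) else 0)"
proof -
  note a = homogD[OF v]
  let ?b = "if hp x = hp y \<otimes> hp a \<otimes> inv (hp y) then \<delta> (ket (cp y)) (cp a) else 0"
  have "act M (reflection G H C \<delta> (ket (x, y))) v = (\<Sum>h\<in>H. \<Sum>d\<in>C.
      (join G H C (ket (hp y)) (\<delta>i (ket (cp x))) (h \<otimes> d) *
       join G H C (ket (hp x)) (\<delta> (ket (cp y))) ((h \<otimes> d) \<otimes> a \<otimes> inv (h \<otimes> d))) \<cdot>\<^sub>v gact M (h \<otimes> d) v)"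
    by (simp add: reflection_ket[OF xy] act_pure_homog[OF M v join_vecs join_vecs] sum_parts)
  also have "\<dots> = (\<Sum>h\<in>H. if h = hp y then (\<Sum>d\<in>C. (\<delta>i (ket (cp x)) d * ?b) \<cdot>\<^sub>v gact M (h \<otimes> d) v) else 0)"
    using a by (intro sum.cong refl) (auto simp: join_app ket_app parts_conj intro!: sum.cong sum.neutral)
  also have "\<dots> = (\<Sum>d\<in>C. (\<delta>i (ket (cp x)) d * ?b) \<cdot>\<^sub>v gact M (hp y \<otimes> d) v)"
    using finHC xy by simp
  also have "\<dots> = ?b \<cdot>\<^sub>v (\<Sum>d\<in>C. \<delta>i (ket (cp x)) d \<cdot>\<^sub>v gact M (hp y) (gact M d v))"
    using xy a by (simp add: scl_sum mult.commute gact_comp[OF M])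
  also have "(\<Sum>d\<in>C. \<delta>i (ket (cp x)) d \<cdot>\<^sub>v gact M (hp y) (gact M d v))
      = gact M (hp y) (\<Sum>d\<in>C. \<delta>i (ket (cp x)) d \<cdot>\<^sub>v gact M d v)"
    using xy a linear_betweenD(3)[OF gact_linear[OF M, of "hp y"]]
    by (subst linear_between_sum[OF gact_linear[OF M, of "hp y"]])
      (auto simp: gact_vecs[OF M] vecs_scl intro!: sum.cong)
  finally show ?thesis by (auto simp: fun_eq_iff scl_app)
qed

text \<open>Summed over \<open>x\<close>, the combinations of the preceding lemma collapse, as \<open>\<delta>\<^sup>-\<^sup>1\<close> maps the constant function \<open>1\<close> to
  the unit of \<open>kC\<close>.\<close>

lemma act_reflection_grp_elt:
  fixes M :: "('g, 'k) dg_mod"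
  assumes M: "M \<in> dg_modules G" and v: "homog M a v" and y: "y \<in> carrier G"
  shows "act M (reflection G H C \<delta> (grp_elt y)) v = \<delta> (ket (cp y)) (cp a) \<cdot>\<^sub>v gact M (hp y) v"
proof -
  note a = homogD[OF v]
  let ?S = "\<lambda>c. \<Sum>d\<in>C. \<delta>i (ket c) d \<cdot>\<^sub>v gact M d v"
  have Sv: "?S c \<in> vecs (idx M)" for c
    using a by (auto intro!: vecs_sum vecs_scl gact_vecs[OF M])
  have "act M (reflection G H C \<delta> (grp_elt y)) v = (\<Sum>x\<in>carrier G. act M (reflection G H C \<delta> (ket (x, y))) v)"
    using y a by (simp add: grp_elt_sum linear_between_sum[OF lin_reflection] vecs_ket
        linear_between_sum[OF act_linear[OF M]] linear_betweenD(1)[OF lin_reflection])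
  also have "\<dots> = (\<Sum>h\<in>H. \<Sum>c\<in>C. if h = hp y \<otimes> hp a \<otimes> inv (hp y)
      then \<delta> (ket (cp y)) (cp a) \<cdot>\<^sub>v gact M (hp y) (?S c) else 0)"
    unfolding sum_parts using y a by (intro sum.cong refl) (simp add: act_reflection[OF M v])
  also have "\<dots> = (\<Sum>c\<in>C. \<Sum>h\<in>H. if h = hp y \<otimes> hp a \<otimes> inv (hp y)
      then \<delta> (ket (cp y)) (cp a) \<cdot>\<^sub>v gact M (hp y) (?S c) else 0)"
    by (rule sum.swap)
  also have "\<dots> = (\<Sum>c\<in>C. \<delta> (ket (cp y)) (cp a) \<cdot>\<^sub>v gact M (hp y) (?S c))"
    using finHC y a by simp
  also have "\<dots> = \<delta> (ket (cp y)) (cp a) \<cdot>\<^sub>v gact M (hp y) (\<Sum>c\<in>C. ?S c)"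
    using y Sv by (simp add: scl_sum linear_between_sum[OF gact_linear[OF M]])
  also have "(\<Sum>c\<in>C. ?S c) = (\<Sum>d\<in>C. (\<Sum>c\<in>C. \<delta>i (ket c) d) \<cdot>\<^sub>v gact M d v)"
    by (subst sum.swap) (simp add: sum_scl)
  also have "\<dots> = (\<Sum>d\<in>C. if d = \<one> then v else 0)"
    using a by (intro sum.cong) (auto simp: \<delta>i_unit ket_app gact_one[OF M])
  finally show ?thesis using finHC by simp
qed

lemma dagger_hopf_hom: "dagger G (reflection G H C \<delta>) \<in> hopf_hom (drinfeld G) (drinfeld G)"
  and dagger_involution: "a \<in> DV \<Longrightarrow> dagger G (reflection G H C \<delta>) (dagger G (reflection G H C \<delta>) a) = a"
proof -
  interpret T: refl_datum G H C "dual_map C C \<delta>"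
    by unfold_locales (rule transpose_datum)
  show "dagger G (reflection G H C \<delta>) \<in> hopf_hom (drinfeld G) (drinfeld G)"
    using T.reflection_hopf_hom by (simp add: dagger_reflection)
  show "dagger G (reflection G H C \<delta>) (dagger G (reflection G H C \<delta>) a) = a" if "a \<in> DV"
    using T.reflection_involution[OF that] by (simp add: dagger_reflection)
qed

end

section \<open>Simple objects\<close>

context fin_group
begin

lemma simple_objectD:
  assumes "is_simple_object G g B \<rho> M \<tau>"
  shows "g \<in> carrier G" "M \<in> dg_modules G"
    and "y \<in> carrier G \<Longrightarrow> linear_between B (idx M) (\<tau> y)"
    and "y \<in> carrier G \<Longrightarrow> z \<in> centralizer G g \<Longrightarrow> w \<in> vecs B \<Longrightarrow> \<tau> (y \<otimes> z) w = \<tau> y (\<rho> z w)"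
    and "y \<in> carrier G \<Longrightarrow> w \<in> vecs B \<Longrightarrow> homog M (y \<otimes> g \<otimes> inv y) (\<tau> y w)"
    and "t \<in> carrier G \<Longrightarrow> y \<in> carrier G \<Longrightarrow> w \<in> vecs B \<Longrightarrow> gact M t (\<tau> y w) = \<tau> (t \<otimes> y) w"
proof -
  show g: "g \<in> carrier G" and M: "M \<in> dg_modules G"
    using assms by (auto simp: is_simple_object_def)
  show lin: "linear_between B (idx M) (\<tau> y)" if "y \<in> carrier G" for y
    using assms that by (auto simp: is_simple_object_def is_induced_def balanced_def)
  show "\<tau> (y \<otimes> z) w = \<tau> y (\<rho> z w)" if "y \<in> carrier G" "z \<in> centralizer G g" "w \<in> vecs B" for y z w
    using assms that by (auto simp: is_simple_object_def is_induced_def balanced_def)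
  have act: "act M (ket (h, t)) (\<tau> y w) =
     (if h = (t \<otimes> y) \<otimes> g \<otimes> inv (t \<otimes> y) then \<tau> (t \<otimes> y) w else 0)"
    if "h \<in> carrier G" "t \<in> carrier G" "y \<in> carrier G" "w \<in> vecs B" for h t y w
    using assms that by (auto simp: is_simple_object_def)
  show hom: "homog M (y \<otimes> g \<otimes> inv y) (\<tau> y w)" if "y \<in> carrier G" "w \<in> vecs B" for y w
    using that g act[of "y \<otimes> g \<otimes> inv y" \<one> y w] linear_betweenD(1)[OF lin] by (simp add: homog_def)
  show "gact M t (\<tau> y w) = \<tau> (t \<otimes> y) w" if "t \<in> carrier G" "y \<in> carrier G" "w \<in> vecs B" for t y w
  proof -
    have e: "(t \<otimes> y) \<otimes> g \<otimes> inv (t \<otimes> y) = t \<otimes> (y \<otimes> g \<otimes> inv y) \<otimes> inv t"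
      using that g by (simp add: inv_mult_group m_assoc)
    show ?thesis
      using act_ket_homog[OF M hom[OF that(2,3)], of "t \<otimes> (y \<otimes> g \<otimes> inv y) \<otimes> inv t" t]
        act[of "t \<otimes> (y \<otimes> g \<otimes> inv y) \<otimes> inv t" t y w] that g e by simp
  qed
qed

text \<open>Linear maps on \<open>\<O>\<^sub>g\<^sup>\<rho>\<close> are determined by their values on the \<open>y \<otimes> w\<close>. That these span is hidden in the uniqueness
  part of the universal property.\<close>

lemma simple_object_eqI:
  assumes s: "is_simple_object G g B \<rho> M \<tau>" and f: "linear_between (idx M) (idx M) f"
    and f': "linear_between (idx M) (idx M) f'"
    and eq: "\<And>y w. y \<in> carrier G \<Longrightarrow> w \<in> vecs B \<Longrightarrow> f (\<tau> y w) = f' (\<tau> y w)" and v: "v \<in> vecs (idx M)"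
  shows "f v = f' v"
proof -
  note S = simple_objectD[OF s]
  have fin: "finite (idx M)" by (rule dg_modulesD(1)[OF S(2)])
  have ind: "is_induced G (centralizer G g) B \<rho> (idx M) \<tau>"
    using s by (simp add: is_simple_object_def)
  have tv: "\<tau> y w \<in> vecs (idx M)" if "y \<in> carrier G" "w \<in> vecs B" for y w
    by (rule linear_betweenD(1)[OF S(3)[OF that(1)] that(2)])
  have "balanced G (centralizer G g) B \<rho> (idx M) (\<lambda>y w. f (\<tau> y w))"
    using linear_between_comp[OF S(3) f] S(4) by (auto simp: balanced_def)
  then have "\<exists>!F. F \<in> lmaps (idx M) (idx M) \<and> (\<forall>y\<in>carrier G. \<forall>w\<in>vecs B. F (\<tau> y w) = f (\<tau> y w))"
    by (rule ind[unfolded is_induced_def, THEN conjunct2, rule_format, OF conjI[OF fin]])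
  moreover have "restrict f (vecs (idx M)) \<in> lmaps (idx M) (idx M)" "restrict f' (vecs (idx M)) \<in> lmaps (idx M) (idx M)"
    using f f' by (simp_all add: lmaps_def linear_between_restrict)
  ultimately have "restrict f (vecs (idx M)) = restrict f' (vecs (idx M))"
    using tv eq by (metis (no_types, lifting) restrict_apply')
  then show ?thesis
    using v by (metis restrict_apply')
qed

end

context refl_datum
begin

lemma char_one: "\<chi> \<in> chars G C \<Longrightarrow> \<chi> \<one> = 1"
proof -
  assume "\<chi> \<in> chars G C"
  then have "\<chi> \<one> * \<chi> \<one> = \<chi> \<one> * 1" "\<chi> \<one> \<noteq> 0"
    unfolding chars_def by (force, force)
  then show "\<chi> \<one> = 1" by simp
qed

lemma charsD: "\<chi> \<in> chars G C \<Longrightarrow> \<chi> \<in> vecs C"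
  "\<chi> \<in> chars G C \<Longrightarrow> c \<in> C \<Longrightarrow> d \<in> C \<Longrightarrow> \<chi> (c \<otimes> d) = \<chi> c * \<chi> d"
  by (auto simp: chars_def)

lemma \<delta>_char: "c \<in> C \<Longrightarrow> \<delta> (ket c) \<in> chars G C"
proof -
  assume c: "c \<in> C"
  have "\<delta> (ket c) x \<noteq> 0" if x: "x \<in> C" for x
  proof
    assume "\<delta> (ket c) x = 0"
    then have "\<delta> (ket c) (x \<otimes> inv x) = 0"
      using c x bichar(2)[of x "inv x" c] by simp
    then show False using c x by (simp add: bichar_one)
  qed
  then show ?thesis
    using c by (auto simp: chars_def \<delta>_vecs vecs_ket bichar)
qed

text \<open>Characters are group-like, so \<open>\<delta>\<^sup>-\<^sup>1\<close> maps them to group elements.\<close>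

lemma delta_inv:
  assumes \<chi>: "\<chi> \<in> chars G C"
  shows "delta_inv C \<delta> \<chi> \<in> C" "ket (delta_inv C \<delta> \<chi>) = \<delta>i \<chi>" "\<delta> (ket (delta_inv C \<delta> \<chi>)) = \<chi>"
proof -
  note ch = charsD[OF \<chi>]
  have C: "finite (carrier GC)" using finHC by simp
  have "bcomul (fun_alg GC) \<chi> = pure \<chi> \<chi>"
    using ch(2) vecs_out[OF ch(1)] by (auto simp: fun_eq_iff fun_alg_simps(2)[OF C groupC] pure_app)
  then have "bcomul (group_alg GC) (\<delta>i \<chi>) = pure (\<delta>i \<chi>) (\<delta>i \<chi>)"
    using hopf_homD(4)[OF hopf_\<delta>i, of \<chi>] ch(1) map_pure_pure[OF finHC(2,2) lin_\<delta>i lin_\<delta>i ch(1,1)] by simp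
  then have gl: "\<delta>i \<chi> x * \<delta>i \<chi> y = (if x \<in> C \<and> x = y then \<delta>i \<chi> x else 0)" for x y
    using fun_cong[of _ _ "(x, y)"] group_alg_simps(2)[OF C, of "\<delta>i \<chi>" x y] by (fastforce simp: pure_app)
  have "\<exists>d\<in>C. \<delta>i \<chi> d \<noteq> 0"
  proof (rule ccontr)
    assume "\<not> ?thesis"
    then have "\<delta>i \<chi> = 0"
      using vecs_out[OF \<delta>i_vecs[OF ch(1)]] by (auto simp: fun_eq_iff)
    then have "\<chi> = 0"
      using \<delta>_\<delta>i[OF ch(1)] linear_between_zero[OF lin_\<delta>] by simp
    then show False using char_one[OF \<chi>] by simp
  qed
  then obtain d where d: "d \<in> C" "\<delta>i \<chi> d \<noteq> 0" by blast
  have "\<delta>i \<chi> d = 1" using gl[of d d] d by simp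
  moreover have "\<delta>i \<chi> x = 0" if "x \<noteq> d" for x
    using gl[of x d] that d by simp
  ultimately have kd: "ket d = \<delta>i \<chi>"
    by (auto simp: fun_eq_iff ket_app)
  have "delta_inv C \<delta> \<chi> = d"
    unfolding delta_inv_def
  proof (rule the_equality)
    show "d \<in> C \<and> ket d = \<delta>i \<chi>" using d kd by simp
    fix e assume "e \<in> C \<and> ket e = \<delta>i \<chi>"
    then have "(ket e :: 'g \<Rightarrow> 'k) = ket d" using kd by simp
    then show "e = d" by (metis ket_app zero_neq_one)
  qed
  then show "delta_inv C \<delta> \<chi> \<in> C" "ket (delta_inv C \<delta> \<chi>) = \<delta>i \<chi>" "\<delta> (ket (delta_inv C \<delta> \<chi>)) = \<chi>"
    using d kd \<delta>_\<delta>i[OF ch(1)] by auto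
qed

lemma centralizer_parts:
  assumes "h \<in> H" "c \<in> C"
  shows "z \<in> centralizer G (h \<otimes> c) \<longleftrightarrow> z \<in> carrier G \<and> hp z \<in> centralizer GH h"
proof -
  have "z \<otimes> (h \<otimes> c) = (h \<otimes> c) \<otimes> z \<longleftrightarrow> hp z \<otimes> h = h \<otimes> hp z" if z: "z \<in> carrier G"
  proof -
    have e: "z \<otimes> (h \<otimes> c) = (hp z \<otimes> h) \<otimes> (cp z \<otimes> c)" "(h \<otimes> c) \<otimes> z = (h \<otimes> hp z) \<otimes> (cp z \<otimes> c)"
      using mult_parts[of "hp z" h "cp z" c] mult_parts[of h "hp z" c "cp z"] assms z
      by (simp_all add: parts_mult commute_CC)
    show ?thesis unfolding e using assms z by simp
  qed
  then show ?thesis by (auto simp: centralizer_def)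
qed

lemma irreducible_rep_join:
  fixes \<rho> :: "'g \<Rightarrow> 'k lmap"
  assumes hc: "h \<in> H" "c \<in> C" and \<chi>: "\<chi> \<in> chars G C"
    and \<rho>: "irreducible_rep (G\<lparr>carrier := centralizer GH h\<rparr>) B \<rho>"
  shows "irreducible_rep (G\<lparr>carrier := centralizer G (h \<otimes> c)\<rparr>) B (rep_join G H C \<rho> \<chi>)"
proof -
  have lin: "linear_between B B (\<rho> z)" if "z \<in> centralizer GH h" for z
    using \<rho> that by (auto simp: irreducible_rep_def)
  have one: "\<rho> \<one> v = v" if "v \<in> vecs B" for v
    using \<rho> that by (auto simp: irreducible_rep_def)
  have mult: "\<rho> (y \<otimes> z) v = \<rho> y (\<rho> z v)"
    if "y \<in> centralizer GH h" "z \<in> centralizer GH h" "v \<in> vecs B" for y z v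
    using \<rho> that by (auto simp: irreducible_rep_def)
  have sub: "U = {0} \<or> U = vecs B"
    if U: "U \<subseteq> vecs B" "module.subspace scl U" "\<forall>z\<in>centralizer G (h \<otimes> c). rep_join G H C \<rho> \<chi> z ` U \<subseteq> U" for U
  proof -
    have "\<rho> z ` U \<subseteq> U" if z: "z \<in> centralizer GH h" for z
    proof -
      have zH: "z \<in> H" using z by (simp add: centralizer_def)
      have "z \<in> centralizer G (h \<otimes> c)" using z zH hc by (simp add: centralizer_parts)
      moreover have "rep_join G H C \<rho> \<chi> z = \<rho> z"
        using zH char_one[OF \<chi>] by (simp add: fun_eq_iff rep_join_def)
      ultimately show ?thesis using U(3) by fastforce
    qed
    then show ?thesis using \<rho> U(1,2) by (auto simp: irreducible_rep_def)
  qed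
  show ?thesis
    unfolding irreducible_rep_def
  proof (intro conjI ballI allI impI)
    show "finite B" "B \<noteq> {}" using \<rho> by (auto simp: irreducible_rep_def)
  next
    fix z assume "z \<in> carrier (G\<lparr>carrier := centralizer G (h \<otimes> c)\<rparr>)"
    then show "linear_between B B (rep_join G H C \<rho> \<chi> z)"
      using lin[of "hp z"] hc by (auto simp: rep_join_def[abs_def] centralizer_parts intro!: linear_between_scl_fun)
  next
    fix v :: "nat \<Rightarrow> 'k" assume "v \<in> vecs B"
    then show "rep_join G H C \<rho> \<chi> \<one>\<^bsub>G\<lparr>carrier := centralizer G (h \<otimes> c)\<rparr>\<^esub> v = v"
      using one char_one[OF \<chi>] by (simp add: rep_join_def)
  next
    fix y z and v :: "nat \<Rightarrow> 'k"
    assume "y \<in> carrier (G\<lparr>carrier := centralizer G (h \<otimes> c)\<rparr>)"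
      "z \<in> carrier (G\<lparr>carrier := centralizer G (h \<otimes> c)\<rparr>)" and v: "v \<in> vecs B"
    then have y: "y \<in> carrier G" "hp y \<in> centralizer GH h" and z: "z \<in> carrier G" "hp z \<in> centralizer GH h"
      using hc by (auto simp: centralizer_parts)
    show "rep_join G H C \<rho> \<chi> (y \<otimes>\<^bsub>G\<lparr>carrier := centralizer G (h \<otimes> c)\<rparr>\<^esub> z) v = rep_join G H C \<rho> \<chi> y (rep_join G H C \<rho> \<chi> z v)"
      using y z v charsD(2)[OF \<chi>, of "cp y" "cp z"] mult[OF y(2) z(2) v]
        linear_betweenD(3)[OF lin[OF y(2)] linear_betweenD(1)[OF lin[OF z(2)] v]]
      by (simp add: rep_join_def parts_hom)
  next
    fix U :: "(nat \<Rightarrow> 'k) set"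
    assume "U \<subseteq> vecs B \<and> module.subspace scl U \<and>
      (\<forall>z\<in>carrier (G\<lparr>carrier := centralizer G (h \<otimes> c)\<rparr>). rep_join G H C \<rho> \<chi> z ` U \<subseteq> U)"
    then show "U = {0} \<or> U = vecs B" using sub by simp
  qed
qed

lemma balanced_split:
  fixes \<rho> :: "'g \<Rightarrow> 'k lmap"
  assumes "balanced G (centralizer G (h \<otimes> c)) B (rep_join G H C \<rho> \<chi>) V \<tau>"
    and hc: "h \<in> H" "c \<in> C" and one: "\<And>w. w \<in> vecs B \<Longrightarrow> \<rho> \<one> w = w"
    and y: "y \<in> carrier G" and w: "w \<in> vecs B"
  shows "\<tau> y w = \<chi> (cp y) \<cdot>\<^sub>v \<tau> (hp y) w"
proof -
  have "\<one> \<in> centralizer GH h" using hc by (simp add: centralizer_def)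
  then have z: "cp y \<in> centralizer G (h \<otimes> c)" using y hc by (simp add: centralizer_parts)
  have "\<tau> (hp y \<otimes> cp y) w = \<tau> (hp y) (rep_join G H C \<rho> \<chi> (cp y) w)"
    using assms(1) z y w unfolding balanced_def by (meson HG parts(1))
  also have "\<dots> = \<tau> (hp y) (\<chi> (cp y) \<cdot>\<^sub>v w)"
    using y w by (simp add: rep_join_def one)
  also have "\<dots> = \<chi> (cp y) \<cdot>\<^sub>v \<tau> (hp y) w"
    using assms(1) y w unfolding balanced_def by (meson HG parts(1) linear_betweenD(3))
  finally show ?thesis using y by (simp add: parts_mult)
qed

text \<open>On a balanced map the character of \<open>C\<close> can be exchanged, because \<open>G = H \<times> C\<close> and the centralizers of \<open>hc\<close> and
  \<open>hc'\<close> coincide. This transports both the module and the test objects of the universal property.\<close>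

lemma balanced_change_char:
  fixes \<rho> :: "'g \<Rightarrow> 'k lmap"
  assumes bal: "balanced G (centralizer G (h \<otimes> c)) B (rep_join G H C \<rho> \<chi>) V \<tau>"
    and h: "h \<in> H" and c: "c \<in> C" "c' \<in> C" and \<chi>: "\<chi> \<in> chars G C" "\<chi>' \<in> chars G C"
    and lin: "\<And>z. z \<in> centralizer GH h \<Longrightarrow> linear_between B B (\<rho> z)"
  shows "balanced G (centralizer G (h \<otimes> c')) B (rep_join G H C \<rho> \<chi>') V (\<lambda>y w. \<chi>' (cp y) \<cdot>\<^sub>v \<tau> (hp y) w)"
  unfolding balanced_def
proof (intro conjI ballI)
  fix y assume y: "y \<in> carrier G"
  have lt: "linear_between B V (\<tau> (hp y))" using bal y by (simp add: balanced_def)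
  show "linear_between B V (\<lambda>w. \<chi>' (cp y) \<cdot>\<^sub>v \<tau> (hp y) w)"
    by (rule linear_between_scl_fun[OF lt])
  fix z and w :: "nat \<Rightarrow> 'k" assume z: "z \<in> centralizer G (h \<otimes> c')" and w: "w \<in> vecs B"
  have z': "z \<in> carrier G" "hp z \<in> centralizer GH h"
    using z h c by (auto simp: centralizer_parts)
  have hz: "hp z \<in> centralizer G (h \<otimes> c)"
    using z' h c by (simp add: centralizer_parts)
  have rw: "\<rho> (hp z) w \<in> vecs B" by (rule linear_betweenD(1)[OF lin[OF z'(2)] w])
  have "\<tau> (hp y \<otimes> hp z) w = \<tau> (hp y) (rep_join G H C \<rho> \<chi> (hp z) w)"
    using bal hz y w unfolding balanced_def by (meson HG parts(1))
  then have "\<tau> (hp y \<otimes> hp z) w = \<tau> (hp y) (\<rho> (hp z) w)"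
    using z' char_one[OF \<chi>(1)] by (simp add: rep_join_def)
  then show "\<chi>' (cp (y \<otimes> z)) \<cdot>\<^sub>v \<tau> (hp (y \<otimes> z)) w = \<chi>' (cp y) \<cdot>\<^sub>v \<tau> (hp y) (rep_join G H C \<rho> \<chi>' z w)"
    using y z' charsD(2)[OF \<chi>(2), of "cp y" "cp z"] linear_betweenD(3)[OF lt rw]
    by (simp add: parts_hom rep_join_def)
qed

lemma split_simpleD:
  fixes \<rho> :: "'g \<Rightarrow> 'k lmap"
  assumes "is_split_simple G H C h c B \<rho> \<chi> M \<tau>"
  shows "h \<in> H" "c \<in> C" "\<chi> \<in> chars G C" "is_simple_object G (h \<otimes> c) B (rep_join G H C \<rho> \<chi>) M \<tau>"
    and "w \<in> vecs B \<Longrightarrow> \<rho> \<one> w = w"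
    and "y \<in> carrier G \<Longrightarrow> w \<in> vecs B \<Longrightarrow> \<tau> y w = \<chi> (cp y) \<cdot>\<^sub>v \<tau> (hp y) w"
    and "d \<in> C \<Longrightarrow> y \<in> carrier G \<Longrightarrow> w \<in> vecs B \<Longrightarrow> \<tau> (d \<otimes> y) w = \<chi> d \<cdot>\<^sub>v \<tau> y w"
proof -
  show hc: "h \<in> H" "c \<in> C" and \<chi>: "\<chi> \<in> chars G C"
    and s: "is_simple_object G (h \<otimes> c) B (rep_join G H C \<rho> \<chi>) M \<tau>"
    using assms by (auto simp: is_split_simple_def)
  show one: "\<rho> \<one> w = w" if "w \<in> vecs B" for w
    using assms that by (auto simp: is_split_simple_def irreducible_rep_def)
  have bal: "balanced G (centralizer G (h \<otimes> c)) B (rep_join G H C \<rho> \<chi>) (idx M) \<tau>"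
    using s by (simp add: is_simple_object_def is_induced_def)
  show sp: "\<tau> y w = \<chi> (cp y) \<cdot>\<^sub>v \<tau> (hp y) w" if "y \<in> carrier G" "w \<in> vecs B" for y w
    by (rule balanced_split[OF bal hc one that])
  show "\<tau> (d \<otimes> y) w = \<chi> d \<cdot>\<^sub>v \<tau> y w" if "d \<in> C" "y \<in> carrier G" "w \<in> vecs B" for d y w
    using sp[of "d \<otimes> y" w] sp[of y w] that charsD(2)[OF \<chi>, of d "cp y"] by (simp add: parts_hom)
qed

text \<open>The space of \<open>F\<^sub>r(\<O>\<^bsub>hc\<^esub>)\<close> is that of \<open>\<O>\<^bsub>hc\<^esub>\<close>; it is induced from the new representation along
  \<open>\<tau>'(y, w) = \<delta>(c)(y\<^sub>C) \<tau>(y\<^sub>H, w)\<close>.\<close>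

lemma split_simple_twist:
  fixes \<rho> :: "'g \<Rightarrow> 'k lmap"
  assumes s: "is_split_simple G H C h c B \<rho> \<chi> M \<tau>"
  defines "\<tau>' \<equiv> \<lambda>y w. \<delta> (ket c) (cp y) \<cdot>\<^sub>v \<tau> (hp y) w"
  shows "is_split_simple G H C h (delta_inv C \<delta> \<chi>) B \<rho> (\<delta> (ket c)) (twist (dagger G (reflection G H C \<delta>)) M) \<tau>'"
    and "\<forall>y\<in>H. \<forall>w\<in>vecs B. \<tau>' y w = \<tau> y w"
proof -
  interpret T: refl_datum G H C "dual_map C C \<delta>"
    by unfold_locales (rule transpose_datum)
  note S = split_simpleD[OF s] and SO = simple_objectD[OF split_simpleD(4)[OF s]]
  note hc = S(1,2) and \<chi> = S(3) and M = SO(2)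
  define d where "d = delta_inv C \<delta> \<chi>"
  have d: "d \<in> C" "\<delta>i \<chi> = ket d" using delta_inv[OF \<chi>] by (simp_all add: d_def)
  let ?M = "twist (dagger G (reflection G H C \<delta>)) M" and ?\<chi> = "\<delta> (ket c)"
  have \<chi>': "?\<chi> \<in> chars G C" by (rule \<delta>_char[OF hc(2)])
  have irr: "irreducible_rep (G\<lparr>carrier := centralizer GH h\<rparr>) B \<rho>"
    using s by (simp add: is_split_simple_def)
  have lin: "linear_between B B (\<rho> z)" if "z \<in> centralizer GH h" for z
    using irr that by (simp add: irreducible_rep_def)
  have ind: "is_induced G (centralizer G (h \<otimes> c)) B (rep_join G H C \<rho> \<chi>) (idx M) \<tau>"
    using S(4) by (simp add: is_simple_object_def)
  have bal: "balanced G (centralizer G (h \<otimes> c)) B (rep_join G H C \<rho> \<chi>) (idx M) \<tau>"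
    using ind by (simp add: is_induced_def)
  have bal': "balanced G (centralizer G (h \<otimes> d)) B (rep_join G H C \<rho> ?\<chi>) (idx M) \<tau>'"
    unfolding \<tau>'_def by (rule balanced_change_char[OF bal hc(1) hc(2) d(1) \<chi> \<chi>' lin])
  have \<tau>'_H: "\<tau>' y w = \<tau> y w" if "y \<in> H" for y w
    using that hc by (simp add: \<tau>'_def bichar_one)
  then show "\<forall>y\<in>H. \<forall>w\<in>vecs B. \<tau>' y w = \<tau> y w" by blast
  have tv: "\<tau> y w \<in> vecs (idx M)" if "y \<in> carrier G" "w \<in> vecs B" for y w
    by (rule linear_betweenD(1)[OF SO(3)[OF that(1)] that(2)])
  have univ: "\<exists>!f. f \<in> lmaps (idx M) Y \<and> (\<forall>y\<in>carrier G. \<forall>w\<in>vecs B. f (\<tau>' y w) = \<beta> y w)"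
    if Y: "finite Y" and \<beta>: "balanced G (centralizer G (h \<otimes> d)) B (rep_join G H C \<rho> ?\<chi>) Y \<beta>" for Y \<beta>
  proof -
    define \<beta>' where "\<beta>' = (\<lambda>y w. \<chi> (cp y) \<cdot>\<^sub>v \<beta> (hp y) w)"
    have "balanced G (centralizer G (h \<otimes> c)) B (rep_join G H C \<rho> \<chi>) Y \<beta>'"
      unfolding \<beta>'_def by (rule balanced_change_char[OF \<beta> hc(1) d(1) hc(2) \<chi>' \<chi> lin])
    then have ex1: "\<exists>!f. f \<in> lmaps (idx M) Y \<and> (\<forall>y\<in>carrier G. \<forall>w\<in>vecs B. f (\<tau> y w) = \<beta>' y w)"
      using ind Y unfolding is_induced_def by blast
    \<comment> \<open>both conditions only concern \<open>y \<in> H\<close>, where the two inducing maps agree\<close>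
    have iff: "(\<forall>y\<in>carrier G. \<forall>w\<in>vecs B. f (\<tau>' y w) = \<beta> y w) \<longleftrightarrow> (\<forall>y\<in>carrier G. \<forall>w\<in>vecs B. f (\<tau> y w) = \<beta>' y w)"
      if f: "f \<in> lmaps (idx M) Y" for f
    proof -
      have fl: "linear_between (idx M) Y f" using f by (simp add: lmaps_def)
      note fs = linear_betweenD(3)[OF fl]
      have "(\<forall>y\<in>carrier G. \<forall>w\<in>vecs B. f (\<tau>' y w) = \<beta> y w) \<longleftrightarrow> (\<forall>y\<in>H. \<forall>w\<in>vecs B. f (\<tau> y w) = \<beta> y w)"
      proof (intro iffI ballI)
        fix y and w :: "nat \<Rightarrow> 'k" assume "\<forall>y\<in>carrier G. \<forall>w\<in>vecs B. f (\<tau>' y w) = \<beta> y w" "y \<in> H" "w \<in> vecs B"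
        then show "f (\<tau> y w) = \<beta> y w" using \<tau>'_H by (metis HG)
      next
        fix y and w :: "nat \<Rightarrow> 'k" assume a: "\<forall>y\<in>H. \<forall>w\<in>vecs B. f (\<tau> y w) = \<beta> y w" "y \<in> carrier G" "w \<in> vecs B"
        have "f (\<tau>' y w) = ?\<chi> (cp y) \<cdot>\<^sub>v f (\<tau> (hp y) w)"
          unfolding \<tau>'_def using a(2,3) by (intro fs tv) auto
        then show "f (\<tau>' y w) = \<beta> y w"
          using a balanced_split[OF \<beta> hc(1) d(1) S(5) a(2,3)] by simp
      qed
      also have "\<dots> \<longleftrightarrow> (\<forall>y\<in>carrier G. \<forall>w\<in>vecs B. f (\<tau> y w) = \<beta>' y w)"
      proof (intro iffI ballI)
        fix y and w :: "nat \<Rightarrow> 'k" assume a: "\<forall>y\<in>H. \<forall>w\<in>vecs B. f (\<tau> y w) = \<beta> y w" "y \<in> carrier G" "w \<in> vecs B"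
        have "f (\<tau> y w) = \<chi> (cp y) \<cdot>\<^sub>v f (\<tau> (hp y) w)"
          using a(2,3) by (subst S(6)[OF a(2,3)]) (intro fs tv, auto)
        then show "f (\<tau> y w) = \<beta>' y w" using a by (simp add: \<beta>'_def)
      next
        fix y and w :: "nat \<Rightarrow> 'k" assume a: "\<forall>y\<in>carrier G. \<forall>w\<in>vecs B. f (\<tau> y w) = \<beta>' y w" "y \<in> H" "w \<in> vecs B"
        then show "f (\<tau> y w) = \<beta> y w" by (simp add: \<beta>'_def char_one[OF \<chi>])
      qed
      finally show ?thesis .
    qed
    show ?thesis
    proof (rule ex1E[OF ex1])
      fix f assume f: "f \<in> lmaps (idx M) Y \<and> (\<forall>y\<in>carrier G. \<forall>w\<in>vecs B. f (\<tau> y w) = \<beta>' y w)"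
        and uniq: "\<forall>f'. f' \<in> lmaps (idx M) Y \<and> (\<forall>y\<in>carrier G. \<forall>w\<in>vecs B. f' (\<tau> y w) = \<beta>' y w) \<longrightarrow> f' = f"
      show ?thesis
      proof (rule ex1I[of _ f])
        show "f \<in> lmaps (idx M) Y \<and> (\<forall>y\<in>carrier G. \<forall>w\<in>vecs B. f (\<tau>' y w) = \<beta> y w)"
          using f iff[of f] by simp
        fix f' assume "f' \<in> lmaps (idx M) Y \<and> (\<forall>y\<in>carrier G. \<forall>w\<in>vecs B. f' (\<tau>' y w) = \<beta> y w)"
        then show "f' = f" using uniq iff[of f'] by simp
      qed
    qed
  qed
  have act: "act ?M (ket (x, t)) (\<tau>' y w) =
      (if x = (t \<otimes> y) \<otimes> (h \<otimes> d) \<otimes> inv (t \<otimes> y) then \<tau>' (t \<otimes> y) w else 0)"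
    if x: "x \<in> carrier G" and t: "t \<in> carrier G" and y: "y \<in> carrier G" and w: "w \<in> vecs B" for x t y w
  proof -
    let ?a = "hp y \<otimes> (h \<otimes> c) \<otimes> inv (hp y)"
    have hom: "homog M ?a (\<tau> (hp y) w)" using y by (intro SO(5) w) simp
    have ca: "hp ?a = hp y \<otimes> h \<otimes> inv (hp y)" "cp ?a = c"
      using parts_conj[of "hp y" "h \<otimes> c"] y hc by simp_all
    have sum: "(\<Sum>e\<in>C. T.\<delta>i (ket (cp x)) e \<cdot>\<^sub>v gact M e (\<tau> (hp y) w)) = ket d (cp x) \<cdot>\<^sub>v \<tau> (hp y) w"
    proof -
      have "(\<Sum>e\<in>C. T.\<delta>i (ket (cp x)) e \<cdot>\<^sub>v gact M e (\<tau> (hp y) w))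
         = (\<Sum>e\<in>C. (\<chi> e * \<delta>i (ket e) (cp x)) \<cdot>\<^sub>v \<tau> (hp y) w)"
        using x y w by (intro sum.cong refl)
          (simp add: transpose_the_inv vecs_ket transpose_ket SO(6) S(7) mult.commute)
      also have "\<dots> = ket d (cp x) \<cdot>\<^sub>v \<tau> (hp y) w"
        using \<delta>i_sum[OF charsD(1)[OF \<chi>], of "cp x"] by (simp add: sum_scl[symmetric] d(2))
      finally show ?thesis .
    qed
    have key: "x = (t \<otimes> y) \<otimes> (h \<otimes> d) \<otimes> inv (t \<otimes> y) \<longleftrightarrow>
        hp x = hp t \<otimes> (hp y \<otimes> h \<otimes> inv (hp y)) \<otimes> inv (hp t) \<and> cp x = d"
    proof -
      let ?b = "(t \<otimes> y) \<otimes> (h \<otimes> d) \<otimes> inv (t \<otimes> y)"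
      have b: "?b \<in> carrier G" using t y hc d by simp
      have "hp ?b = hp t \<otimes> (hp y \<otimes> h \<otimes> inv (hp y)) \<otimes> inv (hp t)" "cp ?b = d"
        using parts_conj[of "t \<otimes> y" "h \<otimes> d"] t y hc d by (simp_all add: parts_hom inv_mult_group m_assoc)
      then show ?thesis using parts_eqI[OF x b] by auto
    qed
    have "act ?M (ket (x, t)) (\<tau>' y w) = ?\<chi> (cp y) \<cdot>\<^sub>v act M (reflection G H C (dual_map C C \<delta>) (ket (x, t))) (\<tau> (hp y) w)"
      unfolding \<tau>'_def twist_simps dagger_reflection using x t y w
      by (intro linear_betweenD(3)[OF dg_modulesD(2)[OF M]] linear_betweenD(1)[OF T.lin_reflection] vecs_ket tv) auto
    also have "\<dots> = (if hp x = hp t \<otimes> hp ?a \<otimes> inv (hp t)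
       then (?\<chi> (cp y) * ?\<chi> (cp t)) \<cdot>\<^sub>v gact M (hp t) (ket d (cp x) \<cdot>\<^sub>v \<tau> (hp y) w) else 0)"
      using t hc by (simp add: T.act_reflection[OF M hom x t] sum ca(2) transpose_ket)
    also have "gact M (hp t) (ket d (cp x) \<cdot>\<^sub>v \<tau> (hp y) w) = ket d (cp x) \<cdot>\<^sub>v \<tau> (hp t \<otimes> hp y) w"
      using t y w linear_betweenD(3)[OF gact_linear[OF M, of "hp t"] tv[of "hp y" w]] by (simp add: SO(6))
    finally have L: "act ?M (ket (x, t)) (\<tau>' y w) = (if hp x = hp t \<otimes> hp ?a \<otimes> inv (hp t)
       then (?\<chi> (cp y) * ?\<chi> (cp t)) \<cdot>\<^sub>v (ket d (cp x) \<cdot>\<^sub>v \<tau> (hp t \<otimes> hp y) w) else 0)" .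
    have kd: "ket d (cp x) = (if cp x = d then 1 else 0 :: 'k)" by (simp add: ket_app)
    have R: "\<tau>' (t \<otimes> y) w = (?\<chi> (cp y) * ?\<chi> (cp t)) \<cdot>\<^sub>v \<tau> (hp t \<otimes> hp y) w"
      using t y hc bichar(2)[of "cp t" "cp y" c] by (simp add: \<tau>'_def parts_hom mult.commute)
    show ?thesis
      unfolding L R key ca(1) kd by (cases "cp x = d") simp_all
  qed
  show "is_split_simple G H C h (delta_inv C \<delta> \<chi>) B \<rho> ?\<chi> ?M \<tau>'"
    unfolding is_split_simple_def is_simple_object_def is_induced_def d_def[symmetric]
    using hc d(1) \<chi>' irr irreducible_rep_join[OF hc(1) d(1) \<chi>' irr] twist_module[OF dagger_hopf_hom M] bal' univ act
    by simp
qed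

end

section \<open>The monoidal structure on simple objects\<close>

context central_hom
begin

text \<open>The central pairing \<open>\<lambda>(g, f) = f(p(g))\<close>, extended linearly.\<close>

definition pairing :: "('g \<Rightarrow> 'k::field) \<Rightarrow> ('g \<Rightarrow> 'k) \<Rightarrow> 'k" where
  "pairing = (\<lambda>a f. \<Sum>g\<in>carrier G. a g * f (p g))"

lemma pairing_ket: "g \<in> carrier G \<Longrightarrow> pairing (ket g) (ket x) = (if x = p g then 1 else 0)"
  using fin by (auto simp: pairing_def sum_ket_mult) (auto simp: ket_app)

lemma sigma_pairing: "pairing_cocycle G pairing = sigma"
  by (simp add: sigma_def pairing_def)

lemma J_simple_objects:
  fixes M N :: "('g, 'k::field) dg_mod"
  assumes s: "is_simple_object G g B \<rho> M \<tau>" and s': "is_simple_object G g' B' \<rho>' N \<tau>'"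
    and S: "left_transversal G (centralizer G g) S"
    and x: "x \<in> carrier G" and t: "t \<in> carrier G" and v: "v \<in> vecs B" and w: "w \<in> vecs B'"
  shows "J M N (\<tau> x v \<otimes>\<^sub>v \<tau>' t w) = (\<Sum>i\<in>S. \<Sum>z\<in>centralizer G g.
     pairing (ket (t \<otimes> g' \<otimes> inv t)) (ket (i \<otimes> z \<otimes> inv x)) \<cdot>\<^sub>v (\<tau> i (\<rho> z v) \<otimes>\<^sub>v \<tau>' t w))"
proof -
  note O = simple_objectD[OF s] and O' = simple_objectD[OF s']
  let ?k = "t \<otimes> g' \<otimes> inv t"
  have k: "?k \<in> carrier G" using t O'(1) by simp
  let ?y = "p ?k \<otimes> x"
  have y: "?y \<in> carrier G" using k x by simp
  have SG: "i \<in> carrier G" if "i \<in> S" for i using S that by (auto simp: left_transversal_def)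
  have finS: "finite S" and finZ: "finite (centralizer G g)"
    using S fin by (auto simp: left_transversal_def centralizer_def intro: finite_subset)
  \<comment> \<open>in the double sum only the term with \<open>iz = p(k)x\<close> survives, and the transversal provides exactly one\<close>
  obtain i0 where i0: "i0 \<in> S" "?y \<in> i0 <# centralizer G g"
      and uniq: "\<And>i. i \<in> S \<Longrightarrow> ?y \<in> i <# centralizer G g \<Longrightarrow> i = i0"
    using S y unfolding left_transversal_def by metis
  from i0(2) obtain z0 where z0: "z0 \<in> centralizer G g" "?y = i0 \<otimes> z0"
    by (auto simp: l_coset_def)
  have zG: "z \<in> carrier G" if "z \<in> centralizer G g" for z using that by (simp add: centralizer_def)
  have iff: "i \<otimes> z \<otimes> inv x = p ?k \<longleftrightarrow> i = i0 \<and> z = z0" if i: "i \<in> S" and z: "z \<in> centralizer G g" for i z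
  proof
    assume "i \<otimes> z \<otimes> inv x = p ?k"
    then have e: "i \<otimes> z = ?y"
      using SG[OF i] zG[OF z] x k by (metis inv_solve_right m_closed p_carrier)
    then have "?y \<in> i <# centralizer G g" using z unfolding l_coset_def by (metis UN_I insertI1)
    then have "i = i0" by (rule uniq[OF i])
    moreover have "z = z0"
      using e z0(2) SG[OF i0(1)] zG[OF z] zG[OF z0(1)] \<open>i = i0\<close> by simp
    ultimately show "i = i0 \<and> z = z0" by simp
  next
    assume "i = i0 \<and> z = z0"
    then have "i \<otimes> z = ?y" using z0 by simp
    then show "i \<otimes> z \<otimes> inv x = p ?k" using x k by (simp add: m_assoc)
  qed
  have "J M N (\<tau> x v \<otimes>\<^sub>v \<tau>' t w) = \<tau> ?y v \<otimes>\<^sub>v \<tau>' t w"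
    using J_vtens[OF O(2) O'(2) _ O'(5)[OF t w]] linear_betweenD(1)[OF O(3)[OF x] v] O(6)[of "p ?k" x v] x k v
    by simp
  also have "\<dots> = \<tau> i0 (\<rho> z0 v) \<otimes>\<^sub>v \<tau>' t w"
    using O(4)[OF SG[OF i0(1)] z0(1) v] z0(2) by simp
  also have "\<dots> = (\<Sum>i\<in>S. if i = i0 then \<Sum>z\<in>centralizer G g. if z = z0 then \<tau> i0 (\<rho> z0 v) \<otimes>\<^sub>v \<tau>' t w else 0 else 0)"
    using finS finZ i0(1) z0(1) by simp
  also have "\<dots> = (\<Sum>i\<in>S. \<Sum>z\<in>centralizer G g.
     pairing (ket ?k) (ket (i \<otimes> z \<otimes> inv x)) \<cdot>\<^sub>v (\<tau> i (\<rho> z v) \<otimes>\<^sub>v \<tau>' t w))"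
    using iff by (auto simp: pairing_ket[OF k] intro!: sum.cong)
  finally show ?thesis .
qed

end

section \<open>Pairings attached to a decomposition\<close>

text \<open>A reflection together with a central pairing.\<close>

locale refl_pairing = refl_datum G H C \<delta> + central_hom G p
  for G :: "('g, 'm) monoid_scheme" (structure) and H C :: "'g set" and \<delta> :: "('g \<Rightarrow> 'k::field) \<Rightarrow> 'g \<Rightarrow> 'k"
    and p :: "'g \<Rightarrow> 'g"

context refl_datum
begin

lemma central_hom_cp: "central_hom G cp"
  by unfold_locales (auto simp: hom_def group_center_def parts_hom central)

text \<open>The condition on the pairing says that its homomorphism is the projection to \<open>C\<close>.\<close>

lemma lazy_pairing_iff:
  assumes "central_hom G p"
  shows "is_lazy_reflection_pairing G H C (central_hom.pairing G p :: ('g \<Rightarrow> 'k) \<Rightarrow> _) \<longleftrightarrow>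
    (\<forall>g\<in>carrier G. p g = cp g)"
proof -
  interpret P: central_hom G p by (rule assms)
  have ct: "bcounit (group_alg G) (ket h) = (1 :: 'k)" "bcounit (fun_alg G) (ket h) = (if h = \<one> then 1 else 0 :: 'k)"
    if "h \<in> H" for h
    using that fin is_group by (auto simp: group_alg_simps fun_alg_simps ket_app)
  show ?thesis
  proof
    assume L: "is_lazy_reflection_pairing G H C (P.pairing :: ('g \<Rightarrow> 'k) \<Rightarrow> _)"
    show "\<forall>g\<in>carrier G. p g = cp g"
    proof
      fix g assume g: "g \<in> carrier G"
      have "P.pairing (ket (hp g \<otimes> cp g)) (ket (hp (p g) \<otimes> cp (p g))) =
         (if cp g = cp (p g) then 1 else 0) * bcounit (group_alg G) (ket (hp g)) * (bcounit (fun_alg G) (ket (hp (p g))) :: 'k)"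
        using L g unfolding is_lazy_reflection_pairing_def by simp
      then have "cp g = cp (p g) \<and> hp (p g) = \<one>"
        using g by (auto simp: parts_mult P.pairing_ket ct split: if_splits)
      then show "p g = cp g" using g parts_mult[of "p g"] by simp
    qed
  next
    assume eq: "\<forall>g\<in>carrier G. p g = cp g"
    have "h' \<otimes> c' = c \<longleftrightarrow> c = c' \<and> h' = \<one>" if "h' \<in> H" "c \<in> C" "c' \<in> C" for h' c c'
      using that parts_of[of h' c'] parts_own(3,4)[of c] by (metis CG l_one)
    then show "is_lazy_reflection_pairing G H C (P.pairing :: ('g \<Rightarrow> 'k) \<Rightarrow> _)"
      unfolding is_lazy_reflection_pairing_def using eq by (auto simp: P.pairing_ket ct)
  qed
qed

lemma lazy_reflections_iff:
  "(reflection G H C \<delta>, l) \<in> lazy_reflections G \<longleftrightarrow> l \<in> central_pairings G \<and> is_lazy_reflection_pairing G H C l"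
proof
  assume "(reflection G H C \<delta>, l) \<in> lazy_reflections G"
  then obtain H' C' \<delta>' where *: "is_reflection_datum G H' C' \<delta>'" "reflection G H' C' \<delta>' = reflection G H C \<delta>"
    "l \<in> central_pairings G" "is_lazy_reflection_pairing G H' C' l"
    by (auto simp: lazy_reflections_def)
  then show "l \<in> central_pairings G \<and> is_lazy_reflection_pairing G H C l"
    using reflection_determines(1,2)[OF *(1,2)] by simp
qed (use datum in \<open>auto simp: lazy_reflections_def\<close>)

lemma central_pairings_iff:
  "l \<in> central_pairings G \<longleftrightarrow> (\<exists>p. central_hom G p \<and> l = central_hom.pairing G p)"
proof -
  have ch: "central_hom G p \<longleftrightarrow> p \<in> hom G (G\<lparr>carrier := group_center G\<rparr>)" for p
    using central_hom.hom_p central_hom.intro[OF fin_group_axioms central_hom_axioms.intro] by blast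
  have "l = central_hom.pairing G p \<longleftrightarrow> l = (\<lambda>a f. \<Sum>g\<in>carrier G. a g * f (p g))" if "central_hom G p" for p
    by (simp add: central_hom.pairing_def[OF that])
  then show ?thesis
    unfolding central_pairings_def using ch by blast
qed

lemma lazy_pairing_unique:
  "\<exists>!l. l \<in> central_pairings G \<and> (reflection G H C \<delta>, l) \<in> lazy_reflections G"
proof (rule ex1I)
  interpret P: central_hom G cp by (rule central_hom_cp)
  show "P.pairing \<in> central_pairings G \<and> (reflection G H C \<delta>, P.pairing) \<in> lazy_reflections G"
    unfolding lazy_reflections_iff central_pairings_iff using lazy_pairing_iff[OF central_hom_cp] central_hom_cp by auto
  fix l assume "l \<in> central_pairings G \<and> (reflection G H C \<delta>, l) \<in> lazy_reflections G"
  then obtain p where p: "central_hom G p" "l = central_hom.pairing G p" "is_lazy_reflection_pairing G H C l"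
    unfolding lazy_reflections_iff central_pairings_iff by blast
  then have "\<forall>g\<in>carrier G. p g = cp g"
    using lazy_pairing_iff[OF p(1)] by simp
  then show "l = P.pairing"
    by (auto simp: p(2) central_hom.pairing_def[OF p(1)] P.pairing_def fun_eq_iff intro!: sum.cong)
qed

end

context refl_datum
begin

lemma central_conj: "d \<in> C \<Longrightarrow> g \<in> carrier G \<Longrightarrow> d \<otimes> g \<otimes> inv d = g"
proof -
  assume dg: "d \<in> C" "g \<in> carrier G"
  have "d \<otimes> g \<otimes> inv d = g \<otimes> d \<otimes> inv d" by (simp only: central[OF dg])
  then show ?thesis using dg by (simp add: m_assoc)
qed

end

context refl_pairing
begin

text \<open>On \<open>\<O>\<^bsub>hc\<^esub>\<close> the subgroup \<open>C\<close> acts by \<open>\<rho>\<^sub>C\<close>, and all degrees of \<open>\<O>\<^bsub>h'c'\<^esub>\<close> have \<open>C\<close>-part \<open>c'\<close>.\<close>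

lemma J_lazy:
  fixes M N :: "('g, 'k) dg_mod"
  assumes p: "\<And>g. g \<in> carrier G \<Longrightarrow> p g = cp g"
    and s: "is_split_simple G H C h c B \<rho> \<chi> M \<tau>" and s': "is_split_simple G H C h' c' B' \<rho>' \<chi>' N \<tau>'"
    and m: "m \<in> vecs (idx M)" and n: "n \<in> vecs (idx N)"
  shows "J M N (m \<otimes>\<^sub>v n) = \<chi> c' \<cdot>\<^sub>v (m \<otimes>\<^sub>v n)"
proof -
  note S = split_simpleD[OF s] and S' = split_simpleD[OF s']
  note O = simple_objectD[OF S(4)] and O' = simple_objectD[OF S'(4)]
  have gm: "gact M d m = \<chi> d \<cdot>\<^sub>v m" if d: "d \<in> C" for d
    by (rule simple_object_eqI[OF S(4) gact_linear[OF O(2)] linear_between_scl_fun[OF linear_between_id] _ m])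
       (use d in \<open>simp_all add: O(6) S(7)\<close>)
  have zero: "n' = 0" if n': "homog N g n'" and g: "cp g \<noteq> c'" for g n'
  proof -
    \<comment> \<open>the projection to the degrees with \<open>C\<close>-part \<open>c'\<close> is the identity on the \<open>y \<otimes> w\<close>\<close>
    let ?P = "\<lambda>n. \<Sum>x | x \<in> carrier G \<and> cp x = c'. act N (ket (x, \<one>)) n"
    have lin: "linear_between (idx N) (idx N) ?P"
      by (intro linear_between_sum_fun dg_modulesD(2)[OF O'(2)] vecs_ket) auto
    have hs: "?P n = (if cp k = c' then n else 0)" if n: "homog N k n" for k n
    proof -
      have "?P n = (\<Sum>x | x \<in> carrier G \<and> cp x = c'. if x = k then n else 0)"
        using homogD[OF n] by (intro sum.cong) (auto simp: act_ket_homog[OF O'(2) n] gact_one[OF O'(2)])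
      then show ?thesis using fin homogD[OF n] by simp
    qed
    have "?P n' = n'"
    proof (rule simple_object_eqI[OF S'(4) lin linear_between_id _ homogD(2)[OF n']])
      fix y and w :: "nat \<Rightarrow> 'k" assume yw: "y \<in> carrier G" "w \<in> vecs B'"
      have "cp (y \<otimes> (h' \<otimes> c') \<otimes> inv y) = c'"
        using parts_conj[of y "h' \<otimes> c'"] yw S'(1,2) by simp
      then show "?P (\<tau>' y w) = \<tau>' y w" using hs[OF O'(5)[OF yw]] by simp
    qed
    then show ?thesis using hs[OF n'] g by simp
  qed
  show ?thesis
  proof (rule homog_eqI[OF O'(2) _ _ _ n])
    show "linear_between (idx N) (tens_idx (idx M) (idx N)) (\<lambda>n. J M N (m \<otimes>\<^sub>v n))"
      by (rule linear_between_comp[OF linear_between_vtens(2)[OF m] J_linear[OF O(2) O'(2)]])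
    show "linear_between (idx N) (tens_idx (idx M) (idx N)) (\<lambda>n. \<chi> c' \<cdot>\<^sub>v (m \<otimes>\<^sub>v n))"
      by (rule linear_between_scl_fun[OF linear_between_vtens(2)[OF m]])
    fix g and n' :: "nat \<Rightarrow> 'k" assume n': "homog N g n'"
    show "J M N (m \<otimes>\<^sub>v n') = \<chi> c' \<cdot>\<^sub>v (m \<otimes>\<^sub>v n')"
    proof (cases "cp g = c'")
      case True
      then show ?thesis
        using homogD[OF n'] S'(2) by (simp add: J_vtens[OF O(2) O'(2) m n'] p gm vtens_lin)
    next
      case False
      have "J M N 0 = 0" by (rule linear_between_zero[OF J_linear[OF O(2) O'(2)]])
      then show ?thesis using zero[OF n' False] by (simp add: vtens_lin)
    qed
  qed
qed

end

section \<open>The regular module\<close>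

context fin_group
begin

lemma bmul_assoc:
  fixes a b c :: "'g \<times> 'g \<Rightarrow> 'k::field"
  assumes a: "a \<in> DV" and b: "b \<in> DV" and c: "c \<in> DV"
  shows "bmul (drinfeld G) (bmul (drinfeld G) a b) c = bmul (drinfeld G) a (bmul (drinfeld G) b c)"
proof -
  note lin = linear_between_bmul[OF closed_drinfeld, simplified, where 'b = 'k]
  have b0: "bmul (drinfeld G) 0 w = 0" "bmul (drinfeld G) w 0 = 0" for w :: "'g \<times> 'g \<Rightarrow> 'k"
    by (simp_all add: fun_eq_iff bmul_app)
  have k: "bmul (drinfeld G) (bmul (drinfeld G) (ket q) (ket r)) (ket s)
      = bmul (drinfeld G) (ket q) (bmul (drinfeld G) (ket r) (ket s) :: _ \<Rightarrow> 'k)"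
    if qrs: "q \<in> GG" "r \<in> GG" "s \<in> GG" for q r s
  proof -
    obtain x y x' y' x'' y'' where e: "q = (x, y)" "r = (x', y')" "s = (x'', y'')"
      and G: "x \<in> carrier G" "y \<in> carrier G" "x' \<in> carrier G" "y' \<in> carrier G" "x'' \<in> carrier G" "y'' \<in> carrier G"
      using qrs by auto
    have "y \<otimes> y' \<otimes> x'' \<otimes> inv (y \<otimes> y') = y \<otimes> (y' \<otimes> x'' \<otimes> inv y') \<otimes> inv y"
      using G by (simp add: inv_mult_group m_assoc)
    moreover have "y \<otimes> x' \<otimes> inv y = y \<otimes> (y' \<otimes> x'' \<otimes> inv y') \<otimes> inv y \<longleftrightarrow> x' = y' \<otimes> x'' \<otimes> inv y'"
      using G by simp
    ultimately show ?thesis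
      using G by (auto simp: e bmul_drinfeld_ket b0 m_assoc)
  qed
  have k1: "bmul (drinfeld G) (bmul (drinfeld G) a (ket r)) (ket s) = bmul (drinfeld G) a (bmul (drinfeld G) (ket r) (ket s))"
    if "r \<in> GG" "s \<in> GG" for r s
    by (rule linear_between_eqI[OF linear_between_comp[OF lin(1) lin(1)] lin(1) finGG k[OF _ that] a])
  have k2: "bmul (drinfeld G) (bmul (drinfeld G) a b) (ket s) = bmul (drinfeld G) a (bmul (drinfeld G) b (ket s))"
    if "s \<in> GG" for s
    by (rule linear_between_eqI[OF linear_between_comp[OF lin(2) lin(1)] linear_between_comp[OF lin(1) lin(2)] finGG k1[OF _ that] b])
  show ?thesis
    by (rule linear_between_eqI[OF lin(2) linear_between_comp[OF lin(2) lin(2)] finGG k2 c])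
qed

lemma bmul_unit:
  fixes a :: "'g \<times> 'g \<Rightarrow> 'k::field"
  assumes "a \<in> DV" shows "bmul (drinfeld G) (unitc (drinfeld G)) a = a"
proof (rule linear_between_eqI[OF linear_between_bmul(2)[OF closed_drinfeld, simplified] linear_between_id finGG _ assms])
  fix q assume "q \<in> GG"
  then obtain x y where q: "q = (x, y)" "x \<in> carrier G" "y \<in> carrier G" by auto
  have "bmul (drinfeld G) (unitc (drinfeld G)) (ket q) = (\<Sum>z\<in>carrier G. bmul (drinfeld G) (ket (z, \<one>)) (ket q) :: _ \<Rightarrow> 'k)"
    by (simp add: unitc_grp_elt grp_elt_sum linear_between_sum[OF linear_between_bmul(1)[OF closed_drinfeld, simplified]] vecs_ket)
  also have "\<dots> = ket q"
    using fin q by (simp add: bmul_drinfeld_ket)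
  finally show "bmul (drinfeld G) (unitc (drinfeld G)) (ket q) = (ket q :: _ \<Rightarrow> 'k)" .
qed

text \<open>Bases of modules consist of natural numbers, so the regular module needs a numbering \<open>enc\<close> of the basis
  of \<open>DG\<close>. The maps \<open>numbered\<close> and \<open>unnumbered\<close> are the resulting mutually inverse linear isomorphisms between
  \<open>DG\<close> and the space of the regular module.\<close>

definition enc :: "'g \<times> 'g \<Rightarrow> nat" where
  "enc = (SOME f. inj_on f GG)"

lemma inj_enc: "inj_on enc GG"
proof -
  obtain f :: "'g \<times> 'g \<Rightarrow> nat" where "inj_on f GG"
    using finite_imp_inj_to_nat_seg[OF finGG] by metis
  then show ?thesis
    unfolding enc_def by (rule someI[of "\<lambda>f. inj_on f GG"])
qed

definition numbered :: "('g \<times> 'g \<Rightarrow> 'k::field) \<Rightarrow> nat \<Rightarrow> 'k" where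
  "numbered f = (\<lambda>n. \<Sum>q\<in>GG. f q * ket (enc q) n)"

definition unnumbered :: "(nat \<Rightarrow> 'k::field) \<Rightarrow> 'g \<times> 'g \<Rightarrow> 'k" where
  "unnumbered v = (\<lambda>q. if q \<in> GG then v (enc q) else 0)"

text \<open>\<open>DG\<close> as a left module over itself.\<close>

definition reg_mod :: "('g, 'k::field) dg_mod" where
  "reg_mod = \<lparr>idx = enc ` GG, act = (\<lambda>a v. numbered (bmul (drinfeld G) a (unnumbered v)))\<rparr>"

lemma numbered_enc: "q \<in> GG \<Longrightarrow> numbered f (enc q) = f q"
proof -
  assume q: "q \<in> GG"
  have "numbered f (enc q) = (\<Sum>r\<in>GG. if r = q then f q else 0)"
    unfolding numbered_def using q inj_enc by (intro sum.cong) (auto simp: ket_app inj_on_def)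
  then show ?thesis using finGG q by simp
qed

lemma numbered_vecs: "numbered f \<in> vecs (idx reg_mod)"
  by (auto simp: vecs_def reg_mod_def numbered_def ket_app intro!: sum.neutral)

lemma unnumbered_vecs: "unnumbered v \<in> DV"
  by (auto simp: vecs_def unnumbered_def)

lemma unnumbered_numbered: "f \<in> DV \<Longrightarrow> unnumbered (numbered f) = f"
  by (auto simp: fun_eq_iff unnumbered_def numbered_enc vecs_def)

lemma numbered_unnumbered: "v \<in> vecs (idx reg_mod) \<Longrightarrow> numbered (unnumbered v) = v"
  by (rule vecs_eqI[OF numbered_vecs]) (auto simp: reg_mod_def numbered_enc unnumbered_def)

lemma numbered_linear:
  "numbered (f + f') = numbered f + numbered f'" "numbered (c \<cdot>\<^sub>v f) = c \<cdot>\<^sub>v numbered f"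
  "unnumbered (v + v') = unnumbered v + unnumbered v'" "unnumbered (c \<cdot>\<^sub>v v) = c \<cdot>\<^sub>v unnumbered v"
  by (auto simp: fun_eq_iff numbered_def unnumbered_def scl_app algebra_simps sum.distrib sum_distrib_left)

lemma reg_mod_module: "(reg_mod :: ('g, 'k::field) dg_mod) \<in> dg_modules G"
proof -
  note lin = linear_between_bmul[OF closed_drinfeld, simplified, where 'b = 'k]
  have act: "act reg_mod a v = numbered (bmul (drinfeld G) a (unnumbered v))" for a and v :: "nat \<Rightarrow> 'k"
    by (simp add: reg_mod_def)
  have bv: "bmul (drinfeld G) a b \<in> DV" for a b :: "'g \<times> 'g \<Rightarrow> 'k"
    using bmul_vecs[OF closed_drinfeld, of a b] by simp
  let ?R = "reg_mod :: ('g, 'k) dg_mod"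
  have "linear_between (idx ?R) (idx ?R) (act ?R a)" for a
    by (rule linear_betweenI)
       (simp_all add: act numbered_vecs numbered_linear linear_betweenD(2)[OF lin(2)] linear_betweenD(3)[OF lin(2)] unnumbered_vecs)
  moreover have "finite (idx (reg_mod :: ('g, 'k) dg_mod))" using finGG by (simp add: reg_mod_def)
  ultimately show ?thesis
    unfolding dg_modules_def
    by (simp add: act linear_betweenD(2)[OF lin(1)] linear_betweenD(3)[OF lin(1)] numbered_linear
        unnumbered_numbered[OF bv] bmul_assoc[OF _ _ unnumbered_vecs] bmul_unit[OF unnumbered_vecs] numbered_unnumbered)
qed

lemma reg_mod_ket:
  assumes "x \<in> carrier G" "y \<in> carrier G"
  shows "homog reg_mod x (numbered (ket (x, y)) :: nat \<Rightarrow> 'k::field)"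
    and "z \<in> carrier G \<Longrightarrow> gact reg_mod z (numbered (ket (x, y)) :: nat \<Rightarrow> 'k) = numbered (ket (z \<otimes> x \<otimes> inv z, z \<otimes> y))"
proof -
  have act: "act reg_mod (ket (x', y')) (numbered (ket (x, y)) :: nat \<Rightarrow> 'k) =
      (if x' = y' \<otimes> x \<otimes> inv y' then numbered (ket (x', y' \<otimes> y)) else 0)"
    if "x' \<in> carrier G" "y' \<in> carrier G" for x' y'
    using that assms by (simp add: reg_mod_def unnumbered_numbered vecs_ket bmul_drinfeld_ket)
      (simp add: numbered_def fun_eq_iff)
  show h: "homog reg_mod x (numbered (ket (x, y)) :: nat \<Rightarrow> 'k)"
    using assms act[of x \<one>] by (simp add: homog_def numbered_vecs)
  assume z: "z \<in> carrier G"
  show "gact reg_mod z (numbered (ket (x, y)) :: nat \<Rightarrow> 'k) = numbered (ket (z \<otimes> x \<otimes> inv z, z \<otimes> y))"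
    using act_ket_homog[OF reg_mod_module h, of "z \<otimes> x \<otimes> inv z" z] act[of "z \<otimes> x \<otimes> inv z" z] z assms by simp
qed

section \<open>Compatibility with the braiding\<close>

lemma restrict_eq_iff: "restrict f A = restrict g A \<longleftrightarrow> (\<forall>x\<in>A. f x = g x)"
  by (auto simp: fun_eq_iff restrict_def)

lemma flip_vtens: "flip (v \<otimes>\<^sub>v w) = w \<otimes>\<^sub>v (v :: nat \<Rightarrow> 'k::field)"
  by (rule vtens_eqI) (simp add: flip_def vtens_app mult.commute)

lemma flip_linear: "linear_between (tens_idx A B) (tens_idx B A) (flip :: 'k::field lmap)"
proof (rule linear_betweenI)
  fix t :: "nat \<Rightarrow> 'k" assume t: "t \<in> vecs (tens_idx A B)"
  show "flip t \<in> vecs (tens_idx B A)"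
    unfolding vecs_def
  proof (clarify)
    fix n assume n: "n \<notin> tens_idx B A"
    obtain i j where ij: "n = prod_encode (i, j)" by (metis prod_decode_inverse surj_pair)
    show "flip t n = 0"
      using n vecs_out[OF t, of "prod_encode (j, i)"] by (auto simp: ij flip_def tens_idx_iff)
  qed
qed (auto simp: flip_def fun_eq_iff scl_app split: prod.split)

lemma r_matrix_sum: "r_matrix G = (\<Sum>g\<in>carrier G. pure (ket (g, \<one>)) (grp_elt g))"
  by (simp add: r_matrix_def grp_elt_def)

lemma braiding_linear:
  assumes "M \<in> dg_modules G" "N \<in> dg_modules G"
  shows "linear_between (tens_idx (idx M) (idx N)) (tens_idx (idx N) (idx M)) (braiding G M N)"
  unfolding braiding_def idx_tens_mod linear_between_restrict
  by (rule linear_between_comp[OF act2_linear[OF assms] flip_linear])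

lemma braiding_vtens:
  assumes M: "M \<in> dg_modules G" and N: "N \<in> dg_modules G" and v: "v \<in> vecs (idx M)" and w: "w \<in> vecs (idx N)"
  shows "braiding G M N (v \<otimes>\<^sub>v w) = (\<Sum>g\<in>carrier G. gact N g w \<otimes>\<^sub>v act M (ket (g, \<one>)) v)"
proof -
  have "act2 G M N (r_matrix G) (v \<otimes>\<^sub>v w) = (\<Sum>g\<in>carrier G. act M (ket (g, \<one>)) v \<otimes>\<^sub>v gact N g w)"
    using v w by (simp add: r_matrix_sum act2_sum act2_pure[OF M N] vecs_ket grp_elt_vecs gact_def)
  moreover have "flip (\<Sum>g\<in>carrier G. act M (ket (g, \<one>)) v \<otimes>\<^sub>v gact N g w)
    = (\<Sum>g\<in>carrier G. flip (act M (ket (g, \<one>)) v \<otimes>\<^sub>v gact N g w))"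
    using v w by (intro linear_between_sum[OF flip_linear[of "idx M" "idx N"]] vtens_vecs)
      (auto intro: dg_modulesD(7)[OF M] gact_vecs[OF N] vecs_ket)
  ultimately show ?thesis
    using v w by (simp add: braiding_def vtens_vecs flip_vtens)
qed

lemma braiding_vtens_homog:
  assumes M: "M \<in> dg_modules G" and N: "N \<in> dg_modules G" and v: "homog M g v" and w: "w \<in> vecs (idx N)"
  shows "braiding G M N (v \<otimes>\<^sub>v w) = gact N g w \<otimes>\<^sub>v v"
proof -
  note g = homogD[OF v]
  have "braiding G M N (v \<otimes>\<^sub>v w) = (\<Sum>g'\<in>carrier G. if g' = g then gact N g w \<otimes>\<^sub>v v else 0)"
    using g by (simp add: braiding_vtens[OF M N g(2) w])
      (intro sum.cong refl, auto simp: act_ket_homog[OF M v] gact_one[OF M] vtens_lin)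
  then show ?thesis using fin g by simp
qed

end

context refl_pairing
begin

text \<open>The functor of the reflection, on objects.\<close>

abbreviation F :: "('g, 'k) dg_mod \<Rightarrow> ('g, 'k) dg_mod" where
  "F \<equiv> twist (dagger G (reflection G H C \<delta>))"

text \<open>The product \<open>K\<close> of the inverse of the matrix \<open>\<delta>(c)(c')\<close> with its transpose.\<close>

definition compare :: "'g \<Rightarrow> 'g \<Rightarrow> 'k" where
  "compare d e = (\<Sum>c\<in>C. \<delta>i (ket d) c * \<delta> (ket e) c)"

lemma compare_iff: "(\<forall>d\<in>C. \<forall>e\<in>C. compare d e = (if d = e then 1 else 0)) \<longleftrightarrow> is_symmetric_iso C \<delta>"
proof
  assume L: "\<forall>d\<in>C. \<forall>e\<in>C. compare d e = (if d = e then 1 else 0)"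
  show "is_symmetric_iso C \<delta>"
    unfolding is_symmetric_iso_def
  proof (intro ballI)
    fix c c' assume c: "c \<in> C" "c' \<in> C"
    have "(\<Sum>d\<in>C. \<delta> (ket c) d * compare d c') = (\<Sum>x\<in>C. (\<Sum>d\<in>C. \<delta> (ket c) d * \<delta>i (ket d) x) * \<delta> (ket c') x)"
      unfolding compare_def sum_distrib_left by (subst sum.swap) (simp add: sum_distrib_right mult.assoc)
    also have "\<dots> = \<delta> (ket c') c"
      using c finHC by (simp add: \<delta>i_\<delta>_sum vecs_ket sum_ket_mult)
    finally have "(\<Sum>d\<in>C. \<delta> (ket c) d * compare d c') = \<delta> (ket c') c" .
    moreover have "(\<Sum>d\<in>C. \<delta> (ket c) d * compare d c') = (\<Sum>d\<in>C. if d = c' then \<delta> (ket c) c' else 0)"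
      using L c by (intro sum.cong) auto
    ultimately show "\<delta> (ket c) c' = \<delta> (ket c') c"
      using c finHC by simp
  qed
next
  assume R: "is_symmetric_iso C \<delta>"
  show "\<forall>d\<in>C. \<forall>e\<in>C. compare d e = (if d = e then 1 else 0)"
  proof (intro ballI)
    fix d e assume de: "d \<in> C" "e \<in> C"
    have "compare d e = (\<Sum>c\<in>C. \<delta>i (ket d) c * \<delta> (ket c) e)"
      unfolding compare_def using R de by (intro sum.cong) (auto simp: is_symmetric_iso_def)
    then show "compare d e = (if d = e then 1 else 0)"
      using de by (auto simp: \<delta>_\<delta>i_sum vecs_ket ket_app)
  qed
qed

lemma braiding_twist:
  assumes M: "M \<in> dg_modules G" and N: "N \<in> dg_modules G" and v: "homog M g v" and w: "homog N h w"
  shows "braiding G (F M) (F N) (v \<otimes>\<^sub>v w) =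
    (\<Sum>d\<in>C. compare d (cp h) \<cdot>\<^sub>v (gact N (hp g) w \<otimes>\<^sub>v gact M d v))"
proof -
  interpret T: refl_datum G H C "dual_map C C \<delta>"
    by unfold_locales (rule transpose_datum)
  note g = homogD[OF v] and h = homogD[OF w]
  note FM = twist_module[OF dagger_hopf_hom M] and FN = twist_module[OF dagger_hopf_hom N]
  let ?S = "\<lambda>c. \<Sum>d\<in>C. \<delta>i (ket d) c \<cdot>\<^sub>v gact M d v"
  have gN: "gact (F N) y w = \<delta> (ket (cp h)) (cp y) \<cdot>\<^sub>v gact N (hp y) w" if "y \<in> carrier G" for y
    using T.act_reflection_grp_elt[OF N w that] that h by (simp add: gact_def dagger_reflection transpose_ket)
  have Sv: "?S c \<in> vecs (idx M)" for c
    using g by (auto intro!: vecs_sum vecs_scl gact_vecs[OF M])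
  have aM: "act (F M) (ket (y, \<one>)) v = (if hp y = hp g then ?S (cp y) else 0)" if y: "y \<in> carrier G" for y
  proof -
    have "act (F M) (ket (y, \<one>)) v = (if hp y = hp g then (\<Sum>d\<in>C. T.\<delta>i (ket (cp y)) d \<cdot>\<^sub>v gact M d v) else 0)"
      using T.act_reflection[OF M v y one_closed] g
      by (simp add: dagger_reflection T.bichar_one gact_one[OF M] vecs_sum vecs_scl gact_vecs[OF M])
    also have "(\<Sum>d\<in>C. T.\<delta>i (ket (cp y)) d \<cdot>\<^sub>v gact M d v) = ?S (cp y)"
      using y by (intro sum.cong refl) (simp add: transpose_the_inv vecs_ket transpose_ket)
    finally show ?thesis .
  qed
  have "braiding G (F M) (F N) (v \<otimes>\<^sub>v w) = (\<Sum>y\<in>carrier G. gact (F N) y w \<otimes>\<^sub>v act (F M) (ket (y, \<one>)) v)"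
    using g h by (intro braiding_vtens[OF FM FN]) simp_all
  also have "\<dots> = (\<Sum>x\<in>H. \<Sum>c\<in>C. gact (F N) (x \<otimes> c) w \<otimes>\<^sub>v act (F M) (ket (x \<otimes> c, \<one>)) v)"
    by (rule sum_parts)
  also have "\<dots> = (\<Sum>x\<in>H. if x = hp g then \<Sum>c\<in>C. (\<delta> (ket (cp h)) c \<cdot>\<^sub>v gact N (hp g) w) \<otimes>\<^sub>v ?S c else 0)"
    by (intro sum.cong refl) (auto simp: gN aM vtens_lin scl_sum mult.commute simp del: twist_simps intro!: sum.cong sum.neutral)
  also have "\<dots> = (\<Sum>c\<in>C. (\<delta> (ket (cp h)) c \<cdot>\<^sub>v gact N (hp g) w) \<otimes>\<^sub>v ?S c)"
    using finHC g by simp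
  also have "\<dots> = (\<Sum>c\<in>C. \<Sum>d\<in>C. (\<delta>i (ket d) c * \<delta> (ket (cp h)) c) \<cdot>\<^sub>v (gact N (hp g) w \<otimes>\<^sub>v gact M d v))"
    by (simp add: vtens_lin scl_sum mult.commute)
  also have "\<dots> = (\<Sum>d\<in>C. compare d (cp h) \<cdot>\<^sub>v (gact N (hp g) w \<otimes>\<^sub>v gact M d v))"
    unfolding compare_def sum_scl by (rule sum.swap)
  finally show ?thesis .
qed

text \<open>The condition for \<open>(F, J)\<close> to respect the braiding of \<open>M\<close> and \<open>N\<close>, on homogeneous vectors.\<close>

definition braided_at :: "('g, 'k) dg_mod \<Rightarrow> ('g, 'k) dg_mod \<Rightarrow> bool" where
  "braided_at M N \<longleftrightarrow> (\<forall>g h v w. homog M g v \<longrightarrow> homog N h w \<longrightarrow>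
     gact N g w \<otimes>\<^sub>v gact M (p h) v =
     (\<Sum>d\<in>C. compare d (cp h) \<cdot>\<^sub>v (gact N (p g \<otimes> hp g) w \<otimes>\<^sub>v gact M d v)))"

text \<open>The left side of the braiding condition is \<open>c \<circ> J\<close> and the right side is \<open>J \<circ> c\<close>, with the braiding of the
  twisted modules on the right.\<close>

lemma braided_at_iff:
  assumes M: "M \<in> dg_modules G" and N: "N \<in> dg_modules G"
  shows "compose (vecs (tens_idx (idx M) (idx N))) (braiding G M N) (J M N)
      = compose (vecs (tens_idx (idx M) (idx N))) (J N M) (braiding G (F M) (F N)) \<longleftrightarrow> braided_at M N"
proof -
  let ?I = "tens_idx (idx M) (idx N)" and ?I' = "tens_idx (idx N) (idx M)"
  note FM = twist_module[OF dagger_hopf_hom M] and FN = twist_module[OF dagger_hopf_hom N]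
  have l: "linear_between ?I ?I' (\<lambda>t. braiding G M N (J M N t))"
    by (rule linear_between_comp[OF J_linear[OF M N] braiding_linear[OF M N]])
  have r: "linear_between ?I ?I' (\<lambda>t. J N M (braiding G (F M) (F N) t))"
    using linear_between_comp[OF braiding_linear[OF FM FN, simplified] J_linear[OF N M]] .
  have lv: "braiding G M N (J M N (v \<otimes>\<^sub>v w)) = gact N g w \<otimes>\<^sub>v gact M (p h) v"
    if v: "homog M g v" and w: "homog N h w" for g h v w
  proof -
    note g = homogD[OF v] and h = homogD[OF w]
    have "p h \<otimes> g \<otimes> inv (p h) = g"
      using g h by (simp add: p_central m_assoc)
    then have "homog M g (gact M (p h) v)"
      using gact_homog[OF M v, of "p h"] h by simp
    then show ?thesis
      using h by (simp add: J_vtens[OF M N g(2) w] braiding_vtens_homog[OF M N])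
  qed
  have rv: "J N M (braiding G (F M) (F N) (v \<otimes>\<^sub>v w)) =
     (\<Sum>d\<in>C. compare d (cp h) \<cdot>\<^sub>v (gact N (p g \<otimes> hp g) w \<otimes>\<^sub>v gact M d v))"
    if v: "homog M g v" and w: "homog N h w" for g h v w
  proof -
    note g = homogD[OF v] and h = homogD[OF w]
    have 1: "J N M (gact N (hp g) w \<otimes>\<^sub>v gact M d v) = gact N (p g \<otimes> hp g) w \<otimes>\<^sub>v gact M d v" if d: "d \<in> C" for d
    proof -
      have "d \<otimes> g \<otimes> inv d = g" using d g by (intro central_conj)
      then have "homog M g (gact M d v)" using gact_homog[OF M v, of d] d by simp
      then show ?thesis
        using g h by (simp add: J_vtens[OF N M] gact_vecs[OF N] gact_comp[OF N])
    qed
    have "J N M (braiding G (F M) (F N) (v \<otimes>\<^sub>v w)) =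
      (\<Sum>d\<in>C. J N M (compare d (cp h) \<cdot>\<^sub>v (gact N (hp g) w \<otimes>\<^sub>v gact M d v)))"
      using g h unfolding braiding_twist[OF M N v w]
      by (intro linear_between_sum[OF J_linear[OF N M]] vecs_scl vtens_vecs gact_vecs[OF M] gact_vecs[OF N]) auto
    also have "\<dots> = (\<Sum>d\<in>C. compare d (cp h) \<cdot>\<^sub>v J N M (gact N (hp g) w \<otimes>\<^sub>v gact M d v))"
      using g h by (intro sum.cong refl linear_betweenD(3)[OF J_linear[OF N M]] vtens_vecs gact_vecs[OF M] gact_vecs[OF N]) auto
    finally show ?thesis by (simp add: 1)
  qed
  have eq_iff: "compose (vecs ?I) (braiding G M N) (J M N) = compose (vecs ?I) (J N M) (braiding G (F M) (F N))
     \<longleftrightarrow> (\<forall>t\<in>vecs ?I. braiding G M N (J M N t) = J N M (braiding G (F M) (F N) t))"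
    by (simp only: compose_def restrict_eq_iff)
  show ?thesis
    unfolding eq_iff
  proof
    assume L: "\<forall>t\<in>vecs ?I. braiding G M N (J M N t) = J N M (braiding G (F M) (F N) t)"
    show "braided_at M N"
      unfolding braided_at_def
    proof (intro allI impI)
      fix g h and v w :: "nat \<Rightarrow> 'k" assume vw: "homog M g v" "homog N h w"
      have "braiding G M N (J M N (v \<otimes>\<^sub>v w)) = J N M (braiding G (F M) (F N) (v \<otimes>\<^sub>v w))"
        using L vtens_vecs[OF homogD(2)[OF vw(1)] homogD(2)[OF vw(2)]] by blast
      then show "gact N g w \<otimes>\<^sub>v gact M (p h) v =
         (\<Sum>d\<in>C. compare d (cp h) \<cdot>\<^sub>v (gact N (p g \<otimes> hp g) w \<otimes>\<^sub>v gact M d v))"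
        using lv[OF vw] rv[OF vw] by simp
    qed
  next
    assume R: "braided_at M N"
    show "\<forall>t\<in>vecs ?I. braiding G M N (J M N t) = J N M (braiding G (F M) (F N) t)"
    proof
      fix t :: "nat \<Rightarrow> 'k" assume t: "t \<in> vecs ?I"
      show "braiding G M N (J M N t) = J N M (braiding G (F M) (F N) t)"
        by (rule tens_homog_eqI[OF M N l r _ t]) (use R lv rv in \<open>simp add: braided_at_def\<close>)
    qed
  qed
qed

lemma braided_at_regular:
  assumes "braided_at reg_mod reg_mod"
  shows "g \<in> carrier G \<Longrightarrow> p g = cp g" and "is_symmetric_iso C \<delta>"
proof -
  \<comment> \<open>the condition at \<open>v = e\<^sub>a \<times> 1\<close> and \<open>w = e\<^sub>b \<times> 1\<close>: its coefficient at \<open>(e\<^sub>x \<times> a) \<otimes> (e\<^sub>a \<times> y)\<close> with \<open>x = aba\<^sup>-\<^sup>1\<close>\<close>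
  have E: "(if y = p b then 1 else 0) =
      (if a = p a \<otimes> hp a then if y \<in> C then compare y (cp b) else 0 else 0)"
    if a: "a \<in> carrier G" and b: "b \<in> carrier G" and y: "y \<in> carrier G" for a b y
  proof -
    let ?v = "numbered (ket (a, \<one>)) :: nat \<Rightarrow> 'k" and ?w = "numbered (ket (b, \<one>)) :: nat \<Rightarrow> 'k"
    let ?x = "a \<otimes> b \<otimes> inv a" and ?z = "p a \<otimes> hp a"
    have z: "?z \<in> carrier G" using a by simp
    have fixa: "d \<otimes> a \<otimes> inv d = a" if "d \<in> C" for d using that a by (intro central_conj)
    have fixp: "p b \<otimes> a \<otimes> inv (p b) = a" using a b by (simp add: p_central m_assoc)
    have nk: "numbered (ket q :: _ \<Rightarrow> 'k) (enc r) = (if r = q then 1 else 0)" if "r \<in> GG" for q r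
      using that by (simp add: numbered_enc ket_app)
    have "(gact reg_mod a ?w \<otimes>\<^sub>v gact reg_mod (p b) ?v) (prod_encode (enc (?x, a), enc (a, y))) =
      (\<Sum>d\<in>C. compare d (cp b) \<cdot>\<^sub>v (gact reg_mod ?z ?w \<otimes>\<^sub>v gact reg_mod d ?v)) (prod_encode (enc (?x, a), enc (a, y)))"
      by (rule fun_cong[OF assms[unfolded braided_at_def, rule_format,
            OF reg_mod_ket(1)[OF a one_closed] reg_mod_ket(1)[OF b one_closed]]])
    then have "(if y = p b then 1 else 0) = (\<Sum>d\<in>C. compare d (cp b) *
       ((if ?x = ?z \<otimes> b \<otimes> inv ?z \<and> a = ?z then 1 else 0) * (if y = d then 1 else 0)))"
      using a b y z
      by (simp add: sum_fun_app scl_app vtens_app reg_mod_ket(2) nk fixa fixp)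
    also have "\<dots> = (\<Sum>d\<in>C. if d = y then if a = ?z then compare y (cp b) else 0 else 0)"
      by (intro sum.cong refl) auto
    also have "\<dots> = (if a = ?z then if y \<in> C then compare y (cp b) else 0 else 0)"
      using finHC by simp
    finally show ?thesis .
  qed
  show pc: "p g = cp g" if g: "g \<in> carrier G" for g
  proof -
    \<comment> \<open>at \<open>y = p b\<close> the left side is \<open>1\<close>, so the first condition on the right must hold\<close>
    have "g = p g \<otimes> hp g"
      using E[OF g g p_carrier[OF g]] by (auto split: if_splits)
    then have "cp g \<otimes> hp g = p g \<otimes> hp g"
      using g by (simp add: commute_HC parts_mult)
    then show ?thesis using g by simp
  qed
  have "compare d e = (if d = e then 1 else 0)" if de: "d \<in> C" "e \<in> C" for d e
    using E[of \<one> e d] de pc[of e] pc[of \<one>] by auto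
  then show "is_symmetric_iso C \<delta>"
    using compare_iff by simp
qed

lemma braided_at_lazy:
  assumes p: "\<And>g. g \<in> carrier G \<Longrightarrow> p g = cp g" and sym: "is_symmetric_iso C \<delta>"
  shows "braided_at M N"
  unfolding braided_at_def
proof (intro allI impI)
  fix g h and v w :: "nat \<Rightarrow> 'k" assume vw: "homog M g v" "homog N h w"
  note g = homogD[OF vw(1)] and h = homogD[OF vw(2)]
  have "(\<Sum>d\<in>C. compare d (cp h) \<cdot>\<^sub>v (gact N (p g \<otimes> hp g) w \<otimes>\<^sub>v gact M d v))
    = (\<Sum>d\<in>C. if d = cp h then gact N (p g \<otimes> hp g) w \<otimes>\<^sub>v gact M (cp h) v else 0)"
    using compare_iff sym h by (intro sum.cong refl) auto
  also have "\<dots> = gact N g w \<otimes>\<^sub>v gact M (p h) v"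
    using finHC g h by (simp add: p commute_HC parts_mult)
  finally show "gact N g w \<otimes>\<^sub>v gact M (p h) v =
     (\<Sum>d\<in>C. compare d (cp h) \<cdot>\<^sub>v (gact N (p g \<otimes> hp g) w \<otimes>\<^sub>v gact M d v))" by simp
qed

lemma braided_iff:
  "is_braided_autoequivalence G (twist_functor G (reflection G H C \<delta>), J) \<longleftrightarrow>
    (\<forall>g\<in>carrier G. p g = cp g) \<and> is_symmetric_iso C \<delta>"
proof -
  have "is_braided_autoequivalence G (twist_functor G (reflection G H C \<delta>), J) \<longleftrightarrow>
    (\<forall>M\<in>dg_modules G. \<forall>N\<in>dg_modules G. braided_at M N)"
    unfolding is_braided_autoequivalence_def prod.case twist_functor_simps idx_tens_mod twist_simps fst_conv
    using twist_monoidal[OF dagger_hopf_hom] twist_autoequivalence[OF dagger_hopf_hom dagger_involution]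
    by (simp add: braided_at_iff)
  also have "\<dots> \<longleftrightarrow> (\<forall>g\<in>carrier G. p g = cp g) \<and> is_symmetric_iso C \<delta>"
  proof
    assume "\<forall>M\<in>dg_modules G. \<forall>N\<in>dg_modules G. braided_at M N"
    then have "braided_at reg_mod reg_mod" using reg_mod_module by blast
    then show "(\<forall>g\<in>carrier G. p g = cp g) \<and> is_symmetric_iso C \<delta>"
      using braided_at_regular by simp
  next
    assume "(\<forall>g\<in>carrier G. p g = cp g) \<and> is_symmetric_iso C \<delta>"
    then show "\<forall>M\<in>dg_modules G. \<forall>N\<in>dg_modules G. braided_at M N"
      using braided_at_lazy by simp
  qed
  finally show ?thesis .
qed

end

theorem proposition4p16:
  fixes G :: "('g, 'm) monoid_scheme"
    and H C :: "'g set"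
    and \<delta> :: "('g \<Rightarrow> 'k::{alg_closed_field, field_char_0}) \<Rightarrow> 'g \<Rightarrow> 'k"
    and l :: "('g \<Rightarrow> 'k) \<Rightarrow> ('g \<Rightarrow> 'k) \<Rightarrow> 'k"
    and r F J
  assumes "group G" and "finite (carrier G)"
    and "is_reflection_datum G H C \<delta>"
    and "l \<in> central_pairings G"
    and r: "r = reflection G H C \<delta>"
    and FJ: "(F, J) = Psi G r (pairing_cocycle G l)"
  shows
    "(r \<in> hopf_aut (drinfeld G) \<and>
      pairing_cocycle G l \<in> lazy_cocycles (drinfeld_dual G) \<and>
      is_monoidal_functor G (F, J) \<and>
      (\<forall>h c B \<rho>H \<rho>C M \<tau>. is_split_simple G H C h c B \<rho>H \<rho>C M \<tau> \<longrightarrow>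
         (\<exists>\<tau>'. is_split_simple G H C h (delta_inv C \<delta> \<rho>C) B \<rho>H (\<delta> (ket c)) (obj F M) \<tau>' \<and>
                (\<forall>s\<in>H. \<forall>v\<in>vecs B. \<tau>' s v = \<tau> s v))) \<and>
      (\<forall>h c B \<rho>H \<rho>C M \<tau> h' c' B' \<chi>H \<chi>C N \<tau>N S T.
         is_split_simple G H C h c B \<rho>H \<rho>C M \<tau> \<and>
         is_split_simple G H C h' c' B' \<chi>H \<chi>C N \<tau>N \<and>
         left_transversal G (centralizer G (h \<otimes>\<^bsub>G\<^esub> c)) S \<and>
         left_transversal G (centralizer G (h' \<otimes>\<^bsub>G\<^esub> c')) T \<longrightarrow>
         (\<forall>s\<in>S. \<forall>t\<in>T. \<forall>v\<in>vecs B. \<forall>w\<in>vecs B'.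
            J M N (\<tau> s v \<otimes>\<^sub>v \<tau>N t w) =
            (\<Sum>i\<in>S. \<Sum>z\<in>centralizer G (h \<otimes>\<^bsub>G\<^esub> c).
               l (ket (t \<otimes>\<^bsub>G\<^esub> (h' \<otimes>\<^bsub>G\<^esub> c') \<otimes>\<^bsub>G\<^esub> inv\<^bsub>G\<^esub> t)) (ket (i \<otimes>\<^bsub>G\<^esub> z \<otimes>\<^bsub>G\<^esub> inv\<^bsub>G\<^esub> s))
               \<cdot>\<^sub>v (\<tau> i (rep_join G H C \<rho>H \<rho>C z v) \<otimes>\<^sub>v \<tau>N t w))))) \<and>
     ((\<exists>!l'. l' \<in> central_pairings G \<and> (r, l') \<in> lazy_reflections G) \<and>
      (\<forall>H' C' \<delta>'. is_reflection_datum G H' C' \<delta>' \<and> reflection G H' C' \<delta>' = r \<longrightarrow>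
         H' = H \<and> C' = C \<and> (\<forall>a\<in>vecs C. \<delta>' a = \<delta> a)) \<and>
      (is_braided_autoequivalence G (F, J) \<longleftrightarrow>
         (r, l) \<in> lazy_reflections G \<and> is_symmetric_iso C \<delta>)) \<and>
     ((r, l) \<in> lazy_reflections G \<longrightarrow>
      (\<forall>h c B \<rho>H \<rho>C M \<tau> h' c' B' \<chi>H \<chi>C N \<tau>N.
         is_split_simple G H C h c B \<rho>H \<rho>C M \<tau> \<and>
         is_split_simple G H C h' c' B' \<chi>H \<chi>C N \<tau>N \<longrightarrow>
         (\<forall>m\<in>vecs (idx M). \<forall>n\<in>vecs (idx N). J M N (m \<otimes>\<^sub>v n) = \<rho>C c' \<cdot>\<^sub>v (m \<otimes>\<^sub>v n))))"
proof -
  interpret fin_group G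
    using assms(1,2) by (simp add: fin_group_def fin_group_axioms_def)
  interpret refl_datum G H C \<delta>
    by unfold_locales (rule assms(3))
  obtain p where p: "central_hom G p" and l: "l = central_hom.pairing G p"
    using assms(4) unfolding central_pairings_iff by blast
  interpret central_hom G p by (rule p)
  interpret refl_pairing G H C \<delta> p by unfold_locales
  have F: "F = twist_functor G (reflection G H C \<delta>)" and J: "J = cocycle_str G sigma"
    using FJ by (simp_all add: Psi_def r l sigma_pairing)
  have lazy: "(r, l) \<in> lazy_reflections G \<longleftrightarrow> (\<forall>g\<in>carrier G. p g = cp g)"
    unfolding r lazy_reflections_iff using assms(4) by (simp add: l lazy_pairing_iff[OF p])
  show ?thesis
  proof (intro conjI)
    show "r \<in> hopf_aut (drinfeld G)"
      unfolding r by (rule reflection_hopf_aut)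
    show "pairing_cocycle G l \<in> lazy_cocycles (drinfeld_dual G)"
      unfolding l sigma_pairing by (rule sigma_lazy)
    show "is_monoidal_functor G (F, J)"
      unfolding F J by (rule twist_monoidal[OF dagger_hopf_hom])
    show "\<forall>h c B \<rho>H \<rho>C M \<tau>. is_split_simple G H C h c B \<rho>H \<rho>C M \<tau> \<longrightarrow>
         (\<exists>\<tau>'. is_split_simple G H C h (delta_inv C \<delta> \<rho>C) B \<rho>H (\<delta> (ket c)) (obj F M) \<tau>' \<and>
                (\<forall>s\<in>H. \<forall>v\<in>vecs B. \<tau>' s v = \<tau> s v))"
      unfolding F twist_functor_simps using split_simple_twist by blast
    show "\<forall>h c B \<rho>H \<rho>C M \<tau> h' c' B' \<chi>H \<chi>C N \<tau>N S T.
         is_split_simple G H C h c B \<rho>H \<rho>C M \<tau> \<and>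
         is_split_simple G H C h' c' B' \<chi>H \<chi>C N \<tau>N \<and>
         left_transversal G (centralizer G (h \<otimes>\<^bsub>G\<^esub> c)) S \<and>
         left_transversal G (centralizer G (h' \<otimes>\<^bsub>G\<^esub> c')) T \<longrightarrow>
         (\<forall>s\<in>S. \<forall>t\<in>T. \<forall>v\<in>vecs B. \<forall>w\<in>vecs B'.
            J M N (\<tau> s v \<otimes>\<^sub>v \<tau>N t w) =
            (\<Sum>i\<in>S. \<Sum>z\<in>centralizer G (h \<otimes>\<^bsub>G\<^esub> c).
               l (ket (t \<otimes>\<^bsub>G\<^esub> (h' \<otimes>\<^bsub>G\<^esub> c') \<otimes>\<^bsub>G\<^esub> inv\<^bsub>G\<^esub> t)) (ket (i \<otimes>\<^bsub>G\<^esub> z \<otimes>\<^bsub>G\<^esub> inv\<^bsub>G\<^esub> s))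
               \<cdot>\<^sub>v (\<tau> i (rep_join G H C \<rho>H \<rho>C z v) \<otimes>\<^sub>v \<tau>N t w)))"
      unfolding J l
      by (intro allI impI ballI, elim conjE, rule J_simple_objects)
         (auto simp: is_split_simple_def left_transversal_def)
    show "\<exists>!l'. l' \<in> central_pairings G \<and> (r, l') \<in> lazy_reflections G"
      unfolding r by (rule lazy_pairing_unique)
    show "\<forall>H' C' \<delta>'. is_reflection_datum G H' C' \<delta>' \<and> reflection G H' C' \<delta>' = r \<longrightarrow>
         H' = H \<and> C' = C \<and> (\<forall>a\<in>vecs C. \<delta>' a = \<delta> a)"
      unfolding r using reflection_determines by blast
    show "is_braided_autoequivalence G (F, J) \<longleftrightarrow> (r, l) \<in> lazy_reflections G \<and> is_symmetric_iso C \<delta>"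
      unfolding lazy F J by (rule braided_iff)
    show "(r, l) \<in> lazy_reflections G \<longrightarrow>
      (\<forall>h c B \<rho>H \<rho>C M \<tau> h' c' B' \<chi>H \<chi>C N \<tau>N.
         is_split_simple G H C h c B \<rho>H \<rho>C M \<tau> \<and>
         is_split_simple G H C h' c' B' \<chi>H \<chi>C N \<tau>N \<longrightarrow>
         (\<forall>m\<in>vecs (idx M). \<forall>n\<in>vecs (idx N). J M N (m \<otimes>\<^sub>v n) = \<rho>C c' \<cdot>\<^sub>v (m \<otimes>\<^sub>v n)))"
      unfolding lazy J using J_lazy by blast
  qed
qed

end
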